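(* Let $\{X_t, t\in\mathbb{Z}\}$ be an $m$-variate time series satisfying Assumption A(4) and Assumption B (both defined in the context), and let $X_1,\ldots,X_n$ be observed. Fix indices $j,k\in\{1,\ldots,m\}$ and $\theta\in\{0,\pi\}$. Let $\tilde f_{jk}(\theta)=[1,0]\,(\mathbf X'\mathbf X)^{-1}\mathbf X'\mathbf Y$ be the local quadratic OLS estimator defined in the context (the estimated intercept). Then $\tilde f_{jk}(\theta)\to f_{jk}(\theta)$ in probability as $n\to\infty$ and $M\to\infty$ with $M/n\to 0$.
   Context: Setting: $\{X_t\}$ is a strictly stationary $\mathbb{R}^m$-valued time series with mean $\mu=EX_t$ and autocovariance $\gamma(h)=E[(X_{t+h}-\mu)(X_t-\mu)']$, with entries $\gamma_{jk}(h)$. The spectral density matrix is $f(w)=\frac{1}{2\pi}\sum_{h=-\infty}^{\infty}e^{-iwh}\gamma(h)$, with entries $f_{jk}(w)$; $f_{jk}(0)$ and $f_{jk}(\pi)$ are real. Assumption A($p$): $f(w)$ is well defined and each entry $f_{jk}(w)$ is $p$ times continuously differentiable for all real $w$. Assumption B: $\{X_t\}$ is strictly stationary and either (i) a linear process $X_t=\mu+\sum_{\ell}\Psi_\ell Z_{t-\ell}$ with i.i.d. mean-zero inputs $Z_t$ each of whose components has a finite fourth moment and with $\sum_\ell\|\Psi_\ell\|^2<\infty$, or (ii) its joint cumulants satisfy the summability condition (B1) of Taniguchi and Kakizawa (2000, p. 55), namely for every $r\ge 2$, every choice of components $a_1,\ldots,a_r$ and every $q=1,\ldots,r-1$, $\sum_{u_1,\ldots,u_{r-1}\in\mathbb{Z}}(1+|u_q|)\,|\mathrm{cum}(X_{u_1,a_1},\ldots,X_{u_{r-1},a_{r-1}},X_{0,a_r})|<\infty$.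 Estimator: $\bar X_n=n^{-1}\sum_{t=1}^n X_t$; for $0\le h<n$, $\hat\gamma(h)=n^{-1}\sum_{t=1}^{n-h}(X_{t+h}-\bar X_n)(X_t-\bar X_n)'$, $\hat\gamma(-h)=\hat\gamma(h)'$, and $\hat\gamma(h)=0$ for $|h|\ge n$. The periodogram matrix is $I(w)=\frac{1}{2\pi}\sum_h e^{-iwh}\hat\gamma(h)$ with entries $I_{jk}(w)$; $\mathcal R[\cdot]$ denotes real part. Fourier frequencies are $w_s=2\pi s/n$. Let $\delta=M/n$ (so $M=[\delta n]$). For $\theta=0$ the regression uses indices $s=1,\ldots,M$; for $\theta=\pi$ it uses $s=[n/2]-M+1,\ldots,[n/2]$. $\mathbf X$ is the $M\times 2$ matrix whose rows are $(1,(\theta-w_s)^2)$ and $\mathbf Y$ the $M$-vector with entries $\mathcal R[I_{jk}(w_s)]$, over these indices $s$. The estimator $\tilde f_{jk}(\theta)$ is the first coordinate of $(\mathbf X'\mathbf X)^{-1}\mathbf X'\mathbf Y$. *)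

theory Defs
  imports "HOL-Probability.Probability"
begin

text \<open>The process is X :: int => 'w => real^'m (time, sample point, value in R^m);
 components are indexed by the finite type 'm, so m = CARD('m).\<close>

definition strictly_stationary ::
  "'w measure \<Rightarrow> (int \<Rightarrow> 'w \<Rightarrow> real^'m) \<Rightarrow> bool" where
  "strictly_stationary P X \<longleftrightarrow>
     (\<forall>t. X t \<in> borel_measurable P) \<and>
     (\<forall>T h. finite T \<longrightarrow>
        distr P (PiM T (\<lambda>_. borel)) (\<lambda>\<omega>. \<lambda>t\<in>T. X (t + h) \<omega>) =
        distr P (PiM T (\<lambda>_. borel)) (\<lambda>\<omega>. \<lambda>t\<in>T. X t \<omega>))"

definition proc_mean :: "'w measure \<Rightarrow> (int \<Rightarrow> 'w \<Rightarrow> real^'m) \<Rightarrow> real^'m" where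
  "proc_mean P X = integral\<^sup>L P (X 0)"

text \<open>gamma_jk(h) = E[(X_{t+h,j} - mu_j)(X_{t,k} - mu_k)], taken at t = 0 (stationarity).\<close>
definition autocov :: "'w measure \<Rightarrow> (int \<Rightarrow> 'w \<Rightarrow> real^'m) \<Rightarrow> 'm \<Rightarrow> 'm \<Rightarrow> int \<Rightarrow> real" where
  "autocov P X j k h =
     integral\<^sup>L P (\<lambda>\<omega>. (X h \<omega> $ j - proc_mean P X $ j) * (X 0 \<omega> $ k - proc_mean P X $ k))"

definition spec_dens :: "'w measure \<Rightarrow> (int \<Rightarrow> 'w \<Rightarrow> real^'m) \<Rightarrow> 'm \<Rightarrow> 'm \<Rightarrow> real \<Rightarrow> complex" where
  "spec_dens P X j k w =
     complex_of_real (1 / (2 * pi)) *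
       infsum (\<lambda>h::int. exp (- \<i> * complex_of_real (w * real_of_int h)) * complex_of_real (autocov P X j k h)) UNIV"

definition C_k_real :: "nat \<Rightarrow> (real \<Rightarrow> 'b::real_normed_vector) \<Rightarrow> bool" where
  "C_k_real p g \<longleftrightarrow>
     (\<exists>D :: nat \<Rightarrow> real \<Rightarrow> 'b. D 0 = g \<and>
        (\<forall>i<p. \<forall>w. (D i has_vector_derivative D (Suc i) w) (at w)) \<and>
        continuous_on UNIV (D p))"

definition assumption_A :: "nat \<Rightarrow> 'w measure \<Rightarrow> (int \<Rightarrow> 'w \<Rightarrow> real^'m) \<Rightarrow> bool" where
  "assumption_A p P X \<longleftrightarrow>
     (\<forall>j k w. (\<lambda>h::int. exp (- \<i> * complex_of_real (w * real_of_int h)) * complex_of_real (autocov P X j k h))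
                 summable_on UNIV) \<and>
     (\<forall>j k. C_k_real p (spec_dens P X j k))"

definition joint_cumulant :: "'w measure \<Rightarrow> nat \<Rightarrow> (nat \<Rightarrow> 'w \<Rightarrow> real) \<Rightarrow> real" where
  "joint_cumulant P r Y =
     (\<Sum>Q\<in>{Q. partition_on {..<r} Q}.
        (-1) ^ (card Q - 1) * fact (card Q - 1) *
        (\<Prod>B\<in>Q. integral\<^sup>L P (\<lambda>\<omega>. \<Prod>i\<in>B. Y i \<omega>)))"

definition linear_process_cond ::
  "'w measure \<Rightarrow> (int \<Rightarrow> 'w \<Rightarrow> real^'m) \<Rightarrow> (int \<Rightarrow> 'w \<Rightarrow> real^'d) \<Rightarrow> (int \<Rightarrow> real^'d^'m) \<Rightarrow> bool" where
  "linear_process_cond P X Z \<Psi> \<longleftrightarrow>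
     prob_space.indep_vars P (\<lambda>_. borel) Z UNIV \<and>
     (\<forall>t. distr P borel (Z t) = distr P borel (Z 0)) \<and>
     (\<forall>t i. integrable P (\<lambda>\<omega>. Z t \<omega> $ i) \<and> integral\<^sup>L P (\<lambda>\<omega>. Z t \<omega> $ i) = 0) \<and>
     (\<forall>t i. integrable P (\<lambda>\<omega>. (Z t \<omega> $ i) ^ 4)) \<and>
     (\<lambda>l. (norm (\<Psi> l))\<^sup>2) summable_on UNIV \<and>
     (\<forall>t. AE \<omega> in P. (\<lambda>N::nat. proc_mean P X + (\<Sum>l\<in>{- int N..int N}. \<Psi> l *v Z (t - l) \<omega>))
                         \<longlonglongrightarrow> X t \<omega>)"

text \<open>Assumption B(ii): all moments finite and condition (B1) of Taniguchi--Kakizawa.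
  Indices are 0-based: the r variables are numbered 0..r-1, and q ranges over 0..r-2.\<close>
definition cumulant_cond :: "'w measure \<Rightarrow> (int \<Rightarrow> 'w \<Rightarrow> real^'m) \<Rightarrow> bool" where
  "cumulant_cond P X \<longleftrightarrow>
     (\<forall>t j q::nat. integrable P (\<lambda>\<omega>. \<bar>X t \<omega> $ j\<bar> ^ q)) \<and>
     (\<forall>r\<ge>2. \<forall>a :: nat \<Rightarrow> 'm. \<forall>q<r - 1.
        (\<lambda>u::nat \<Rightarrow> int. (1 + real_of_int \<bar>u q\<bar>) *
            \<bar>joint_cumulant P r (\<lambda>i \<omega>. if i < r - 1 then X (u i) \<omega> $ a i else X 0 \<omega> $ a (r - 1))\<bar>)
          summable_on (PiE {..<r - 1} (\<lambda>_. UNIV)))"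

definition assumption_B :: "'w measure \<Rightarrow> (int \<Rightarrow> 'w \<Rightarrow> real^'m) \<Rightarrow> bool" where
  "assumption_B P X \<longleftrightarrow> strictly_stationary P X \<and>
     ((\<exists>(Z :: int \<Rightarrow> 'w \<Rightarrow> real^'m) \<Psi>. linear_process_cond P X Z \<Psi>) \<or> cumulant_cond P X)"

definition sample_mean :: "nat \<Rightarrow> (int \<Rightarrow> real^'m) \<Rightarrow> real^'m" where
  "sample_mean n x = (1 / real n) *\<^sub>R (\<Sum>t\<in>{1..int n}. x t)"

definition acov_hat_nonneg :: "nat \<Rightarrow> (int \<Rightarrow> real^'m) \<Rightarrow> 'm \<Rightarrow> 'm \<Rightarrow> int \<Rightarrow> real" where
  "acov_hat_nonneg n x j k h =
     (1 / real n) * (\<Sum>t\<in>{1..int n - h}.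
        (x (t + h) $ j - sample_mean n x $ j) * (x t $ k - sample_mean n x $ k))"

definition acov_hat :: "nat \<Rightarrow> (int \<Rightarrow> real^'m) \<Rightarrow> 'm \<Rightarrow> 'm \<Rightarrow> int \<Rightarrow> real" where
  "acov_hat n x j k h =
     (if 0 \<le> h \<and> h < int n then acov_hat_nonneg n x j k h
      else if h < 0 \<and> - h < int n then acov_hat_nonneg n x k j (- h)
      else 0)"

definition periodogram :: "nat \<Rightarrow> (int \<Rightarrow> real^'m) \<Rightarrow> 'm \<Rightarrow> 'm \<Rightarrow> real \<Rightarrow> complex" where
  "periodogram n x j k w =
     complex_of_real (1 / (2 * pi)) *
       (\<Sum>h\<in>{- int n..int n}. exp (- \<i> * complex_of_real (w * real_of_int h)) * complex_of_real (acov_hat n x j k h))"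

definition fourier_freq :: "nat \<Rightarrow> nat \<Rightarrow> real" where
  "fourier_freq n s = 2 * pi * real s / real n"

definition reg_indices :: "nat \<Rightarrow> nat \<Rightarrow> real \<Rightarrow> nat set" where
  "reg_indices n M \<theta> = (if \<theta> = 0 then {1..M} else {n div 2 + 1 - M..n div 2})"

definition design_row :: "nat \<Rightarrow> real \<Rightarrow> nat \<Rightarrow> real^2" where
  "design_row n \<theta> s = (\<chi> i. if i = 1 then 1 else (\<theta> - fourier_freq n s)\<^sup>2)"

definition XtX :: "nat \<Rightarrow> nat \<Rightarrow> real \<Rightarrow> real^2^2" where
  "XtX n M \<theta> = (\<chi> a b. \<Sum>s\<in>reg_indices n M \<theta>. design_row n \<theta> s $ a * design_row n \<theta> s $ b)"

definition XtY :: "nat \<Rightarrow> nat \<Rightarrow> real \<Rightarrow> (int \<Rightarrow> real^'m) \<Rightarrow> 'm \<Rightarrow> 'm \<Rightarrow> real^2" where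
  "XtY n M \<theta> x j k = (\<chi> a. \<Sum>s\<in>reg_indices n M \<theta>.
       design_row n \<theta> s $ a * Re (periodogram n x j k (fourier_freq n s)))"

definition f_tilde :: "nat \<Rightarrow> nat \<Rightarrow> real \<Rightarrow> (int \<Rightarrow> real^'m) \<Rightarrow> 'm \<Rightarrow> 'm \<Rightarrow> real" where
  "f_tilde n M \<theta> x j k = (matrix_inv (XtX n M \<theta>) *v XtY n M \<theta> x j k) $ 1"

end

theory Submission
  imports Defs
begin

text \<open>
  The estimator is a weighted sum of \<open>Re I\<^sub>j\<^sub>k(w\<^sub>s)\<close> with weights \<open>a\<^sub>s\<close> that add up to 1 and are
  bounded by \<open>40 / M\<close>. Since the \<open>w\<^sub>s\<close> are nonzero Fourier frequencies, the sample mean may be replaced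
  by \<open>\<mu>\<close>, so the estimator equals \<open>(2 \<pi> n)\<^sup>-\<^sup>1 \<Sum>\<^sub>t\<^sub>,\<^sub>u W(t - u) (X\<^sub>t\<^sub>j - \<mu>\<^sub>j) (X\<^sub>u\<^sub>k - \<mu>\<^sub>k)\<close> with
  \<open>W(h) = \<Sum>\<^sub>s a\<^sub>s cos(w\<^sub>s h)\<close>. As \<open>\<gamma>\<close> is absolutely summable and \<open>W(h)\<close> tends to \<open>cos(\<theta> h)\<close>, the mean
  converges to \<open>f\<^sub>j\<^sub>k(\<theta>)\<close> by dominated convergence.

  The variance splits into a Gaussian part and a fourth-order cumulant part. The Gaussian part is
  \<open>O(1 / M)\<close> by Schur's test and Parseval, which bounds \<open>n\<^sup>-\<^sup>2 \<Sum>\<^sub>t\<^sub>,\<^sub>u W(t - u)\<^sup>2\<close> by \<open>\<Sum>\<^sub>s a\<^sub>s\<^sup>2\<close>. Under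
  summable cumulants the other part is \<open>O(1 / n)\<close>. For a linear process with merely square summable
  coefficients, cumulants add up over the independent inputs; the contribution of one input to a
  discrete Fourier transform has variance \<open>o(n)\<close> uniformly in the input, while the sum of these
  variances is \<open>O(n)\<close>, so the cumulant part is \<open>o(1)\<close>. The infinite moving average is reached by
  truncation, with Fatou's lemma for the variance.
\<close>

section \<open>Fourth moments and fourth-order cumulants\<close>

text \<open>The obstacle is the linear case. Coefficients that are only square summable do not make
  the fourth-order cumulants absolutely summable, and the autocovariances of truncated moving
  averages are not known to be summable uniformly in the truncation, since
  \<open>assumption_A\<close> speaks about \<open>X\<close> alone. Hence the bound for truncations
  carries their covariances along without estimating them; the truncation length tends to infinity
  at fixed \<open>n\<close>, and absolute summability enters only in the limit. Single inputs are
  measured by \<open>var_form\<close> and not by the norm of their coefficient, because sums of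
  \<open>var_form\<close> over the inputs are variances and can be expressed through
  autocovariances, while norms of coefficients of a degenerate input cannot. Both alternatives of
  Assumption B meet in \<open>gaussian_quadratic_forms\<close>; its remainder has to be uniform in
  the weights because the weights change with \<open>n\<close>. The constant 40 is the reciprocal of
  the factor in the lower bound M^6 / 40 for the determinant of the design.\<close>

context prob_space
begin

definition L4 :: "('a \<Rightarrow> real) \<Rightarrow> bool" where
  "L4 f \<longleftrightarrow> f \<in> borel_measurable M \<and> integrable M (\<lambda>x. f x ^ 4)"

lemma L4_measurable [measurable_dest]: "L4 f \<Longrightarrow> f \<in> borel_measurable M"
  by (simp add: L4_def)

lemma L4_const: "L4 (\<lambda>_. c)"
  by (simp add: L4_def)

text \<open>Repeated use of 2 |u v| <= u^2 + v^2 dominates the product by the fourth powers. Since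
  constants lie in \<open>L4\<close>, products of fewer factors are instances with factors
  1.\<close>

lemma L4_mult4:
  assumes "L4 a" "L4 b" "L4 c" "L4 d"
  shows "integrable M (\<lambda>x. a x * b x * c x * d x)"
proof (rule Bochner_Integration.integrable_bound)
  show "integrable M (\<lambda>x. a x ^ 4 + b x ^ 4 + c x ^ 4 + d x ^ 4)"
    using assms by (auto simp: L4_def)
  show "(\<lambda>x. a x * b x * c x * d x) \<in> borel_measurable M"
    using assms by (auto simp: L4_def)
  have *: "\<bar>u * v\<bar> \<le> (u\<^sup>2 + v\<^sup>2) / 2" for u v :: real
    using sum_squares_bound[of "\<bar>u\<bar>" "\<bar>v\<bar>"] by (simp add: abs_mult)
  have "\<bar>a * b * c * d\<bar> \<le> a ^ 4 + b ^ 4 + c ^ 4 + d ^ 4" for a b c d :: real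
  proof -
    have "\<bar>a * b * c * d\<bar> \<le> ((a * b)\<^sup>2 + (c * d)\<^sup>2) / 2"
      using *[of "a * b" "c * d"] by (simp add: mult.assoc)
    also have "(a * b)\<^sup>2 \<le> (a ^ 4 + b ^ 4) / 2"
      using *[of "a\<^sup>2" "b\<^sup>2"] by (simp add: power_mult_distrib flip: power_mult)
    also have "(c * d)\<^sup>2 \<le> (c ^ 4 + d ^ 4) / 2"
      using *[of "c\<^sup>2" "d\<^sup>2"] by (simp add: power_mult_distrib flip: power_mult)
    finally have "\<bar>a * b * c * d\<bar> \<le> (a ^ 4 + b ^ 4 + (c ^ 4 + d ^ 4)) / 4"
      by (simp add: field_simps)
    moreover have "0 \<le> a ^ 4" "0 \<le> b ^ 4" "0 \<le> c ^ 4" "0 \<le> d ^ 4" by auto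
    moreover have "X \<le> p + q + r + s"
      if "X \<le> (p + q + (r + s)) / 4" "0 \<le> p" "0 \<le> q" "0 \<le> r" "0 \<le> s" for X p q r s :: real
      using that by (simp add: field_simps)
    ultimately show ?thesis by blast
  qed
  then show "AE x in M. norm (a x * b x * c x * d x) \<le> norm (a x ^ 4 + b x ^ 4 + c x ^ 4 + d x ^ 4)"
    by (intro AE_I2) (smt (verit) real_norm_def)
qed

lemma L4_mult3:
  assumes "L4 a" "L4 b" "L4 c"
  shows "integrable M (\<lambda>x. a x * b x * c x)"
  using L4_mult4[OF assms L4_const[of 1]] by simp

lemma L4_mult2:
  assumes "L4 a" "L4 b"
  shows "integrable M (\<lambda>x. a x * b x)"
  using L4_mult3[OF assms L4_const[of 1]] by simp

lemma L4_integrable: "L4 a \<Longrightarrow> integrable M a"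
  using L4_mult2[OF _ L4_const[of 1]] by simp

lemma L4_add:
  assumes "L4 a" "L4 b"
  shows "L4 (\<lambda>x. a x + b x)"
proof -
  have "(\<lambda>x. (a x + b x) ^ 4) = (\<lambda>x. a x * a x * a x * a x + 4 * (a x * a x * a x * b x) +
      6 * (a x * a x * b x * b x) + 4 * (a x * b x * b x * b x) + b x * b x * b x * b x)"
    by (auto simp: algebra_simps power4_eq_xxxx)
  then have "integrable M (\<lambda>x. (a x + b x) ^ 4)"
    using assms by (auto intro!: Bochner_Integration.integrable_add integrable_mult_right L4_mult4)
  then show ?thesis
    using assms by (auto simp: L4_def)
qed

lemma L4_cmult: "L4 a \<Longrightarrow> L4 (\<lambda>x. r * a x)"
  by (auto simp: L4_def power_mult_distrib)

lemma L4_sum: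
  assumes "\<And>i. i \<in> I \<Longrightarrow> L4 (A i)"
  shows "L4 (\<lambda>x. \<Sum>i\<in>I. A i x)"
  using assms by (induction I rule: infinite_finite_induct) (auto intro: L4_add L4_const)

text \<open>This is the fourth joint cumulant only for variables of mean zero. It is multilinear for
  all arguments; \<open>cum4_centered\<close> treats variables with a mean.\<close>

definition cum4 :: "('a \<Rightarrow> real) \<Rightarrow> ('a \<Rightarrow> real) \<Rightarrow> ('a \<Rightarrow> real) \<Rightarrow> ('a \<Rightarrow> real) \<Rightarrow> real" where
  "cum4 a b c d = expectation (\<lambda>x. a x * b x * c x * d x)
     - expectation (\<lambda>x. a x * b x) * expectation (\<lambda>x. c x * d x)
     - expectation (\<lambda>x. a x * c x) * expectation (\<lambda>x. b x * d x)
     - expectation (\<lambda>x. a x * d x) * expectation (\<lambda>x. b x * c x)"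

text \<open>These transpositions bring any argument to the first place, so that linearity has to be
  proved there only.\<close>

lemma cum4_swap:
  "cum4 a b c d = cum4 b a c d" "cum4 a b c d = cum4 c b a d" "cum4 a b c d = cum4 d b c a"
  by (simp_all add: cum4_def ac_simps)

lemma expectation_sum_mult:
  fixes A :: "'i \<Rightarrow> 'a \<Rightarrow> real" and g :: "'a \<Rightarrow> real"
  assumes "\<And>i. i \<in> I \<Longrightarrow> integrable M (\<lambda>x. A i x * g x)"
  shows "expectation (\<lambda>x. (\<Sum>i\<in>I. r i * A i x) * g x) = (\<Sum>i\<in>I. r i * expectation (\<lambda>x. A i x * g x))"
proof -
  have "expectation (\<lambda>x. (\<Sum>i\<in>I. r i * A i x) * g x) = expectation (\<lambda>x. \<Sum>i\<in>I. r i * (A i x * g x))"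
    by (simp only: sum_distrib_right mult.assoc)
  also have "\<dots> = (\<Sum>i\<in>I. r i * expectation (\<lambda>x. A i x * g x))"
    using assms by (subst Bochner_Integration.integral_sum) auto
  finally show ?thesis .
qed

lemma cum4_sum1:
  assumes "\<And>i. i \<in> I \<Longrightarrow> L4 (A i)" "L4 b" "L4 c" "L4 d"
  shows "cum4 (\<lambda>x. \<Sum>i\<in>I. r i * A i x) b c d = (\<Sum>i\<in>I. r i * cum4 (A i) b c d)"
proof -
  let ?S = "\<lambda>x. \<Sum>i\<in>I. r i * A i x"
  have "expectation (\<lambda>x. ?S x * b x * c x * d x) =
      (\<Sum>i\<in>I. r i * expectation (\<lambda>x. A i x * b x * c x * d x))"
    using expectation_sum_mult[of I A "\<lambda>x. b x * c x * d x" r] L4_mult4[OF assms(1) assms(2-4)]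
    by (simp add: mult.assoc)
  moreover have "expectation (\<lambda>x. ?S x * g x) = (\<Sum>i\<in>I. r i * expectation (\<lambda>x. A i x * g x))"
    if "L4 g" for g
    using that assms by (intro expectation_sum_mult L4_mult2) auto
  ultimately show ?thesis
    using assms(2-4) unfolding cum4_def
    by (simp add: sum_distrib_right sum_subtractf right_diff_distrib mult.assoc)
qed

lemma cum4_sum:
  assumes A: "\<And>i. i \<in> I \<Longrightarrow> L4 (A i)" and B: "\<And>i. i \<in> I \<Longrightarrow> L4 (B i)"
    and C: "\<And>i. i \<in> I \<Longrightarrow> L4 (C i)" and D: "\<And>i. i \<in> I \<Longrightarrow> L4 (D i)"
  shows "cum4 (\<lambda>x. \<Sum>i\<in>I. r1 i * A i x) (\<lambda>x. \<Sum>i\<in>I. r2 i * B i x)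
     (\<lambda>x. \<Sum>i\<in>I. r3 i * C i x) (\<lambda>x. \<Sum>i\<in>I. r4 i * D i x) =
     (\<Sum>i\<in>I. \<Sum>j\<in>I. \<Sum>k\<in>I. \<Sum>l\<in>I. r1 i * r2 j * r3 k * r4 l * cum4 (A i) (B j) (C k) (D l))"
proof -
  have L: "L4 (\<lambda>x. \<Sum>i\<in>I. r i * E i x)" if "\<And>i. i \<in> I \<Longrightarrow> L4 (E i)" for E r
    using that by (intro L4_sum L4_cmult)
  have 2: "cum4 a (\<lambda>x. \<Sum>i\<in>I. r i * E i x) c d = (\<Sum>i\<in>I. r i * cum4 a (E i) c d)"
    if "L4 a" "\<And>i. i \<in> I \<Longrightarrow> L4 (E i)" "L4 c" "L4 d" for E a c d r
    using cum4_sum1[of I E a c d r] that by (simp add: cum4_swap(1)[of a])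
  have 3: "cum4 a b (\<lambda>x. \<Sum>i\<in>I. r i * E i x) d = (\<Sum>i\<in>I. r i * cum4 a b (E i) d)"
    if "L4 a" "\<And>i. i \<in> I \<Longrightarrow> L4 (E i)" "L4 b" "L4 d" for E a b d r
    using cum4_sum1[of I E b a d r] that by (simp add: cum4_swap(2)[of a])
  have 4: "cum4 a b c (\<lambda>x. \<Sum>i\<in>I. r i * E i x) = (\<Sum>i\<in>I. r i * cum4 a b c (E i))"
    if "L4 a" "\<And>i. i \<in> I \<Longrightarrow> L4 (E i)" "L4 b" "L4 c" for E a b c r
    using cum4_sum1[of I E b c a r] that by (simp add: cum4_swap(3)[of a])
  show ?thesis
    by (simp add: cum4_sum1 2 3 4 L A B C D sum_distrib_left mult.assoc)
qed

text \<open>Expanding the square yields fourth moments, and the definition of \<open>cum4\<close>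
  splits each of them into a cumulant and three pairings. The pairing that keeps \<open>A i\<close>
  with \<open>B i\<close> rebuilds the squared mean, which merges with \<open>c\<close> into a
  squared bias; the other two pairings are the Gaussian part.\<close>

lemma expectation_quadratic_form:
  fixes A B :: "'i \<Rightarrow> 'a \<Rightarrow> real"
  assumes A: "\<And>i. i \<in> I \<Longrightarrow> L4 (A i)" and B: "\<And>i. i \<in> I \<Longrightarrow> L4 (B i)"
  shows "integrable M (\<lambda>x. ((\<Sum>i\<in>I. w i * (A i x * B i x)) - c) ^ 2)"
    and "expectation (\<lambda>x. ((\<Sum>i\<in>I. w i * (A i x * B i x)) - c) ^ 2) =
     ((\<Sum>i\<in>I. w i * expectation (\<lambda>x. A i x * B i x)) - c) ^ 2 +
     (\<Sum>i\<in>I. \<Sum>j\<in>I. w i * w j *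
       (expectation (\<lambda>x. A i x * A j x) * expectation (\<lambda>x. B i x * B j x) +
        expectation (\<lambda>x. A i x * B j x) * expectation (\<lambda>x. B i x * A j x))) +
     (\<Sum>i\<in>I. \<Sum>j\<in>I. w i * w j * cum4 (A i) (B i) (A j) (B j))"
proof -
  let ?Q = "\<lambda>x. \<Sum>i\<in>I. w i * (A i x * B i x)"
  have sq: "(?Q x) ^ 2 = (\<Sum>i\<in>I. \<Sum>j\<in>I. w i * w j * (A i x * B i x * A j x * B j x))" for x
    by (simp add: power2_eq_square sum_product mult_ac)
  have i4: "integrable M (\<lambda>x. w i * w j * (A i x * B i x * A j x * B j x))" if "i \<in> I" "j \<in> I" for i j
    using that A B by (intro integrable_mult_right L4_mult4)
  have 1: "integrable M (\<lambda>x. (?Q x) ^ 2)"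
    unfolding sq using i4 by (intro Bochner_Integration.integrable_sum)
  have 2: "integrable M ?Q"
    using A B by (intro Bochner_Integration.integrable_sum integrable_mult_right L4_mult2)
  have eq: "(?Q x - c) ^ 2 = (?Q x) ^ 2 - 2 * c * ?Q x + c ^ 2" for x
    by (simp add: power2_diff)
  show "integrable M (\<lambda>x. (?Q x - c) ^ 2)"
    unfolding eq using 1 2 by auto
  have E1: "expectation ?Q = (\<Sum>i\<in>I. w i * expectation (\<lambda>x. A i x * B i x))" (is "_ = ?m")
    using A B by (subst Bochner_Integration.integral_sum) (auto intro!: L4_mult2)
  have E2: "expectation (\<lambda>x. (?Q x) ^ 2) =
      (\<Sum>i\<in>I. \<Sum>j\<in>I. w i * w j * expectation (\<lambda>x. A i x * B i x * A j x * B j x))"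
    unfolding sq using i4 by (simp add: Bochner_Integration.integral_sum Bochner_Integration.integrable_sum)
  have m2: "?m ^ 2 = (\<Sum>i\<in>I. \<Sum>j\<in>I. w i * w j * 
      (expectation (\<lambda>x. A i x * B i x) * expectation (\<lambda>x. A j x * B j x)))"
    by (simp add: power2_eq_square sum_product mult_ac)
  have "expectation (\<lambda>x. (?Q x - c) ^ 2) = expectation (\<lambda>x. (?Q x) ^ 2) - 2 * c * ?m + c ^ 2"
    unfolding eq using 1 2 by (simp add: E1 prob_space)
  also have "\<dots> = (?m - c) ^ 2 + (expectation (\<lambda>x. (?Q x) ^ 2) - ?m ^ 2)"
    by (simp add: power2_diff)
  also have "expectation (\<lambda>x. (?Q x) ^ 2) - ?m ^ 2 = 
     (\<Sum>i\<in>I. \<Sum>j\<in>I. w i * w j *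
       (expectation (\<lambda>x. A i x * A j x) * expectation (\<lambda>x. B i x * B j x) +
        expectation (\<lambda>x. A i x * B j x) * expectation (\<lambda>x. B i x * A j x))) +
     (\<Sum>i\<in>I. \<Sum>j\<in>I. w i * w j * cum4 (A i) (B i) (A j) (B j))"
    unfolding E2 m2 cum4_def
    by (simp add: sum.distrib[symmetric] sum_subtractf[symmetric] algebra_simps)
  finally show "expectation (\<lambda>x. (?Q x - c) ^ 2) = (?m - c) ^ 2 + 
     (\<Sum>i\<in>I. \<Sum>j\<in>I. w i * w j *
       (expectation (\<lambda>x. A i x * A j x) * expectation (\<lambda>x. B i x * B j x) +
        expectation (\<lambda>x. A i x * B j x) * expectation (\<lambda>x. B i x * A j x))) +
     (\<Sum>i\<in>I. \<Sum>j\<in>I. w i * w j * cum4 (A i) (B i) (A j) (B j))"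
    by simp
qed

end

section \<open>Linear forms in independent vectors\<close>

locale indep_vectors = prob_space +
  fixes Z :: "int \<Rightarrow> 'a \<Rightarrow> 'v::euclidean_space"
  assumes indep: "indep_vars (\<lambda>_. borel) Z UNIV"
    and distr_eq: "\<And>t. distr M borel (Z t) = distr M borel (Z 0)"
    and L4_inner: "\<And>v. L4 (\<lambda>x. v \<bullet> Z 0 x)"
    and mean_inner: "\<And>v. expectation (\<lambda>x. v \<bullet> Z 0 x) = 0"
begin

lemma Z_measurable [measurable]: "Z l \<in> borel_measurable M"
  using indep by (auto simp: indep_vars_def)

lemma expectation_Z:
  fixes g :: "'v \<Rightarrow> real"
  assumes [measurable]: "g \<in> borel_measurable borel"
  shows "expectation (\<lambda>x. g (Z l x)) = expectation (\<lambda>x. g (Z 0 x))"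
  using integral_distr[of "Z l" M borel g] integral_distr[of "Z 0" M borel g] distr_eq[of l] by simp

lemma integrable_Z:
  fixes g :: "'v \<Rightarrow> real"
  assumes [measurable]: "g \<in> borel_measurable borel"
  shows "integrable M (\<lambda>x. g (Z l x)) \<longleftrightarrow> integrable M (\<lambda>x. g (Z 0 x))"
  using integrable_distr_eq[of "Z l" M borel g] integrable_distr_eq[of "Z 0" M borel g] distr_eq[of l] by simp

lemma L4_form: "L4 (\<lambda>x. v \<bullet> Z l x)"
proof -
  have "integrable M (\<lambda>x. (v \<bullet> Z l x) ^ 4)"
    using L4_inner[of v] integrable_Z[of "\<lambda>z. (v \<bullet> z) ^ 4" l] by (simp add: L4_def)
  then show ?thesis
    by (simp add: L4_def)
qed

lemma mean_form: "expectation (\<lambda>x. v \<bullet> Z l x) = 0"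
  using mean_inner[of v] expectation_Z[of "\<lambda>z. v \<bullet> z" l] by simp

definition lin_form :: "(int \<Rightarrow> 'v) \<Rightarrow> int set \<Rightarrow> 'a \<Rightarrow> real" where
  "lin_form A L x = (\<Sum>l\<in>L. A l \<bullet> Z l x)"

lemma L4_lin_form: "L4 (lin_form A L)"
  unfolding lin_form_def[abs_def] by (intro L4_sum L4_form)

text \<open>The family restricted to \<open>L\<close> is treated as one random element, so
  independence of disjoint blocks gives the factorisation. Splitting off one input at a time is what
  inductions over the inputs need.\<close>

lemma expectation_indep_mult:
  fixes F :: "(int \<Rightarrow> 'v) \<Rightarrow> real" and G :: "'v \<Rightarrow> real"
  assumes "m \<notin> L" and F: "F \<in> borel_measurable (PiM L (\<lambda>_. borel))" and [measurable]: "G \<in> borel_measurable borel"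
    and iF: "integrable M (\<lambda>x. F (\<lambda>l\<in>L. Z l x))" and iG: "integrable M (\<lambda>x. G (Z m x))"
  shows "expectation (\<lambda>x. F (\<lambda>l\<in>L. Z l x) * G (Z m x)) =
     expectation (\<lambda>x. F (\<lambda>l\<in>L. Z l x)) * expectation (\<lambda>x. G (Z m x))"
proof -
  have "indep_var (PiM L (\<lambda>_. borel)) (\<lambda>x. \<lambda>l\<in>L. Z l x) (PiM {m} (\<lambda>_. borel)) (\<lambda>x. \<lambda>l\<in>{m}. Z l x)"
    using assms(1) by (intro indep_var_restrict[OF indep]) auto
  moreover have "(\<lambda>z. G (z m)) \<in> borel_measurable (PiM {m} (\<lambda>_. borel))"
    by measurable
  ultimately have "indep_var borel (F \<circ> (\<lambda>x. \<lambda>l\<in>L. Z l x)) borel ((\<lambda>z. G (z m)) \<circ> (\<lambda>x. \<lambda>l\<in>{m}. Z l x))"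
    using F by (intro indep_var_compose)
  then have "indep_var borel (\<lambda>x. F (\<lambda>l\<in>L. Z l x)) borel (\<lambda>x. G (Z m x))"
    by (simp add: o_def)
  then show ?thesis
    using iF iG by (rule indep_var_lebesgue_integral)
qed

lemma lin_form_insert:
  assumes "finite L" "m \<notin> L"
  shows "lin_form A (insert m L) = (\<lambda>x. lin_form A L x + A m \<bullet> Z m x)"
  using assms by (auto simp: lin_form_def)

text \<open>The two digits count the factors taken from the block \<open>L\<close> and from the new
  input \<open>m\<close>. Terms with a single factor of the new input vanish because it has mean
  zero.\<close>

lemma
  assumes "m \<notin> L"
  shows expectation_lin_form_11: "expectation (\<lambda>x. lin_form A L x * (b \<bullet> Z m x)) = 0"
    and expectation_lin_form_13: "expectation (\<lambda>x. lin_form A L x * ((b \<bullet> Z m x) * (c \<bullet> Z m x) * (d \<bullet> Z m x))) =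
      expectation (lin_form A L) * expectation (\<lambda>x. (b \<bullet> Z m x) * (c \<bullet> Z m x) * (d \<bullet> Z m x))"
    and expectation_lin_form_22: "expectation (\<lambda>x. (lin_form A L x * lin_form B L x) * ((c \<bullet> Z m x) * (d \<bullet> Z m x))) =
      expectation (\<lambda>x. lin_form A L x * lin_form B L x) * expectation (\<lambda>x. (c \<bullet> Z m x) * (d \<bullet> Z m x))"
    and expectation_lin_form_31: "expectation (\<lambda>x. (lin_form A L x * lin_form B L x * lin_form C L x) * (d \<bullet> Z m x)) = 0"
proof -
  have [measurable]: "(\<lambda>z. \<Sum>l\<in>L. A l \<bullet> z l) \<in> borel_measurable (PiM L (\<lambda>_. borel))" for A :: "int \<Rightarrow> 'v"
    by measurable
  note iL = L4_integrable[OF L4_lin_form] L4_mult2[OF L4_lin_form L4_lin_form]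
    L4_mult3[OF L4_lin_form L4_lin_form L4_lin_form]
  note iZ = L4_integrable[OF L4_form] L4_mult2[OF L4_form L4_form] L4_mult3[OF L4_form L4_form L4_form]
  show "expectation (\<lambda>x. lin_form A L x * (b \<bullet> Z m x)) = 0"
    using expectation_indep_mult[OF assms, of "\<lambda>z. \<Sum>l\<in>L. A l \<bullet> z l" "\<lambda>z. b \<bullet> z"] iL iZ
    by (simp add: lin_form_def[symmetric] mean_form)
  show "expectation (\<lambda>x. lin_form A L x * ((b \<bullet> Z m x) * (c \<bullet> Z m x) * (d \<bullet> Z m x))) =
      expectation (lin_form A L) * expectation (\<lambda>x. (b \<bullet> Z m x) * (c \<bullet> Z m x) * (d \<bullet> Z m x))"
    using expectation_indep_mult[OF assms, of "\<lambda>z. \<Sum>l\<in>L. A l \<bullet> z l" "\<lambda>z. (b \<bullet> z) * (c \<bullet> z) * (d \<bullet> z)"] iL iZ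
    by (simp add: lin_form_def[symmetric])
  show "expectation (\<lambda>x. (lin_form A L x * lin_form B L x) * ((c \<bullet> Z m x) * (d \<bullet> Z m x))) =
      expectation (\<lambda>x. lin_form A L x * lin_form B L x) * expectation (\<lambda>x. (c \<bullet> Z m x) * (d \<bullet> Z m x))"
    using expectation_indep_mult[OF assms, of "\<lambda>z. (\<Sum>l\<in>L. A l \<bullet> z l) * (\<Sum>l\<in>L. B l \<bullet> z l)" "\<lambda>z. (c \<bullet> z) * (d \<bullet> z)"] iL iZ
    by (simp add: lin_form_def[symmetric])
  show "expectation (\<lambda>x. (lin_form A L x * lin_form B L x * lin_form C L x) * (d \<bullet> Z m x)) = 0"
    using expectation_indep_mult[OF assms, of "\<lambda>z. (\<Sum>l\<in>L. A l \<bullet> z l) * (\<Sum>l\<in>L. B l \<bullet> z l) * (\<Sum>l\<in>L. C l \<bullet> z l)" "\<lambda>z. d \<bullet> z"] iL iZ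
    by (simp add: lin_form_def[symmetric] mean_form)
qed

lemma expectation_lin_form: "expectation (lin_form A L) = 0"
proof -
  have "expectation (lin_form A L) = (\<Sum>l\<in>L. expectation (\<lambda>x. A l \<bullet> Z l x))"
    unfolding lin_form_def[abs_def] by (intro Bochner_Integration.integral_sum L4_integrable L4_form)
  then show ?thesis by (simp add: mean_form)
qed

lemma expectation_lin_form_mult_insert:
  assumes "finite L" "m \<notin> L"
  shows "expectation (\<lambda>x. lin_form A (insert m L) x * lin_form B (insert m L) x) =
    expectation (\<lambda>x. lin_form A L x * lin_form B L x) + expectation (\<lambda>x. (A m \<bullet> Z m x) * (B m \<bullet> Z m x))"
proof -
  let ?a = "lin_form A L" and ?b = "lin_form B L" and ?a' = "\<lambda>x. A m \<bullet> Z m x" and ?b' = "\<lambda>x. B m \<bullet> Z m x"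
  have "(\<lambda>x. lin_form A (insert m L) x * lin_form B (insert m L) x) =
     (\<lambda>x. ?a x * ?b x + ?a x * ?b' x + ?b x * ?a' x + ?a' x * ?b' x)"
    using assms by (simp add: lin_form_insert algebra_simps)
  then show ?thesis
    using assms(2) by (simp add: L4_mult2 L4_lin_form L4_form expectation_lin_form_11)
qed

lemma expectation_lin_form_mult:
  assumes "finite L"
  shows "expectation (\<lambda>x. lin_form A L x * lin_form B L x) = (\<Sum>l\<in>L. expectation (\<lambda>x. (A l \<bullet> Z l x) * (B l \<bullet> Z l x)))"
  using assms
proof (induction L rule: finite_induct)
  case empty
  then show ?case by (simp add: lin_form_def)
next
  case (insert m L)
  then show ?case by (simp add: expectation_lin_form_mult_insert)
qed

text \<open>The six mixed second-order terms of the fourth moment are exactly cancelled by the products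
  of second moments.\<close>
lemma cum4_lin_form_insert:
  assumes "finite L" "m \<notin> L"
  shows "cum4 (lin_form A (insert m L)) (lin_form B (insert m L)) (lin_form C (insert m L)) (lin_form D (insert m L)) =
     cum4 (lin_form A L) (lin_form B L) (lin_form C L) (lin_form D L) +
     cum4 (\<lambda>x. A m \<bullet> Z m x) (\<lambda>x. B m \<bullet> Z m x) (\<lambda>x. C m \<bullet> Z m x) (\<lambda>x. D m \<bullet> Z m x)"
proof -
  define a b c d where "a = lin_form A L" "b = lin_form B L" "c = lin_form C L" "d = lin_form D L"
  define a' b' c' d' where "a' = (\<lambda>x. A m \<bullet> Z m x)" "b' = (\<lambda>x. B m \<bullet> Z m x)"
    "c' = (\<lambda>x. C m \<bullet> Z m x)" "d' = (\<lambda>x. D m \<bullet> Z m x)"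
  note df = a_b_c_d_def a'_b'_c'_d'_def
  have L: "L4 a" "L4 b" "L4 c" "L4 d" "L4 a'" "L4 b'" "L4 c'" "L4 d'"
    by (auto simp: df L4_lin_form L4_form)
  let ?E = expectation
  have zero: "?E (\<lambda>x. a x * (b' x * c' x * d' x)) = 0" "?E (\<lambda>x. b x * (a' x * c' x * d' x)) = 0"
    "?E (\<lambda>x. c x * (a' x * b' x * d' x)) = 0" "?E (\<lambda>x. d x * (a' x * b' x * c' x)) = 0"
    "?E (\<lambda>x. a x * b x * c x * d' x) = 0" "?E (\<lambda>x. a x * b x * d x * c' x) = 0"
    "?E (\<lambda>x. a x * c x * d x * b' x) = 0" "?E (\<lambda>x. b x * c x * d x * a' x) = 0"
    by (simp_all only: df expectation_lin_form_13[OF assms(2)] expectation_lin_form_31[OF assms(2)]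
        expectation_lin_form mult_zero_left)
  have two: "?E (\<lambda>x. (a x * b x) * (c' x * d' x)) = ?E (\<lambda>x. a x * b x) * ?E (\<lambda>x. c' x * d' x)"
    "?E (\<lambda>x. (a x * c x) * (b' x * d' x)) = ?E (\<lambda>x. a x * c x) * ?E (\<lambda>x. b' x * d' x)"
    "?E (\<lambda>x. (a x * d x) * (b' x * c' x)) = ?E (\<lambda>x. a x * d x) * ?E (\<lambda>x. b' x * c' x)"
    "?E (\<lambda>x. (b x * c x) * (a' x * d' x)) = ?E (\<lambda>x. b x * c x) * ?E (\<lambda>x. a' x * d' x)"
    "?E (\<lambda>x. (b x * d x) * (a' x * c' x)) = ?E (\<lambda>x. b x * d x) * ?E (\<lambda>x. a' x * c' x)"
    "?E (\<lambda>x. (c x * d x) * (a' x * b' x)) = ?E (\<lambda>x. c x * d x) * ?E (\<lambda>x. a' x * b' x)"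
    by (simp_all only: df expectation_lin_form_22[OF assms(2)])
  have int: "integrable M (\<lambda>x. p x * u x * r x * s x)" "integrable M (\<lambda>x. p x * u x * (r x * s x))"
      "integrable M (\<lambda>x. p x * (u x * r x * s x))"
    if "L4 p" "L4 u" "L4 r" "L4 s" for p u r s
    using L4_mult4[OF that] by (simp_all add: mult.assoc)
  \<comment> \<open>The sixteen products are sorted by their degree in the new input: 0 and 4, then
    3, then 1, then 2. The facts \<open>zero\<close> remove degrees 3 and 1; the facts
    \<open>two\<close> factor degree 2.\<close>
  have eq: "(\<lambda>x. (a x + a' x) * (b x + b' x) * (c x + c' x) * (d x + d' x)) = (\<lambda>x.
     a x * b x * c x * d x + a' x * b' x * c' x * d' x +
     (a x * (b' x * c' x * d' x) + b x * (a' x * c' x * d' x) + c x * (a' x * b' x * d' x) + d x * (a' x * b' x * c' x)) +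
     (a x * b x * c x * d' x + a x * b x * d x * c' x + a x * c x * d x * b' x + b x * c x * d x * a' x) +
     ((a x * b x) * (c' x * d' x) + (a x * c x) * (b' x * d' x) + (a x * d x) * (b' x * c' x) +
      (b x * c x) * (a' x * d' x) + (b x * d x) * (a' x * c' x) + (c x * d x) * (a' x * b' x)))"
    by (simp add: algebra_simps)
  have E4: "?E (\<lambda>x. (a x + a' x) * (b x + b' x) * (c x + c' x) * (d x + d' x)) =
    ?E (\<lambda>x. a x * b x * c x * d x) + ?E (\<lambda>x. a' x * b' x * c' x * d' x) +
     (?E (\<lambda>x. a x * b x) * ?E (\<lambda>x. c' x * d' x) + ?E (\<lambda>x. a x * c x) * ?E (\<lambda>x. b' x * d' x) +
      ?E (\<lambda>x. a x * d x) * ?E (\<lambda>x. b' x * c' x) + ?E (\<lambda>x. b x * c x) * ?E (\<lambda>x. a' x * d' x) +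
      ?E (\<lambda>x. b x * d x) * ?E (\<lambda>x. a' x * c' x) + ?E (\<lambda>x. c x * d x) * ?E (\<lambda>x. a' x * b' x))"
    unfolding eq
    by (simp only: Bochner_Integration.integral_add Bochner_Integration.integrable_add int L zero two add_0_right)
  have E2: "?E (\<lambda>x. (lin_form U L x + U m \<bullet> Z m x) * (lin_form V L x + V m \<bullet> Z m x)) =
      ?E (\<lambda>x. lin_form U L x * lin_form V L x) + ?E (\<lambda>x. (U m \<bullet> Z m x) * (V m \<bullet> Z m x))" for U V
    using expectation_lin_form_mult_insert[OF assms] by (simp add: lin_form_insert[OF assms])
  note E2' = E2[of A B] E2[of A C] E2[of A D] E2[of B C] E2[of B D] E2[of C D]
  show ?thesis
    unfolding lin_form_insert[OF assms] cum4_def E2' E4[unfolded df]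
    by (simp add: algebra_simps)
qed

lemma cum4_lin_form:
  assumes "finite L"
  shows "cum4 (lin_form A L) (lin_form B L) (lin_form C L) (lin_form D L) =
     (\<Sum>l\<in>L. cum4 (\<lambda>x. A l \<bullet> Z l x) (\<lambda>x. B l \<bullet> Z l x) (\<lambda>x. C l \<bullet> Z l x) (\<lambda>x. D l \<bullet> Z l x))"
  using assms
proof (induction L rule: finite_induct)
  case empty
  then show ?case by (simp add: lin_form_def cum4_def)
next
  case (insert m L)
  then show ?case by (simp add: cum4_lin_form_insert)
qed

section \<open>Moments of a single input in terms of its variance\<close>

definition var_form :: "'v \<Rightarrow> real" where
  "var_form v = expectation (\<lambda>x. (v \<bullet> Z 0 x)\<^sup>2)"

lemma var_form_nonneg: "0 \<le> var_form v"
  by (simp add: var_form_def)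

lemma var_form_eq: "expectation (\<lambda>x. (v \<bullet> Z l x) * (v \<bullet> Z l x)) = var_form v"
  using expectation_Z[of "\<lambda>z. (v \<bullet> z) * (v \<bullet> z)" l] by (simp add: var_form_def power2_eq_square)

lemma cum4_form:
  "cum4 (\<lambda>x. a \<bullet> Z l x) (\<lambda>x. b \<bullet> Z l x) (\<lambda>x. c \<bullet> Z l x) (\<lambda>x. d \<bullet> Z l x) =
   cum4 (\<lambda>x. a \<bullet> Z 0 x) (\<lambda>x. b \<bullet> Z 0 x) (\<lambda>x. c \<bullet> Z 0 x) (\<lambda>x. d \<bullet> Z 0 x)"
  unfolding cum4_def
  using expectation_Z[of "\<lambda>z. (a \<bullet> z) * (b \<bullet> z) * (c \<bullet> z) * (d \<bullet> z)" l]
    expectation_Z[of "\<lambda>z. (u \<bullet> z) * (v \<bullet> z)" l for u v] by simp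

lemma var_form_eq_0_AE:
  assumes "var_form v = 0"
  shows "AE x in M. v \<bullet> Z 0 x = 0"
proof -
  have "integrable M (\<lambda>x. (v \<bullet> Z 0 x)\<^sup>2)"
    using L4_mult2[OF L4_form L4_form, of v 0 v 0] by (simp add: power2_eq_square)
  then have "AE x in M. (v \<bullet> Z 0 x)\<^sup>2 = 0"
    using assms integral_nonneg_eq_0_iff_AE[of M "\<lambda>x. (v \<bullet> Z 0 x)\<^sup>2"] by (simp add: var_form_def)
  then show ?thesis by simp
qed

lemma var_form_scaleR: "var_form (r *\<^sub>R v) = r\<^sup>2 * var_form v"
  by (simp add: var_form_def power_mult_distrib)

lemma integrable_norm_Z:
  shows "integrable M (\<lambda>x. norm (Z 0 x) ^ 4)" "integrable M (\<lambda>x. norm (Z 0 x) ^ 2)"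
proof -
  have "integrable M (\<lambda>x. (\<Sum>b\<in>Basis. (b \<bullet> Z 0 x)\<^sup>2)\<^sup>2)"
    unfolding power2_eq_square sum_product
    using L4_mult4[OF L4_form L4_form L4_form L4_form]
    by (intro Bochner_Integration.integrable_sum) (simp add: mult.assoc)
  moreover have n2: "norm z ^ 2 = (\<Sum>b\<in>Basis. (b \<bullet> z)\<^sup>2)" for z :: 'v
    by (subst power2_norm_eq_inner, subst euclidean_inner) (simp add: power2_eq_square inner_commute)
  moreover have "norm z ^ 4 = (norm z ^ 2) ^ 2" for z :: 'v
    by (simp flip: power_mult)
  ultimately show "integrable M (\<lambda>x. norm (Z 0 x) ^ 4)"
    by simp
  show "integrable M (\<lambda>x. norm (Z 0 x) ^ 2)"
    unfolding n2 unfolding power2_eq_square using L4_mult2[OF L4_form L4_form]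
    by (intro Bochner_Integration.integrable_sum)
qed

text \<open>Cauchy-Schwarz pointwise. A reverse estimate by the norm of \<open>v\<close> itself
  fails when the covariance of \<open>Z 0\<close> is singular, which is why
  \<open>kernel_decomposition\<close> passes to another vector.\<close>

lemma var_form_le_norm: "var_form v \<le> (norm v)\<^sup>2 * expectation (\<lambda>x. norm (Z 0 x) ^ 2)"
proof -
  have "integrable M (\<lambda>x. (v \<bullet> Z 0 x)\<^sup>2)"
    using L4_mult2[OF L4_form L4_form, of v 0 v 0] by (simp add: power2_eq_square)
  moreover have "(v \<bullet> z)\<^sup>2 \<le> (norm v)\<^sup>2 * norm z ^ 2" for z
    using Cauchy_Schwarz_ineq2[of v z] by (metis abs_ge_zero power2_abs power_mono power_mult_distrib)
  ultimately have "var_form v \<le> expectation (\<lambda>x. (norm v)\<^sup>2 * norm (Z 0 x) ^ 2)"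
    unfolding var_form_def using integrable_norm_Z(2) by (intro integral_mono) auto
  then show ?thesis by simp
qed

text \<open>In coordinates this is a quadratic polynomial. Continuity serves to attain a minimum on
  a compact part of the unit sphere.\<close>

lemma continuous_on_var_form: "continuous_on S var_form"
proof -
  let ?c = "\<lambda>b b'. expectation (\<lambda>x. (b \<bullet> Z 0 x) * (b' \<bullet> Z 0 x))"
  have "var_form v = (\<Sum>b\<in>Basis. \<Sum>b'\<in>Basis. (v \<bullet> b) * (v \<bullet> b') * ?c b b')" for v
  proof -
    have e: "v \<bullet> z = (\<Sum>b\<in>Basis. (v \<bullet> b) * (b \<bullet> z))" for z
      by (subst euclidean_inner) (simp add: inner_commute)
    have "(v \<bullet> z)\<^sup>2 = (\<Sum>b\<in>Basis. \<Sum>b'\<in>Basis. (v \<bullet> b) * (v \<bullet> b') * ((b \<bullet> z) * (b' \<bullet> z)))" for z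
      unfolding power2_eq_square by (subst (1 2) e, unfold sum_product) (simp only: mult_ac)
    then show ?thesis
      unfolding var_form_def using L4_mult2[OF L4_form L4_form]
      by (simp add: Bochner_Integration.integral_sum Bochner_Integration.integrable_sum)
  qed
  then have "var_form = (\<lambda>v. \<Sum>b\<in>Basis. \<Sum>b'\<in>Basis. (v \<bullet> b) * (v \<bullet> b') * ?c b b')" by auto
  then show ?thesis
    by (auto intro!: continuous_intros)
qed

text \<open>The covariance of \<open>Z 0\<close> may be singular, so \<open>var_form\<close> is compared with the norm of the
  component orthogonal to its kernel; the kernel component does not contribute almost surely.\<close>
lemma kernel_decomposition:
  obtains \<kappa> where "\<kappa> > 0"
    "\<And>v. \<exists>v'. (AE x in M. v \<bullet> Z 0 x = v' \<bullet> Z 0 x) \<and> \<kappa> * (norm v')\<^sup>2 \<le> var_form v"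
proof -
  define K where "K = {v. var_form v = 0}"
  have q_shift: "var_form (u + v) = var_form v" if "var_form u = 0" for u v
  proof -
    have "AE x in M. u \<bullet> Z 0 x = 0"
      using that by (rule var_form_eq_0_AE)
    then have "var_form (u + v) = var_form v"
      unfolding var_form_def by (intro integral_cong_AE) (auto simp: inner_add_left)
    then show ?thesis .
  qed
  have "subspace K"
    unfolding subspace_def K_def using q_shift by (auto simp: var_form_scaleR) (simp add: var_form_def)
  then have spK: "span K = K" by (simp add: span_eq_iff)
  \<comment> \<open>The unit sphere of the orthogonal complement of the kernel. It is compact and
    \<open>var_form\<close> is positive on it, so the minimum there serves as \<kappa>.\<close>
  define Sph where "Sph = {v. norm v = 1 \<and> (\<forall>u\<in>K. orthogonal u v)}"
  have "compact Sph"
  proof -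
    have "Sph = sphere 0 1 \<inter> (\<Inter>u\<in>K. {v. u \<bullet> v = 0})"
      by (auto simp: Sph_def orthogonal_def)
    moreover have "closed (\<Inter>u\<in>K. {v. u \<bullet> v = 0})"
      by (intro closed_INT ballI closed_hyperplane)
    ultimately show ?thesis
      by (simp add: compact_Int_closed)
  qed
  have pos: "var_form v > 0" if "v \<in> Sph" for v
  proof -
    have "v \<notin> K"
      using that by (auto simp: Sph_def orthogonal_self)
    then show ?thesis
      using var_form_nonneg[of v] by (auto simp: K_def)
  qed
  obtain \<kappa> where \<kappa>: "\<kappa> > 0" "\<And>v. v \<in> Sph \<Longrightarrow> \<kappa> \<le> var_form v"
  proof (cases "Sph = {}")
    \<comment> \<open>An empty sphere means that the kernel is the whole space; then any positive
      constant will do.\<close>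
    case True
    then show ?thesis using that[of 1] by auto
  next
    case False
    then obtain v where "v \<in> Sph" "\<forall>w\<in>Sph. var_form v \<le> var_form w"
      using continuous_attains_inf[OF \<open>compact Sph\<close> False continuous_on_var_form] by blast
    then show ?thesis using that[of "var_form v"] pos by auto
  qed
  have "\<exists>v'. (AE x in M. v \<bullet> Z 0 x = v' \<bullet> Z 0 x) \<and> \<kappa> * (norm v')\<^sup>2 \<le> var_form v" for v
  proof -
    obtain y z where yz: "y \<in> span K" "\<And>w. w \<in> span K \<Longrightarrow> orthogonal z w" "v = y + z"
      using orthogonal_subspace_decomp_exists[of K v] by metis
    have "y \<in> K"
      using yz(1) spK by simp
    then have "var_form y = 0"
      by (simp add: K_def)
    then have "AE x in M. y \<bullet> Z 0 x = 0" and qv: "var_form v = var_form z"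
      using var_form_eq_0_AE q_shift yz(3) by auto
    then have "AE x in M. v \<bullet> Z 0 x = z \<bullet> Z 0 x"
      by (auto simp: yz(3) inner_add_left)
    moreover have "\<kappa> * (norm z)\<^sup>2 \<le> var_form v"
    proof (cases "z = 0")
      case True
      then show ?thesis using var_form_nonneg by simp
    next
      case False
      then have "(1 / norm z) *\<^sub>R z \<in> Sph"
        using yz(2) by (auto simp: Sph_def spK orthogonal_def inner_commute)
      from \<kappa>(2)[OF this] have "\<kappa> \<le> var_form z / (norm z)\<^sup>2"
        by (simp add: var_form_scaleR power_divide)
      then show ?thesis
        using False by (simp add: qv field_simps)
    qed
    ultimately show ?thesis by blast
  qed
  with \<kappa>(1) show ?thesis by (rule that)
qed

text \<open>Second moments do not control fourth moments in general, but the linear forms in one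
  input make up a finite-dimensional space. Each vector is replaced by a vector \<open>p v\<close>
  that gives almost surely the same form; moments are bounded by norms, and norm (p v) <= sqrt
  (var_form v / \<kappa>) leads back to variances.\<close>

lemma cum4_form_bound:
  obtains K where "K \<ge> 0"
    "\<And>a b c d l. \<bar>cum4 (\<lambda>x. a \<bullet> Z l x) (\<lambda>x. b \<bullet> Z l x) (\<lambda>x. c \<bullet> Z l x) (\<lambda>x. d \<bullet> Z l x)\<bar>
       \<le> K * (sqrt (var_form a) * sqrt (var_form b) * sqrt (var_form c) * sqrt (var_form d))"
proof -
  obtain \<kappa> where \<kappa>: "\<kappa> > 0"
    "\<And>v. \<exists>v'. (AE x in M. v \<bullet> Z 0 x = v' \<bullet> Z 0 x) \<and> \<kappa> * (norm v')\<^sup>2 \<le> var_form v"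
    using kernel_decomposition by metis
  define N2 where "N2 = expectation (\<lambda>x. norm (Z 0 x) ^ 2)"
  define N4 where "N4 = expectation (\<lambda>x. norm (Z 0 x) ^ 4)"
  have N0: "N2 \<ge> 0" "N4 \<ge> 0" by (auto simp: N2_def N4_def)
  define K where "K = (N4 + 3 * N2\<^sup>2) / \<kappa>\<^sup>2"
  have "\<bar>cum4 (\<lambda>x. a \<bullet> Z l x) (\<lambda>x. b \<bullet> Z l x) (\<lambda>x. c \<bullet> Z l x) (\<lambda>x. d \<bullet> Z l x)\<bar>
       \<le> K * (sqrt (var_form a) * sqrt (var_form b) * sqrt (var_form c) * sqrt (var_form d))" for a b c d l
  proof -
    from \<kappa>(2) obtain p where p: "\<And>v. AE x in M. v \<bullet> Z 0 x = p v \<bullet> Z 0 x" "\<And>v. \<kappa> * (norm (p v))\<^sup>2 \<le> var_form v"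
      by metis
    have np: "norm (p v) \<le> sqrt (var_form v) / sqrt \<kappa>" for v
    proof -
      have "(norm (p v))\<^sup>2 \<le> var_form v / \<kappa>"
        using p(2)[of v] \<kappa>(1) by (simp add: field_simps)
      then show ?thesis
        using real_le_rsqrt[of "norm (p v)" "var_form v / \<kappa>"] by (simp add: real_sqrt_divide)
    qed
    have e2: "\<bar>expectation (\<lambda>x. (u \<bullet> Z 0 x) * (v \<bullet> Z 0 x))\<bar> \<le> norm (p u) * norm (p v) * N2" for u v
    proof -
      have "expectation (\<lambda>x. (u \<bullet> Z 0 x) * (v \<bullet> Z 0 x)) = expectation (\<lambda>x. (p u \<bullet> Z 0 x) * (p v \<bullet> Z 0 x))"
        using p(1)[of u] p(1)[of v] by (intro integral_cong_AE) auto
      also have "\<bar>\<dots>\<bar> \<le> expectation (\<lambda>x. norm (p u) * norm (p v) * norm (Z 0 x) ^ 2)"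
      proof (rule integral_abs_bound[THEN order_trans], rule integral_mono)
        fix x
        have "\<bar>(p u \<bullet> Z 0 x) * (p v \<bullet> Z 0 x)\<bar> \<le> (norm (p u) * norm (Z 0 x)) * (norm (p v) * norm (Z 0 x))"
          unfolding abs_mult by (intro mult_mono Cauchy_Schwarz_ineq2) auto
        then show "\<bar>(p u \<bullet> Z 0 x) * (p v \<bullet> Z 0 x)\<bar> \<le> norm (p u) * norm (p v) * norm (Z 0 x) ^ 2"
          by (simp add: power2_eq_square mult_ac)
      qed (use L4_mult2[OF L4_form L4_form] integrable_norm_Z in auto)
      finally show ?thesis by (simp add: N2_def)
    qed
    have e4: "\<bar>expectation (\<lambda>x. (a \<bullet> Z 0 x) * (b \<bullet> Z 0 x) * (c \<bullet> Z 0 x) * (d \<bullet> Z 0 x))\<bar>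
      \<le> norm (p a) * norm (p b) * norm (p c) * norm (p d) * N4"
    proof -
      have "expectation (\<lambda>x. (a \<bullet> Z 0 x) * (b \<bullet> Z 0 x) * (c \<bullet> Z 0 x) * (d \<bullet> Z 0 x)) =
        expectation (\<lambda>x. (p a \<bullet> Z 0 x) * (p b \<bullet> Z 0 x) * (p c \<bullet> Z 0 x) * (p d \<bullet> Z 0 x))"
        using p(1)[of a] p(1)[of b] p(1)[of c] p(1)[of d] by (intro integral_cong_AE) auto
      also have "\<bar>\<dots>\<bar> \<le> expectation (\<lambda>x. norm (p a) * norm (p b) * norm (p c) * norm (p d) * norm (Z 0 x) ^ 4)"
      proof (rule integral_abs_bound[THEN order_trans], rule integral_mono)
        fix x
        have "\<bar>(p a \<bullet> Z 0 x) * (p b \<bullet> Z 0 x) * (p c \<bullet> Z 0 x) * (p d \<bullet> Z 0 x)\<bar> \<le>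
          (norm (p a) * norm (Z 0 x)) * (norm (p b) * norm (Z 0 x)) * (norm (p c) * norm (Z 0 x)) * (norm (p d) * norm (Z 0 x))"
          unfolding abs_mult by (intro mult_mono Cauchy_Schwarz_ineq2) auto
        then show "\<bar>(p a \<bullet> Z 0 x) * (p b \<bullet> Z 0 x) * (p c \<bullet> Z 0 x) * (p d \<bullet> Z 0 x)\<bar> \<le>
           norm (p a) * norm (p b) * norm (p c) * norm (p d) * norm (Z 0 x) ^ 4"
          by (simp add: power4_eq_xxxx mult_ac)
      qed (use L4_mult4[OF L4_form L4_form L4_form L4_form] integrable_norm_Z in auto)
      finally show ?thesis by (simp add: N4_def)
    qed
    have prod: "\<bar>expectation (\<lambda>x. (u \<bullet> Z 0 x) * (v \<bullet> Z 0 x)) * expectation (\<lambda>x. (w \<bullet> Z 0 x) * (z \<bullet> Z 0 x))\<bar>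
      \<le> norm (p u) * norm (p v) * norm (p w) * norm (p z) * N2\<^sup>2" for u v w z
    proof -
      have "\<bar>expectation (\<lambda>x. (u \<bullet> Z 0 x) * (v \<bullet> Z 0 x)) * expectation (\<lambda>x. (w \<bullet> Z 0 x) * (z \<bullet> Z 0 x))\<bar> \<le>
        (norm (p u) * norm (p v) * N2) * (norm (p w) * norm (p z) * N2)"
        unfolding abs_mult by (intro mult_mono e2) (auto simp: N0)
      then show ?thesis by (simp add: power2_eq_square mult_ac)
    qed
    have "\<bar>cum4 (\<lambda>x. a \<bullet> Z 0 x) (\<lambda>x. b \<bullet> Z 0 x) (\<lambda>x. c \<bullet> Z 0 x) (\<lambda>x. d \<bullet> Z 0 x)\<bar>
      \<le> norm (p a) * norm (p b) * norm (p c) * norm (p d) * N4 + norm (p a) * norm (p b) * norm (p c) * norm (p d) * N2\<^sup>2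
       + norm (p a) * norm (p c) * norm (p b) * norm (p d) * N2\<^sup>2 + norm (p a) * norm (p d) * norm (p b) * norm (p c) * N2\<^sup>2"
      unfolding cum4_def using e4 prod[of a b c d] prod[of a c b d] prod[of a d b c] by linarith
    also have "\<dots> = (norm (p a) * norm (p b) * norm (p c) * norm (p d)) * (N4 + 3 * N2\<^sup>2)"
      by (simp add: algebra_simps)
    also have "\<dots> \<le> ((sqrt (var_form a) / sqrt \<kappa>) * (sqrt (var_form b) / sqrt \<kappa>) * (sqrt (var_form c) / sqrt \<kappa>) * (sqrt (var_form d) / sqrt \<kappa>)) * (N4 + 3 * N2\<^sup>2)"
      using \<kappa>(1) N0 by (intro mult_mono np) (auto simp: var_form_nonneg)
    also have "\<dots> = (sqrt (var_form a) * sqrt (var_form b) * sqrt (var_form c) * sqrt (var_form d)) * (N4 + 3 * N2\<^sup>2) / ((sqrt \<kappa>)\<^sup>2)\<^sup>2"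
      by (simp add: power2_eq_square field_simps)
    also have "\<dots> = K * (sqrt (var_form a) * sqrt (var_form b) * sqrt (var_form c) * sqrt (var_form d))"
      using \<kappa>(1) by (simp add: K_def)
    finally show ?thesis
      unfolding cum4_form[of a l b c d] .
  qed
  moreover have "K \<ge> 0" using N0 by (simp add: K_def)
  ultimately show ?thesis using that by blast
qed

end

section \<open>Limits of moments\<close>

context prob_space
begin

text \<open>The bounds \<open>b n\<close> may vary with \<open>n\<close>: in the application they
  belong to truncated processes, and only their limit can be estimated.\<close>

lemma fatou_expectation:
  fixes f :: "nat \<Rightarrow> 'a \<Rightarrow> real"
  assumes f: "\<And>n. integrable M (f n)" "\<And>n x. 0 \<le> f n x" and [measurable]: "g \<in> borel_measurable M"
    and lim: "AE x in M. (\<lambda>n. f n x) \<longlonglongrightarrow> g x"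
    and b: "\<And>n. expectation (f n) \<le> b n" "b \<longlonglongrightarrow> B"
  shows "integrable M g" "expectation g \<le> B"
proof -
  have [measurable]: "f n \<in> borel_measurable M" for n
    using f(1) by auto
  have g0: "AE x in M. 0 \<le> g x"
    using lim by eventually_elim (auto intro: LIMSEQ_le_const f(2))
  have "(\<integral>\<^sup>+x. ennreal (g x) \<partial>M) = (\<integral>\<^sup>+x. liminf (\<lambda>n. ennreal (f n x)) \<partial>M)"
  proof (rule nn_integral_cong_AE, use lim in eventually_elim)
    fix x assume "(\<lambda>n. f n x) \<longlonglongrightarrow> g x"
    then have "(\<lambda>n. ennreal (f n x)) \<longlonglongrightarrow> ennreal (g x)"
      by (rule tendsto_ennrealI)
    then show "ennreal (g x) = liminf (\<lambda>n. ennreal (f n x))"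
      by (simp add: lim_imp_Liminf)
  qed
  also have "\<dots> \<le> liminf (\<lambda>n. \<integral>\<^sup>+x. ennreal (f n x) \<partial>M)"
    by (rule nn_integral_liminf) simp
  also have "\<dots> = liminf (\<lambda>n. ennreal (expectation (f n)))"
    using f by (simp add: nn_integral_eq_integral)
  also have "\<dots> \<le> liminf (\<lambda>n. ennreal (b n))"
    by (intro Liminf_mono always_eventually allI ennreal_leI b)
  also have "\<dots> = ennreal B"
    using b(2) by (intro lim_imp_Liminf tendsto_ennrealI) simp_all
  finally have le: "(\<integral>\<^sup>+x. ennreal (g x) \<partial>M) \<le> ennreal B" .
  show ig: "integrable M g"
    using g0 le by (intro integrableI_nonneg) (auto intro: le_less_trans)
  have "0 \<le> b n" for n
    using b(1)[of n] Bochner_Integration.integral_nonneg[of M "f n"] f(2) by (meson order_trans)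
  then have "0 \<le> B"
    using b(2) by (intro LIMSEQ_le_const) auto
  then show "expectation g \<le> B"
    using le nn_integral_eq_integral[OF ig g0] by simp
qed

text \<open>Boundedness in L2 gives uniform integrability. Fatou's lemma puts \<open>g\<close> into
  L2; the difference is cut off at a level \<open>R\<close>, below which dominated convergence
  applies.\<close>

lemma expectation_tendsto_of_L2_bounded:
  fixes f :: "nat \<Rightarrow> 'a \<Rightarrow> real"
  assumes f [measurable]: "\<And>n. f n \<in> borel_measurable M" and f2: "\<And>n. integrable M (\<lambda>x. (f n x)\<^sup>2)"
    and [measurable]: "g \<in> borel_measurable M"
    and lim: "AE x in M. (\<lambda>n. f n x) \<longlonglongrightarrow> g x"
    and S: "\<And>n. expectation (\<lambda>x. (f n x)\<^sup>2) \<le> S"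
  shows "integrable M g" "(\<lambda>n. expectation (f n)) \<longlonglongrightarrow> expectation g"
proof -
  have lim2: "AE x in M. (\<lambda>n. (f n x)\<^sup>2) \<longlonglongrightarrow> (g x)\<^sup>2"
    using lim by eventually_elim (intro tendsto_power)
  have g2: "integrable M (\<lambda>x. (g x)\<^sup>2)" "expectation (\<lambda>x. (g x)\<^sup>2) \<le> S"
    using fatou_expectation[of "\<lambda>n x. (f n x)\<^sup>2" "\<lambda>x. (g x)\<^sup>2" "\<lambda>_. S" S] f2 lim2 S by auto
  show ig: "integrable M g"
    using g2(1) by (rule square_integrable_imp_integrable[rotated]) simp
  have if': "integrable M (f n)" for n
    using f2 by (rule square_integrable_imp_integrable[rotated]) simp
  have S0: "0 \<le> S"
    using S[of 0] Bochner_Integration.integral_nonneg[of M "\<lambda>x. (f 0 x)\<^sup>2"] by (meson order_trans zero_le_power2)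
  define h where "h n x = \<bar>f n x - g x\<bar>" for n x
  have [measurable]: "h n \<in> borel_measurable M" for n
    unfolding h_def by measurable
  have h2: "(h n x)\<^sup>2 \<le> 2 * (f n x)\<^sup>2 + 2 * (g x)\<^sup>2" for n x
    using zero_le_power2[of "f n x + g x"] by (simp add: h_def power2_eq_square algebra_simps)
  have ih2: "integrable M (\<lambda>x. (h n x)\<^sup>2)" for n
    by (rule Bochner_Integration.integrable_bound[of M "\<lambda>x. 2 * (f n x)\<^sup>2 + 2 * (g x)\<^sup>2"])
       (use f2 g2 h2 in auto)
  have Eh2: "expectation (\<lambda>x. (h n x)\<^sup>2) \<le> 4 * S" for n
  proof -
    have "expectation (\<lambda>x. (h n x)\<^sup>2) \<le> expectation (\<lambda>x. 2 * (f n x)\<^sup>2 + 2 * (g x)\<^sup>2)"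
      using f2 g2 ih2 h2 by (intro integral_mono) auto
    also have "\<dots> = 2 * expectation (\<lambda>x. (f n x)\<^sup>2) + 2 * expectation (\<lambda>x. (g x)\<^sup>2)"
      using f2 g2 by simp
    finally show ?thesis using S[of n] g2(2) by linarith
  qed
  have ih: "integrable M (h n)" for n
    unfolding h_def using ig if' by auto
  have "(\<lambda>n. expectation (h n)) \<longlonglongrightarrow> 0"
  proof (rule LIMSEQ_I)
    fix e :: real assume "e > 0"
    \<comment> \<open>Makes the contribution above the level, at most 4 S / R, smaller than e / 2.
      The added 1 keeps \<open>R\<close> positive when S = 0.\<close>
    define R where "R = 8 * (S + 1) / e"
    have R: "R > 0" "4 * S / R < e / 2"
      using \<open>e > 0\<close> S0 by (auto simp: R_def field_simps)
    have imin: "integrable M (\<lambda>x. min (h n x) R)" for n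
      using ih[of n] by simp
    have "(\<lambda>n. expectation (\<lambda>x. min (h n x) R)) \<longlonglongrightarrow> expectation (\<lambda>x. 0)"
    proof (rule integral_dominated_convergence[where w = "\<lambda>_. R"])
      show "AE x in M. (\<lambda>n. min (h n x) R) \<longlonglongrightarrow> 0"
        using lim
      proof eventually_elim
        fix x assume "(\<lambda>n. f n x) \<longlonglongrightarrow> g x"
        then have "(\<lambda>n. h n x) \<longlonglongrightarrow> 0"
          unfolding h_def by (simp add: LIM_zero tendsto_rabs_zero)
        then have "(\<lambda>n. min (h n x) R) \<longlonglongrightarrow> min 0 R"
          by (intro tendsto_min) auto
        then show "(\<lambda>n. min (h n x) R) \<longlonglongrightarrow> 0"
          using R(1) by simp
      qed
      show "AE x in M. norm (min (h n x) R) \<le> R" for n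
        using R(1) by (auto simp: h_def)
    qed auto
    then have "\<forall>\<^sub>F n in sequentially. expectation (\<lambda>x. min (h n x) R) < e / 2"
      using \<open>e > 0\<close> by (intro order_tendstoD(2)[of _ 0]) auto
    then obtain n0 where n0: "\<And>n. n \<ge> n0 \<Longrightarrow> expectation (\<lambda>x. min (h n x) R) < e / 2"
      by (auto simp: eventually_sequentially)
    have "norm (expectation (h n) - 0) < e" if "n \<ge> n0" for n
    proof -
      \<comment> \<open>Above the level the excess is paid for by the second moment, as h > R
        implies h <= h^2 / R.\<close>
      have "h n x \<le> min (h n x) R + (h n x)\<^sup>2 / R" for x
      proof (cases "h n x \<le> R")
        case True
        then show ?thesis using R(1) by (simp add: h_def)
      next
        case False
        then have "h n x * R \<le> h n x * h n x"
          using R(1) by (intro mult_left_mono) auto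
        then have "h n x \<le> (h n x)\<^sup>2 / R"
          using R(1) by (simp add: power2_eq_square field_simps)
        then show ?thesis using R(1) False by (simp add: min_def)
      qed
      then have "expectation (h n) \<le> expectation (\<lambda>x. min (h n x) R + (h n x)\<^sup>2 / R)"
        using ih imin ih2 by (intro integral_mono) auto
      also have "\<dots> = expectation (\<lambda>x. min (h n x) R) + expectation (\<lambda>x. (h n x)\<^sup>2) / R"
        using imin ih2 by simp
      also have "\<dots> \<le> expectation (\<lambda>x. min (h n x) R) + 4 * S / R"
        using Eh2 R(1) by (intro add_left_mono divide_right_mono) auto
      also have "\<dots> < e" using n0[OF that] R(2) by linarith
      finally have "expectation (h n) < e" .
      moreover have "0 \<le> expectation (h n)"
        by (intro Bochner_Integration.integral_nonneg) (simp add: h_def)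
      ultimately show ?thesis by simp
    qed
    then show "\<exists>n0. \<forall>n\<ge>n0. norm (expectation (h n) - 0) < e" by blast
  qed
  moreover have "norm (expectation (f n) - expectation g) \<le> expectation (h n)" for n
  proof -
    have "expectation (f n) - expectation g = expectation (\<lambda>x. f n x - g x)"
      using ig if' by simp
    also have "norm \<dots> \<le> expectation (h n)"
      using integral_abs_bound[of M "\<lambda>x. f n x - g x"] by (simp add: h_def[abs_def])
    finally show ?thesis .
  qed
  ultimately have "(\<lambda>n. expectation (f n) - expectation g) \<longlonglongrightarrow> 0"
    by (intro Lim_null_comparison[of "\<lambda>n. expectation (f n) - expectation g" "\<lambda>n. expectation (h n)"]) auto
  then show "(\<lambda>n. expectation (f n)) \<longlonglongrightarrow> expectation g"
    by (simp add: LIM_zero_iff)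
qed

end

text \<open>Cauchy-Schwarz over a window of length \<open>n\<close> gives only O(n). A finite set
  that carries almost all of the square sum contributes O(1) wherever the window lies, and on the
  remaining indices Cauchy-Schwarz gives an arbitrarily small multiple of \<open>n\<close>. The
  bound is the supremum over the position \<open>m\<close>.\<close>

lemma square_summable_window:
  fixes \<psi> :: "int \<Rightarrow> real"
  assumes nn: "\<And>l. 0 \<le> \<psi> l" and sq: "(\<lambda>l. (\<psi> l)\<^sup>2) summable_on UNIV"
  obtains b :: "nat \<Rightarrow> real" where "\<And>n m. (\<Sum>t\<in>{1..int n}. \<psi> (t - m))\<^sup>2 \<le> b n"
    "(\<lambda>n. b n / real n) \<longlonglongrightarrow> 0"
proof -
  have reidx: "(\<Sum>t\<in>{1..int n}. \<psi> (t - m)) = (\<Sum>r\<in>{1 - m..int n - m}. \<psi> r)" for n m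
    by (rule sum.reindex_bij_witness[of _ "\<lambda>r. r + m" "\<lambda>t. t - m"]) auto
  have CS: "(\<Sum>r\<in>F. \<psi> r)\<^sup>2 \<le> real (card F) * (\<Sum>r\<in>F. (\<psi> r)\<^sup>2)" for F
    using Cauchy_Schwarz_ineq_sum[of "\<lambda>_. 1" \<psi> F] by simp
  have fin: "sum (\<lambda>l. (\<psi> l)\<^sup>2) F \<le> infsum (\<lambda>l. (\<psi> l)\<^sup>2) UNIV" if "finite F" for F
    using that sq by (intro finite_sum_le_infsum) auto
  define w where "w n m = (\<Sum>t\<in>{1..int n}. \<psi> (t - m))\<^sup>2" for n m
  define b where "b n = (SUP m. w n m)" for n
  have bdd: "bdd_above (range (w n))" for n
  proof (rule bdd_aboveI2)
    fix m
    show "w n m \<le> real n * infsum (\<lambda>l. (\<psi> l)\<^sup>2) UNIV"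
      unfolding w_def reidx using CS[of "{1 - m..int n - m}"] fin[of "{1 - m..int n - m}"]
      by (smt (verit) card_atLeastAtMost_int finite_atLeastAtMost_int mult_left_mono nat_int of_nat_0_le_iff)
  qed
  have up: "w n m \<le> b n" for n m
    unfolding b_def by (intro cSUP_upper bdd) auto
  have "(\<lambda>n. b n / real n) \<longlonglongrightarrow> 0"
  proof (rule LIMSEQ_I)
    fix e :: real assume "e > 0"
    obtain F where F: "finite F" "\<And>H. finite H \<Longrightarrow> F \<subseteq> H \<Longrightarrow> dist (sum (\<lambda>l. (\<psi> l)\<^sup>2) H) (infsum (\<lambda>l. (\<psi> l)\<^sup>2) UNIV) < e / 8"
    proof -
      have "((\<lambda>l. (\<psi> l)\<^sup>2) has_sum infsum (\<lambda>l. (\<psi> l)\<^sup>2) UNIV) UNIV"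
        using sq by simp
      then have "(sum (\<lambda>l. (\<psi> l)\<^sup>2) \<longlongrightarrow> infsum (\<lambda>l. (\<psi> l)\<^sup>2) UNIV) (finite_subsets_at_top UNIV)"
        by (simp add: has_sum_def)
      then have "\<forall>\<^sub>F H in finite_subsets_at_top UNIV. dist (sum (\<lambda>l. (\<psi> l)\<^sup>2) H) (infsum (\<lambda>l. (\<psi> l)\<^sup>2) UNIV) < e / 8"
        using \<open>e > 0\<close> by (intro tendstoD) auto
      then obtain F where "finite F"
        "\<forall>H. finite H \<and> F \<subseteq> H \<and> H \<subseteq> UNIV \<longrightarrow> dist (sum (\<lambda>l. (\<psi> l)\<^sup>2) H) (infsum (\<lambda>l. (\<psi> l)\<^sup>2) UNIV) < e / 8"
        unfolding eventually_finite_subsets_at_top by blast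
      then show ?thesis
        using that[of F] by blast
    qed
    have tail: "sum (\<lambda>l. (\<psi> l)\<^sup>2) H \<le> e / 8" if "finite H" "H \<inter> F = {}" for H
    proof -
      have "sum (\<lambda>l. (\<psi> l)\<^sup>2) (F \<union> H) = sum (\<lambda>l. (\<psi> l)\<^sup>2) F + sum (\<lambda>l. (\<psi> l)\<^sup>2) H"
        using that F(1) by (intro sum.union_disjoint) auto
      moreover have "sum (\<lambda>l. (\<psi> l)\<^sup>2) (F \<union> H) \<le> infsum (\<lambda>l. (\<psi> l)\<^sup>2) UNIV"
        using that F(1) by (intro fin) auto
      ultimately show ?thesis using F(2)[OF F(1) subset_refl] unfolding dist_real_def by linarith
    qed
    define s where "s = (\<Sum>r\<in>F. \<psi> r)\<^sup>2"
    \<comment> \<open>By (p + q)^2 <= 2 p^2 + 2 q^2 there are two parts, 2 s and at most 2 n (e /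
      8); this choice of \<open>n0\<close> bounds each of them by n e / 4.\<close>
    obtain n0 where n0: "real n0 > 8 * s / e" "n0 > 0"
      using reals_Archimedean2[of "max 1 (8 * s / e)"] by fastforce
    have "norm (b n / real n - 0) < e" if "n \<ge> n0" for n
    proof -
      have n: "n > 0" using that n0 by simp
      have "w n m \<le> e / 2 * real n" for m
      proof -
        let ?I = "{1 - m..int n - m}"
        have "(\<Sum>r\<in>?I. \<psi> r) = (\<Sum>r\<in>?I \<inter> F. \<psi> r) + (\<Sum>r\<in>?I - F. \<psi> r)"
          by (subst sum.Int_Diff[of _ _ F]) auto
        also have "\<dots> \<le> (\<Sum>r\<in>F. \<psi> r) + (\<Sum>r\<in>?I - F. \<psi> r)"
          using F(1) nn by (intro add_right_mono sum_mono2) auto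
        finally have "w n m \<le> ((\<Sum>r\<in>F. \<psi> r) + (\<Sum>r\<in>?I - F. \<psi> r))\<^sup>2"
          unfolding w_def reidx by (intro power_mono sum_nonneg nn) auto
        also have "\<dots> \<le> 2 * s + 2 * (\<Sum>r\<in>?I - F. \<psi> r)\<^sup>2"
          unfolding s_def using sum_squares_bound[of "\<Sum>r\<in>F. \<psi> r" "\<Sum>r\<in>?I - F. \<psi> r"]
          by (simp add: power2_sum)
        also have "(\<Sum>r\<in>?I - F. \<psi> r)\<^sup>2 \<le> real (card (?I - F)) * (\<Sum>r\<in>?I - F. (\<psi> r)\<^sup>2)"
          by (rule CS)
        also have "\<dots> \<le> real n * (e / 8)"
        proof (intro mult_mono tail)
          have "card (?I - F) \<le> card ?I" by (intro card_mono) auto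
          then show "real (card (?I - F)) \<le> real n" by simp
        qed (auto intro: sum_nonneg)
        also have "2 * s + 2 * (real n * (e / 8)) \<le> e / 2 * real n"
        proof -
          have "8 * s / e < real n" using n0(1) that by linarith
          then show ?thesis using \<open>e > 0\<close> by (simp add: field_simps)
        qed
        finally show ?thesis by simp
      qed
      then have "b n \<le> e / 2 * real n"
        unfolding b_def by (intro cSUP_least) auto
      then have "b n / real n \<le> e / 2"
        using n by (simp add: field_simps)
      moreover have "0 \<le> b n"
        using up[of n 0] by (smt (verit) w_def zero_le_power2)
      then have "0 \<le> b n / real n" by simp
      ultimately show ?thesis using \<open>e > 0\<close> by (simp only: real_norm_def)
    qed
    then show "\<exists>n0. \<forall>n\<ge>n0. norm (b n / real n - 0) < e" by blast
  qed
  then show ?thesis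
    using that up unfolding w_def by blast
qed

text \<open>Used with pairs of times as points and kernels of rank one, where the inner double sum
  is a cumulant of four cosine or sine transforms.\<close>

lemma sum_bilinear_expand:
  fixes c :: "'x \<Rightarrow> 'x \<Rightarrow> real"
  shows "(\<Sum>x\<in>T. \<Sum>y\<in>T. (\<Sum>i\<in>P. a i * f i x) * (\<Sum>i\<in>P. a i * f i y) * c x y) =
    (\<Sum>i\<in>P. \<Sum>k\<in>P. a i * a k * (\<Sum>x\<in>T. \<Sum>y\<in>T. f i x * f k y * c x y))"
proof -
  have "(\<Sum>x\<in>T. \<Sum>y\<in>T. (\<Sum>i\<in>P. a i * f i x) * (\<Sum>i\<in>P. a i * f i y) * c x y) =
    (\<Sum>x\<in>T. \<Sum>y\<in>T. \<Sum>i\<in>P. \<Sum>k\<in>P. a i * a k * (f i x * f k y * c x y))"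
    by (simp only: sum_product, simp only: sum_distrib_right, simp only: mult_ac)
  also have "\<dots> = (\<Sum>x\<in>T. \<Sum>i\<in>P. \<Sum>y\<in>T. \<Sum>k\<in>P. a i * a k * (f i x * f k y * c x y))"
    by (rule sum.cong[OF refl], rule sum.swap)
  also have "\<dots> = (\<Sum>i\<in>P. \<Sum>x\<in>T. \<Sum>k\<in>P. \<Sum>y\<in>T. a i * a k * (f i x * f k y * c x y))"
    by (subst sum.swap) (intro sum.cong refl sum.swap)
  also have "\<dots> = (\<Sum>i\<in>P. \<Sum>k\<in>P. \<Sum>x\<in>T. \<Sum>y\<in>T. a i * a k * (f i x * f k y * c x y))"
    by (rule sum.cong[OF refl], rule sum.swap)
  finally show ?thesis
    by (simp only: sum_distrib_left)
qed

section \<open>Quadratic forms of linear processes\<close>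

definition cosW :: "nat set \<Rightarrow> (nat \<Rightarrow> real) \<Rightarrow> (nat \<Rightarrow> real) \<Rightarrow> int \<Rightarrow> real" where
  "cosW S a w h = (\<Sum>s\<in>S. a s * cos (w s * real_of_int h))"

abbreviation square_idx :: "nat \<Rightarrow> (int \<times> int) set" where
  "square_idx n \<equiv> {1..int n} \<times> {1..int n}"

text \<open>By Isserlis' formula, the variance of the quadratic form for jointly Gaussian series
  with these covariances. The arguments in the last product are ordered so that the cross-covariance
  occurs in one orientation only.\<close>

definition gauss_var :: "nat \<Rightarrow> (int \<Rightarrow> real) \<Rightarrow> (int \<Rightarrow> real) \<Rightarrow> (int \<Rightarrow> real) \<Rightarrow> (int \<Rightarrow> real) \<Rightarrow> real" where
  "gauss_var n W gj gk gjk = (\<Sum>p\<in>square_idx n. \<Sum>p'\<in>square_idx n.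
     W (fst p - snd p) * W (fst p' - snd p') *
       (gj (fst p - fst p') * gk (snd p - snd p') + gjk (fst p - snd p') * gjk (fst p' - snd p)))"

text \<open>The second moment of a cosine-weighted quadratic form exceeds the one for a Gaussian process
  with the same covariances by at most \<open>o(n\<^sup>2)\<close>, uniformly in the weights.\<close>
definition gaussian_quadratic_forms ::
  "'w measure \<Rightarrow> (int \<Rightarrow> 'w \<Rightarrow> real) \<Rightarrow> (int \<Rightarrow> 'w \<Rightarrow> real) \<Rightarrow> (int \<Rightarrow> real) \<Rightarrow> (int \<Rightarrow> real) \<Rightarrow> (int \<Rightarrow> real) \<Rightarrow> bool" where
  "gaussian_quadratic_forms P Y Y' gj gk gjk \<longleftrightarrow>
    (\<forall>C. \<exists>R. R \<longlonglongrightarrow> 0 \<and> (\<forall>n S a w c. finite S \<longrightarrow> (\<Sum>s\<in>S. \<bar>a s\<bar>) \<le> C \<longrightarrow>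
      integrable P (\<lambda>x. ((\<Sum>p\<in>square_idx n. cosW S a w (fst p - snd p) * (Y (fst p) x * Y' (snd p) x)) - c)\<^sup>2) \<and>
      integral\<^sup>L P (\<lambda>x. ((\<Sum>p\<in>square_idx n. cosW S a w (fst p - snd p) * (Y (fst p) x * Y' (snd p) x)) - c)\<^sup>2)
       \<le> ((\<Sum>p\<in>square_idx n. cosW S a w (fst p - snd p) * gjk (fst p - snd p)) - c)\<^sup>2
          + gauss_var n (cosW S a w) gj gk gjk + R n * (real n)\<^sup>2))"

text \<open>One index set for cosines and sines together: the addition formula for cos (w (t - u))
  then writes the kernel as a sum of rank-one kernels, see \<open>cosW_trig\<close>.\<close>

definition trig :: "(nat \<Rightarrow> real) \<Rightarrow> nat \<times> bool \<Rightarrow> int \<Rightarrow> real" where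
  "trig w i t = (if snd i then cos (w (fst i) * real_of_int t) else sin (w (fst i) * real_of_int t))"

lemma abs_trig_le_1: "\<bar>trig w i t\<bar> \<le> 1"
  by (simp add: trig_def)

lemma cosW_trig:
  assumes "finite S"
  shows "cosW S a w (t - u) = (\<Sum>i\<in>S \<times> UNIV. a (fst i) * (trig w i t * trig w i u))"
proof -
  have "(\<Sum>i\<in>S \<times> UNIV. a (fst i) * (trig w i t * trig w i u)) =
     (\<Sum>s\<in>S. \<Sum>\<sigma>\<in>UNIV. a s * (trig w (s, \<sigma>) t * trig w (s, \<sigma>) u))"
    by (simp add: sum.cartesian_product case_prod_unfold)
  also have "\<dots> = (\<Sum>s\<in>S. a s * cos (w s * real_of_int (t - u)))"
    by (simp add: UNIV_bool trig_def cos_diff right_diff_distrib distrib_left add.commute)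
  finally show ?thesis by (simp add: cosW_def)
qed

lemma abs_cosW_le:
  assumes "(\<Sum>s\<in>S. \<bar>a s\<bar>) \<le> C"
  shows "\<bar>cosW S a w h\<bar> \<le> C"
proof -
  have "\<bar>cosW S a w h\<bar> \<le> (\<Sum>s\<in>S. \<bar>a s * cos (w s * real_of_int h)\<bar>)"
    unfolding cosW_def by (rule sum_abs)
  also have "\<dots> \<le> (\<Sum>s\<in>S. \<bar>a s\<bar>)"
    by (intro sum_mono) (simp add: abs_mult mult_left_le)
  finally show ?thesis using assms by simp
qed

lemma sum_shift_le_infsum:
  fixes g :: "int \<Rightarrow> real"
  assumes "(\<lambda>h. \<bar>g h\<bar>) summable_on UNIV" "finite F" "inj_on f F"
  shows "(\<Sum>t\<in>F. \<bar>g (f t)\<bar>) \<le> infsum (\<lambda>h. \<bar>g h\<bar>) UNIV"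
proof -
  have "(\<Sum>t\<in>F. \<bar>g (f t)\<bar>) = sum (\<lambda>h. \<bar>g h\<bar>) (f ` F)"
    using assms(3) by (simp add: sum.reindex)
  also have "\<dots> \<le> infsum (\<lambda>h. \<bar>g h\<bar>) UNIV"
    using assms by (intro finite_sum_le_infsum) auto
  finally show ?thesis .
qed

section \<open>Truncated moving averages and their limit\<close>

context indep_vectors
begin

definition truncated :: "(int \<Rightarrow> 'v) \<Rightarrow> nat \<Rightarrow> int \<Rightarrow> 'a \<Rightarrow> real" where
  "truncated \<alpha> N t x = (\<Sum>l\<in>{- int N..int N}. \<alpha> l \<bullet> Z (t - l) x)"

lemma L4_truncated: "L4 (truncated \<alpha> N t)"
  unfolding truncated_def[abs_def] by (intro L4_sum L4_form)

lemma truncated_lin_form: "truncated \<alpha> N t = lin_form (\<lambda>m. \<alpha> (t - m)) {t - int N..t + int N}"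
  unfolding truncated_def lin_form_def fun_eq_iff
  by (intro allI sum.reindex_bij_witness[of _ "\<lambda>m. t - m" "\<lambda>l. t - l"]) auto

text \<open>Padding by zeros turns the truncations at all times 1..n into forms in the same inputs,
  those from 1 - N to n + N; additivity of cumulants requires such a common index set.\<close>

definition trunc_coeff :: "(int \<Rightarrow> 'v) \<Rightarrow> nat \<Rightarrow> int \<Rightarrow> int \<Rightarrow> 'v" where
  "trunc_coeff \<alpha> N t m = (if \<bar>t - m\<bar> \<le> int N then \<alpha> (t - m) else 0)"

lemma truncated_lin_form_common:
  assumes "t \<in> {1..int n}"
  shows "truncated \<alpha> N t = lin_form (trunc_coeff \<alpha> N t) {1 - int N..int n + int N}"
proof
  fix x
  have "lin_form (trunc_coeff \<alpha> N t) {1 - int N..int n + int N} x = (\<Sum>m\<in>{t - int N..t + int N}. \<alpha> (t - m) \<bullet> Z m x)"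
    unfolding lin_form_def using assms by (intro sum.mono_neutral_cong_right) (auto simp: trunc_coeff_def)
  then show "truncated \<alpha> N t x = lin_form (trunc_coeff \<alpha> N t) {1 - int N..int n + int N} x"
    by (simp add: truncated_lin_form lin_form_def)
qed

text \<open>Summation by input instead of by time. With \<open>r\<close> a cosine or sine vector,
  the coefficient of an input is its contribution to the discrete Fourier transform.\<close>

lemma sum_truncated_lin_form:
  "(\<lambda>x. \<Sum>t\<in>{1..int n}. r t * truncated \<alpha> N t x) =
    lin_form (\<lambda>m. \<Sum>t\<in>{1..int n}. r t *\<^sub>R trunc_coeff \<alpha> N t m) {1 - int N..int n + int N}"
proof
  fix x
  have "(\<Sum>t\<in>{1..int n}. r t * truncated \<alpha> N t x) =
     (\<Sum>t\<in>{1..int n}. r t * lin_form (trunc_coeff \<alpha> N t) {1 - int N..int n + int N} x)"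
    by (intro sum.cong refl) (simp only: truncated_lin_form_common[where n = n])
  also have "\<dots> = (\<Sum>t\<in>{1..int n}. \<Sum>m\<in>{1 - int N..int n + int N}. (r t *\<^sub>R trunc_coeff \<alpha> N t m) \<bullet> Z m x)"
    by (simp add: lin_form_def sum_distrib_left)
  also have "\<dots> = (\<Sum>m\<in>{1 - int N..int n + int N}. \<Sum>t\<in>{1..int n}. (r t *\<^sub>R trunc_coeff \<alpha> N t m) \<bullet> Z m x)"
    by (rule sum.swap)
  also have "\<dots> = lin_form (\<lambda>m. \<Sum>t\<in>{1..int n}. r t *\<^sub>R trunc_coeff \<alpha> N t m) {1 - int N..int n + int N} x"
    by (simp add: lin_form_def inner_sum_left)
  finally show "(\<Sum>t\<in>{1..int n}. r t * truncated \<alpha> N t x) =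
    lin_form (\<lambda>m. \<Sum>t\<in>{1..int n}. r t *\<^sub>R trunc_coeff \<alpha> N t m) {1 - int N..int n + int N} x" .
qed

definition second_moment :: real where
  "second_moment = expectation (\<lambda>x. norm (Z 0 x) ^ 2)"

lemma second_moment_nonneg: "0 \<le> second_moment"
  by (simp add: second_moment_def)

lemma sum_var_form_le:
  fixes \<psi> :: "int \<Rightarrow> real"
  assumes nn: "\<And>l. norm (\<alpha> l) \<le> \<psi> l" and sq: "(\<lambda>l. (\<psi> l)\<^sup>2) summable_on UNIV" and "finite F" "inj_on f F"
  shows "(\<Sum>l\<in>F. var_form (\<alpha> (f l))) \<le> second_moment * infsum (\<lambda>l. (\<psi> l)\<^sup>2) UNIV"
proof -
  have "(\<Sum>l\<in>F. var_form (\<alpha> (f l))) \<le> (\<Sum>l\<in>F. second_moment * (\<psi> (f l))\<^sup>2)"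
  proof (rule sum_mono)
    fix l
    have "var_form (\<alpha> (f l)) \<le> (norm (\<alpha> (f l)))\<^sup>2 * second_moment"
      using var_form_le_norm by (simp add: second_moment_def)
    also have "\<dots> \<le> (\<psi> (f l))\<^sup>2 * second_moment"
      using nn by (intro mult_right_mono power_mono second_moment_nonneg) auto
    finally show "var_form (\<alpha> (f l)) \<le> second_moment * (\<psi> (f l))\<^sup>2" by (simp add: mult.commute)
  qed
  also have "\<dots> = second_moment * (\<Sum>l\<in>F. \<bar>(\<psi> (f l))\<^sup>2\<bar>)"
    by (simp add: sum_distrib_left)
  also have "\<dots> \<le> second_moment * infsum (\<lambda>l. \<bar>(\<psi> l)\<^sup>2\<bar>) UNIV"
    using assms by (intro mult_left_mono sum_shift_le_infsum[of "\<lambda>l. (\<psi> l)\<^sup>2"] second_moment_nonneg) auto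
  finally show ?thesis by simp
qed

text \<open>The fourth moment is the cumulant plus three times the squared variance. The cumulant is
  at most a multiple of the sum over the inputs of squared variances, hence of the squared total
  variance, and the latter is bounded uniformly in \<open>N\<close> and \<open>t\<close>.\<close>

lemma truncated_fourth_moment_bound:
  assumes nn: "\<And>l. norm (\<alpha> l) \<le> \<psi> l" and sq: "(\<lambda>l. (\<psi> l)\<^sup>2) summable_on UNIV"
  obtains B where "\<And>N t. expectation (\<lambda>x. truncated \<alpha> N t x ^ 4) \<le> B"
proof -
  obtain K where K: "K \<ge> 0"
    "\<And>a b c d l. \<bar>cum4 (\<lambda>x. a \<bullet> Z l x) (\<lambda>x. b \<bullet> Z l x) (\<lambda>x. c \<bullet> Z l x) (\<lambda>x. d \<bullet> Z l x)\<bar>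
       \<le> K * (sqrt (var_form a) * sqrt (var_form b) * sqrt (var_form c) * sqrt (var_form d))"
    using cum4_form_bound by metis
  define S where "S = second_moment * infsum (\<lambda>l. (\<psi> l)\<^sup>2) UNIV"
  have "expectation (\<lambda>x. truncated \<alpha> N t x ^ 4) \<le> (K + 3) * S\<^sup>2" for N t
  proof -
    let ?L = "{t - int N..t + int N}"
    let ?f = "lin_form (\<lambda>m. \<alpha> (t - m)) ?L"
    let ?Q = "\<Sum>m\<in>?L. var_form (\<alpha> (t - m))"
    have Q: "0 \<le> ?Q" "?Q \<le> S"
      unfolding S_def using sum_var_form_le[OF nn sq, of ?L "\<lambda>m. t - m"]
      by (auto intro: sum_nonneg var_form_nonneg simp: inj_on_def)
    have E2: "expectation (\<lambda>x. ?f x * ?f x) = ?Q"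
      by (simp add: expectation_lin_form_mult var_form_eq)
    have "cum4 ?f ?f ?f ?f \<le> (\<Sum>m\<in>?L. K * (var_form (\<alpha> (t - m)))\<^sup>2)"
    proof -
      have "cum4 (\<lambda>x. a \<bullet> Z m x) (\<lambda>x. a \<bullet> Z m x) (\<lambda>x. a \<bullet> Z m x) (\<lambda>x. a \<bullet> Z m x) \<le> K * (var_form a)\<^sup>2" for a m
        using K(2)[of a m a a a] var_form_nonneg[of a] by (simp add: power2_eq_square mult.assoc)
      then show ?thesis
        by (simp add: cum4_lin_form sum_mono)
    qed
    also have "\<dots> \<le> K * ?Q\<^sup>2"
    proof -
      have "(\<Sum>m\<in>?L. (var_form (\<alpha> (t - m)))\<^sup>2) \<le> (\<Sum>m\<in>?L. var_form (\<alpha> (t - m)) * ?Q)"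
        unfolding power2_eq_square
        by (intro sum_mono mult_left_mono var_form_nonneg member_le_sum) auto
      then show ?thesis
        using K(1) by (simp add: sum_distrib_left[symmetric] sum_distrib_right[symmetric] power2_eq_square mult_left_mono)
    qed
    finally have c: "cum4 ?f ?f ?f ?f \<le> K * ?Q\<^sup>2" .
    have "expectation (\<lambda>x. ?f x ^ 4) = cum4 ?f ?f ?f ?f + 3 * ?Q\<^sup>2"
      unfolding cum4_def E2 by (simp add: power2_eq_square power4_eq_xxxx)
    also have "\<dots> \<le> (K + 3) * ?Q\<^sup>2"
      using c by (simp add: algebra_simps)
    also have "\<dots> \<le> (K + 3) * S\<^sup>2"
      using K(1) Q by (intro mult_left_mono power_mono) auto
    finally show ?thesis by (simp add: truncated_lin_form)
  qed
  then show ?thesis using that by blast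
qed

text \<open>Uniform fourth moments bound the products in L2, so the almost sure convergence of the
  truncations suffices. This identifies the limits of the truncated covariances with the covariances
  of the process.\<close>

lemma truncated_product_moment_tendsto:
  assumes nn: "\<And>l. norm (\<alpha> l) \<le> \<psi> l" "\<And>l. norm (\<beta> l) \<le> \<psi> l" and sq: "(\<lambda>l. (\<psi> l)\<^sup>2) summable_on UNIV"
    and [measurable]: "Y \<in> borel_measurable M" "Y' \<in> borel_measurable M"
    and lim: "AE x in M. (\<lambda>N. truncated \<alpha> N t x) \<longlonglongrightarrow> Y x" "AE x in M. (\<lambda>N. truncated \<beta> N u x) \<longlonglongrightarrow> Y' x"
  shows "(\<lambda>N. expectation (\<lambda>x. truncated \<alpha> N t x * truncated \<beta> N u x)) \<longlonglongrightarrow> expectation (\<lambda>x. Y x * Y' x)"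
proof -
  obtain B1 where B1: "\<And>N t. expectation (\<lambda>x. truncated \<alpha> N t x ^ 4) \<le> B1"
    using truncated_fourth_moment_bound[OF nn(1) sq] by metis
  obtain B2 where B2: "\<And>N t. expectation (\<lambda>x. truncated \<beta> N t x ^ 4) \<le> B2"
    using truncated_fourth_moment_bound[OF nn(2) sq] by metis
  note [measurable] = L4_measurable[OF L4_truncated]
  have i2: "integrable M (\<lambda>x. (truncated \<alpha> N t x * truncated \<beta> N u x)\<^sup>2)" for N
    using L4_mult4[OF L4_truncated[of \<alpha> N t] L4_truncated[of \<beta> N u] L4_truncated[of \<alpha> N t] L4_truncated[of \<beta> N u]]
    by (simp add: power2_eq_square mult.assoc)
  have i4: "integrable M (\<lambda>x. truncated \<alpha> N t x ^ 4)" for \<alpha> N t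
    using L4_truncated by (simp add: L4_def)
  show ?thesis
  proof (rule expectation_tendsto_of_L2_bounded(2)[where S = "B1 + B2"])
    show "AE x in M. (\<lambda>N. truncated \<alpha> N t x * truncated \<beta> N u x) \<longlonglongrightarrow> Y x * Y' x"
      using lim by eventually_elim (intro tendsto_mult)
    fix N
    have "(a * b)\<^sup>2 \<le> a ^ 4 + b ^ 4" for a b :: real
    proof -
      have "2 * (a\<^sup>2 * b\<^sup>2) \<le> (a\<^sup>2)\<^sup>2 + (b\<^sup>2)\<^sup>2" using sum_squares_bound[of "a\<^sup>2" "b\<^sup>2"] by simp
      moreover have "0 \<le> a\<^sup>2 * b\<^sup>2" by simp
      ultimately have "a\<^sup>2 * b\<^sup>2 \<le> (a\<^sup>2)\<^sup>2 + (b\<^sup>2)\<^sup>2" by linarith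
      then show ?thesis by (simp add: power_mult_distrib flip: power_mult)
    qed
    then have "expectation (\<lambda>x. (truncated \<alpha> N t x * truncated \<beta> N u x)\<^sup>2) \<le> expectation (\<lambda>x. truncated \<alpha> N t x ^ 4 + truncated \<beta> N u x ^ 4)"
      using i2 i4 by (intro integral_mono) auto
    also have "\<dots> \<le> B1 + B2"
      using B1 B2 i4 by (simp add: add_mono)
    finally show "expectation (\<lambda>x. (truncated \<alpha> N t x * truncated \<beta> N u x)\<^sup>2) \<le> B1 + B2" .
  qed (use i2 in auto)
qed

text \<open>The quadratic form is diagonalised by the trigonometric vectors, so that the cumulant sum
  becomes \<open>\<Sum>\<^sub>m (\<Sum>\<^sub>i \<bar>a\<^sub>i\<bar> sqrt (var_form J\<^sub>i\<^sub>m) sqrt (var_form K\<^sub>i\<^sub>m))\<^sup>2\<close> up to a constant; one factor of the square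
  is bounded uniformly by the window sum, the other one adds up to a variance.\<close>
lemma truncated_cum4_sum_bound:
  fixes w :: "nat \<Rightarrow> real"
  assumes nn: "\<And>l. norm (\<alpha> l) \<le> \<psi> l" "\<And>l. norm (\<beta> l) \<le> \<psi> l"
    and b: "\<And>m. (\<Sum>t\<in>{1..int n}. \<psi> (t - m))\<^sup>2 \<le> b" and S: "finite S" "(\<Sum>s\<in>S. \<bar>a s\<bar>) \<le> C"
    and K: "K \<ge> 0"
    "\<And>a b c d l. \<bar>cum4 (\<lambda>x. a \<bullet> Z l x) (\<lambda>x. b \<bullet> Z l x) (\<lambda>x. c \<bullet> Z l x) (\<lambda>x. d \<bullet> Z l x)\<bar>
       \<le> K * (sqrt (var_form a) * sqrt (var_form b) * sqrt (var_form c) * sqrt (var_form d))"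
  defines "W \<equiv> cosW S a w"
  shows "(\<Sum>p\<in>square_idx n. \<Sum>p'\<in>square_idx n. W (fst p - snd p) * W (fst p' - snd p') *
        cum4 (truncated \<alpha> N (fst p)) (truncated \<beta> N (snd p)) (truncated \<alpha> N (fst p')) (truncated \<beta> N (snd p')))
    \<le> K * (2 * C * second_moment * b) * (\<Sum>i\<in>S \<times> UNIV. \<bar>a (fst i)\<bar> *
        ((\<Sum>t\<in>{1..int n}. \<Sum>u\<in>{1..int n}. trig w i t * trig w i u * expectation (\<lambda>x. truncated \<alpha> N t x * truncated \<alpha> N u x)) +
         (\<Sum>t\<in>{1..int n}. \<Sum>u\<in>{1..int n}. trig w i t * trig w i u * expectation (\<lambda>x. truncated \<beta> N t x * truncated \<beta> N u x))) / 2)"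
proof -
  let ?T = "{1..int n}"
  let ?L = "{1 - int N..int n + int N}"
  let ?I = "S \<times> (UNIV :: bool set)"
  define J where "J i m = (\<Sum>t\<in>?T. trig w i t *\<^sub>R trunc_coeff \<alpha> N t m)" for i m
  define H where "H i m = (\<Sum>t\<in>?T. trig w i t *\<^sub>R trunc_coeff \<beta> N t m)" for i m
  have JJ: "(\<lambda>x. \<Sum>t\<in>?T. trig w i t * truncated \<alpha> N t x) = lin_form (J i) ?L" for i
    unfolding sum_truncated_lin_form by (simp add: J_def[abs_def])
  have HH: "(\<lambda>x. \<Sum>t\<in>?T. trig w i t * truncated \<beta> N t x) = lin_form (H i) ?L" for i
    unfolding sum_truncated_lin_form by (simp add: H_def[abs_def])
  have step1: "(\<Sum>p\<in>square_idx n. \<Sum>p'\<in>square_idx n. W (fst p - snd p) * W (fst p' - snd p') *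
        cum4 (truncated \<alpha> N (fst p)) (truncated \<beta> N (snd p)) (truncated \<alpha> N (fst p')) (truncated \<beta> N (snd p'))) =
     (\<Sum>i\<in>?I. \<Sum>k\<in>?I. a (fst i) * a (fst k) *
       cum4 (lin_form (J i) ?L) (lin_form (H i) ?L) (lin_form (J k) ?L) (lin_form (H k) ?L))"
  proof -
    have "cum4 (lin_form (J i) ?L) (lin_form (H i) ?L) (lin_form (J k) ?L) (lin_form (H k) ?L) =
       (\<Sum>p\<in>square_idx n. \<Sum>p'\<in>square_idx n. (trig w i (fst p) * trig w i (snd p)) * (trig w k (fst p') * trig w k (snd p')) *
        cum4 (truncated \<alpha> N (fst p)) (truncated \<beta> N (snd p)) (truncated \<alpha> N (fst p')) (truncated \<beta> N (snd p')))" for i k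
      unfolding JJ[symmetric] HH[symmetric]
      by (subst cum4_sum) (simp_all add: L4_truncated sum.cartesian_product' mult_ac)
    then show ?thesis
      unfolding W_def cosW_trig[OF S(1)] sum_bilinear_expand by simp
  qed
  have q_le: "var_form v \<le> second_moment * b" if "norm v \<le> (\<Sum>t\<in>?T. \<psi> (t - m))" for v m
  proof -
    have "var_form v \<le> (norm v)\<^sup>2 * second_moment"
      using var_form_le_norm by (simp add: second_moment_def)
    also have "\<dots> \<le> (\<Sum>t\<in>?T. \<psi> (t - m))\<^sup>2 * second_moment"
      using that by (intro mult_right_mono power_mono second_moment_nonneg) auto
    also have "\<dots> \<le> b * second_moment"
      using b by (intro mult_right_mono second_moment_nonneg)
    finally show ?thesis by (simp add: mult.commute)
  qed
  have norm_le: "norm (\<Sum>t\<in>?T. trig w i t *\<^sub>R trunc_coeff \<gamma> N t m) \<le> (\<Sum>t\<in>?T. \<psi> (t - m))"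
    if "\<And>l. norm (\<gamma> l) \<le> \<psi> l" for \<gamma> i m
  proof (rule sum_norm_le)
    fix t
    have "0 \<le> \<psi> (t - m)" using that[of "t - m"] norm_ge_zero order_trans by blast
    then have "norm (trunc_coeff \<gamma> N t m) \<le> \<psi> (t - m)"
      using that by (simp add: trunc_coeff_def)
    then have "\<bar>trig w i t\<bar> * norm (trunc_coeff \<gamma> N t m) \<le> 1 * \<psi> (t - m)"
      by (intro mult_mono abs_trig_le_1) auto
    then show "norm (trig w i t *\<^sub>R trunc_coeff \<gamma> N t m) \<le> \<psi> (t - m)" by simp
  qed
  have qJ: "var_form (J i m) \<le> second_moment * b" and qH: "var_form (H i m) \<le> second_moment * b" for i m
    by (auto simp only: J_def H_def intro!: q_le[of _ m] norm_le nn)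
  define g where "g i m = sqrt (var_form (J i m)) * sqrt (var_form (H i m))" for i m
  have g0: "0 \<le> g i m" for i m
    by (simp add: g_def var_form_nonneg)
  have b0: "0 \<le> b" using b[of 0] by (rule order_trans[rotated]) simp
  have g1: "g i m \<le> second_moment * b" for i m
  proof -
    have "g i m \<le> sqrt (second_moment * b) * sqrt (second_moment * b)"
      unfolding g_def using qJ qH by (intro mult_mono) (auto simp: var_form_nonneg second_moment_nonneg b0)
    then show ?thesis using b0 second_moment_nonneg by simp
  qed
  have g2: "g i m \<le> (var_form (J i m) + var_form (H i m)) / 2" for i m
    using sum_squares_bound[of "sqrt (var_form (J i m))" "sqrt (var_form (H i m))"] var_form_nonneg
    by (simp add: g_def)
  \<comment> \<open>Every weight counts twice, once for the cosine and once for the sine.\<close>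
  have C2: "(\<Sum>i\<in>?I. \<bar>a (fst i)\<bar>) \<le> 2 * C"
  proof -
    have "(\<Sum>i\<in>?I. \<bar>a (fst i)\<bar>) = (\<Sum>s\<in>S. \<Sum>\<sigma>\<in>(UNIV::bool set). \<bar>a s\<bar>)"
      by (simp add: sum.cartesian_product')
    also have "\<dots> = 2 * (\<Sum>s\<in>S. \<bar>a s\<bar>)"
      by (simp add: UNIV_bool sum_distrib_left)
    finally show ?thesis using S(2) by simp
  qed
  have cum: "\<bar>cum4 (lin_form (J i) ?L) (lin_form (H i) ?L) (lin_form (J k) ?L) (lin_form (H k) ?L)\<bar>
     \<le> (\<Sum>m\<in>?L. K * (g i m * g k m))" for i k
  proof -
    have "\<bar>cum4 (lin_form (J i) ?L) (lin_form (H i) ?L) (lin_form (J k) ?L) (lin_form (H k) ?L)\<bar> \<le>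
      (\<Sum>m\<in>?L. \<bar>cum4 (\<lambda>x. J i m \<bullet> Z m x) (\<lambda>x. H i m \<bullet> Z m x) (\<lambda>x. J k m \<bullet> Z m x) (\<lambda>x. H k m \<bullet> Z m x)\<bar>)"
      by (subst cum4_lin_form) (auto intro: sum_abs)
    also have "\<dots> \<le> (\<Sum>m\<in>?L. K * (g i m * g k m))"
    proof (rule sum_mono)
      fix m
      show "\<bar>cum4 (\<lambda>x. J i m \<bullet> Z m x) (\<lambda>x. H i m \<bullet> Z m x) (\<lambda>x. J k m \<bullet> Z m x) (\<lambda>x. H k m \<bullet> Z m x)\<bar> \<le> K * (g i m * g k m)"
        using K(2)[of "J i m" m "H i m" "J k m" "H k m"] by (simp add: g_def mult.assoc)
    qed
    finally show ?thesis .
  qed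
  have "(\<Sum>i\<in>?I. \<Sum>k\<in>?I. a (fst i) * a (fst k) *
       cum4 (lin_form (J i) ?L) (lin_form (H i) ?L) (lin_form (J k) ?L) (lin_form (H k) ?L))
    \<le> (\<Sum>i\<in>?I. \<Sum>k\<in>?I. \<bar>a (fst i)\<bar> * \<bar>a (fst k)\<bar> * (\<Sum>m\<in>?L. K * (g i m * g k m)))"
  proof (intro sum_mono)
    fix i k
    have "a (fst i) * a (fst k) * cum4 (lin_form (J i) ?L) (lin_form (H i) ?L) (lin_form (J k) ?L) (lin_form (H k) ?L)
      \<le> \<bar>a (fst i) * a (fst k)\<bar> * \<bar>cum4 (lin_form (J i) ?L) (lin_form (H i) ?L) (lin_form (J k) ?L) (lin_form (H k) ?L)\<bar>"
      unfolding abs_mult[symmetric] by (rule abs_ge_self)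
    also have "\<dots> \<le> \<bar>a (fst i) * a (fst k)\<bar> * (\<Sum>m\<in>?L. K * (g i m * g k m))"
      by (intro mult_left_mono cum) auto
    finally show "a (fst i) * a (fst k) * cum4 (lin_form (J i) ?L) (lin_form (H i) ?L) (lin_form (J k) ?L) (lin_form (H k) ?L)
      \<le> \<bar>a (fst i)\<bar> * \<bar>a (fst k)\<bar> * (\<Sum>m\<in>?L. K * (g i m * g k m))" by (simp add: abs_mult)
  qed
  also have "\<dots> = (\<Sum>i\<in>?I. \<Sum>k\<in>?I. \<Sum>m\<in>?L. K * ((\<bar>a (fst i)\<bar> * g i m) * (\<bar>a (fst k)\<bar> * g k m)))"
    by (simp only: sum_distrib_left mult_ac)
  also have "\<dots> = (\<Sum>i\<in>?I. \<Sum>m\<in>?L. \<Sum>k\<in>?I. K * ((\<bar>a (fst i)\<bar> * g i m) * (\<bar>a (fst k)\<bar> * g k m)))"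
    by (rule sum.cong[OF refl], rule sum.swap)
  also have "\<dots> = (\<Sum>m\<in>?L. \<Sum>i\<in>?I. \<Sum>k\<in>?I. K * ((\<bar>a (fst i)\<bar> * g i m) * (\<bar>a (fst k)\<bar> * g k m)))"
    by (rule sum.swap)
  also have "\<dots> = (\<Sum>m\<in>?L. K * ((\<Sum>i\<in>?I. \<bar>a (fst i)\<bar> * g i m) * (\<Sum>i\<in>?I. \<bar>a (fst i)\<bar> * g i m)))"
    by (simp only: sum_product, simp only: sum_distrib_left)
  also have "\<dots> \<le> (\<Sum>m\<in>?L. K * ((2 * C * second_moment * b) * (\<Sum>i\<in>?I. \<bar>a (fst i)\<bar> * ((var_form (J i m) + var_form (H i m)) / 2))))"
  proof (intro sum_mono mult_left_mono mult_mono)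
    fix m
    have "(\<Sum>i\<in>?I. \<bar>a (fst i)\<bar> * g i m) \<le> (\<Sum>i\<in>?I. \<bar>a (fst i)\<bar> * (second_moment * b))"
      by (intro sum_mono mult_left_mono g1) auto
    also have "\<dots> = (\<Sum>i\<in>?I. \<bar>a (fst i)\<bar>) * (second_moment * b)"
      by (simp only: sum_distrib_right)
    also have "\<dots> \<le> 2 * C * (second_moment * b)"
      by (intro mult_right_mono C2) (simp add: b0 second_moment_nonneg)
    finally show "(\<Sum>i\<in>?I. \<bar>a (fst i)\<bar> * g i m) \<le> 2 * C * second_moment * b" by (simp add: mult.assoc)
    show "0 \<le> 2 * C * second_moment * b"
      using S(2) b0 second_moment_nonneg by (smt (verit) mult_nonneg_nonneg sum_nonneg abs_ge_zero)
  qed (use g2 in \<open>auto intro!: sum_nonneg mult_nonneg_nonneg g0 K simp: field_simps\<close>)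
  also have "\<dots> = K * (2 * C * second_moment * b) * (\<Sum>m\<in>?L. \<Sum>i\<in>?I. \<bar>a (fst i)\<bar> * ((var_form (J i m) + var_form (H i m)) / 2))"
    by (simp only: sum_distrib_left mult.assoc)
  also have "(\<Sum>m\<in>?L. \<Sum>i\<in>?I. \<bar>a (fst i)\<bar> * ((var_form (J i m) + var_form (H i m)) / 2)) =
     (\<Sum>i\<in>?I. \<Sum>m\<in>?L. \<bar>a (fst i)\<bar> * ((var_form (J i m) + var_form (H i m)) / 2))"
    by (rule sum.swap)
  also have "\<dots> = (\<Sum>i\<in>?I. \<bar>a (fst i)\<bar> * ((\<Sum>m\<in>?L. var_form (J i m)) + (\<Sum>m\<in>?L. var_form (H i m))) / 2)"
    by (simp only: sum_distrib_left[symmetric] sum_divide_distrib[symmetric] sum.distrib times_divide_eq_right)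
  \<comment> \<open>By independence the variances of the single inputs add up to the variance of the
    whole transform. In this way covariances replace coefficients, and they can be estimated after
    the passage to the limit.\<close>
  also have "(\<lambda>i. \<Sum>m\<in>?L. var_form (J i m)) =
     (\<lambda>i. \<Sum>t\<in>?T. \<Sum>u\<in>?T. trig w i t * trig w i u * expectation (\<lambda>x. truncated \<alpha> N t x * truncated \<alpha> N u x))"
  proof
    fix i
    have "(\<Sum>m\<in>?L. var_form (J i m)) = expectation (\<lambda>x. lin_form (J i) ?L x * lin_form (J i) ?L x)"
      by (simp add: expectation_lin_form_mult var_form_eq)
    also have "\<dots> = expectation (\<lambda>x. \<Sum>t\<in>?T. \<Sum>u\<in>?T. trig w i t * trig w i u * (truncated \<alpha> N t x * truncated \<alpha> N u x))"
      unfolding JJ[symmetric] by (simp add: sum_product mult_ac)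
    also have "\<dots> = (\<Sum>t\<in>?T. \<Sum>u\<in>?T. trig w i t * trig w i u * expectation (\<lambda>x. truncated \<alpha> N t x * truncated \<alpha> N u x))"
      by (simp add: Bochner_Integration.integral_sum Bochner_Integration.integrable_sum L4_mult2 L4_truncated)
    finally show "(\<Sum>m\<in>?L. var_form (J i m)) = 
      (\<Sum>t\<in>?T. \<Sum>u\<in>?T. trig w i t * trig w i u * expectation (\<lambda>x. truncated \<alpha> N t x * truncated \<alpha> N u x))" .
  qed
  also have "(\<lambda>i. \<Sum>m\<in>?L. var_form (H i m)) =
     (\<lambda>i. \<Sum>t\<in>?T. \<Sum>u\<in>?T. trig w i t * trig w i u * expectation (\<lambda>x. truncated \<beta> N t x * truncated \<beta> N u x))"
  proof
    fix i
    have "(\<Sum>m\<in>?L. var_form (H i m)) = expectation (\<lambda>x. lin_form (H i) ?L x * lin_form (H i) ?L x)"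
      by (simp add: expectation_lin_form_mult var_form_eq)
    also have "\<dots> = expectation (\<lambda>x. \<Sum>t\<in>?T. \<Sum>u\<in>?T. trig w i t * trig w i u * (truncated \<beta> N t x * truncated \<beta> N u x))"
      unfolding HH[symmetric] by (simp add: sum_product mult_ac)
    also have "\<dots> = (\<Sum>t\<in>?T. \<Sum>u\<in>?T. trig w i t * trig w i u * expectation (\<lambda>x. truncated \<beta> N t x * truncated \<beta> N u x))"
      by (simp add: Bochner_Integration.integral_sum Bochner_Integration.integrable_sum L4_mult2 L4_truncated)
    finally show "(\<Sum>m\<in>?L. var_form (H i m)) = 
      (\<Sum>t\<in>?T. \<Sum>u\<in>?T. trig w i t * trig w i u * expectation (\<lambda>x. truncated \<beta> N t x * truncated \<beta> N u x))" .
  qed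
  finally show ?thesis unfolding step1 .
qed


text \<open>At fixed \<open>n\<close> every term of the truncated bound is a finite sum of
  covariances, so the bound converges as \<open>N\<close> grows, and Fatou's lemma carries it over
  to the process. In the limit the variance of a transform is at most \<open>n\<close> times an
  absolute sum of autocovariances; with window sums b n = o(n) the cumulant part is o(n^2).\<close>

lemma linear_gaussian_quadratic_forms:
  assumes nn: "\<And>l. norm (\<alpha> l) \<le> \<psi> l" "\<And>l. norm (\<beta> l) \<le> \<psi> l" and sq: "(\<lambda>l. (\<psi> l)\<^sup>2) summable_on UNIV"
    and meas [measurable]: "\<And>t. Y t \<in> borel_measurable M" "\<And>t. Y' t \<in> borel_measurable M"
    and lim: "\<And>t. AE x in M. (\<lambda>N. truncated \<alpha> N t x) \<longlonglongrightarrow> Y t x" "\<And>t. AE x in M. (\<lambda>N. truncated \<beta> N t x) \<longlonglongrightarrow> Y' t x"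
    and gj: "\<And>t u. expectation (\<lambda>x. Y t x * Y u x) = gj (t - u)" "(\<lambda>h. \<bar>gj h\<bar>) summable_on UNIV"
    and gk: "\<And>t u. expectation (\<lambda>x. Y' t x * Y' u x) = gk (t - u)" "(\<lambda>h. \<bar>gk h\<bar>) summable_on UNIV"
    and gjk: "\<And>t u. expectation (\<lambda>x. Y t x * Y' u x) = gjk (t - u)"
  shows "gaussian_quadratic_forms M Y Y' gj gk gjk"
  unfolding gaussian_quadratic_forms_def
proof
  fix C :: real
  obtain K where K: "K \<ge> 0"
    "\<And>a b c d l. \<bar>cum4 (\<lambda>x. a \<bullet> Z l x) (\<lambda>x. b \<bullet> Z l x) (\<lambda>x. c \<bullet> Z l x) (\<lambda>x. d \<bullet> Z l x)\<bar>
       \<le> K * (sqrt (var_form a) * sqrt (var_form b) * sqrt (var_form c) * sqrt (var_form d))"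
    using cum4_form_bound by metis
  have \<psi>0: "0 \<le> \<psi> l" for l using nn(1)[of l] norm_ge_zero order_trans by blast
  obtain b :: "nat \<Rightarrow> real" where b: "\<And>n m. (\<Sum>t\<in>{1..int n}. \<psi> (t - m))\<^sup>2 \<le> b n" "(\<lambda>n. b n / real n) \<longlonglongrightarrow> 0"
    using square_summable_window[OF \<psi>0 sq] by metis
  have b0: "0 \<le> b n" for n by (rule order_trans[OF zero_le_power2 b(1)])
  define Gj Gk where "Gj = infsum (\<lambda>h. \<bar>gj h\<bar>) UNIV" and "Gk = infsum (\<lambda>h. \<bar>gk h\<bar>) UNIV"
  \<comment> \<open>The product of the uniform factor
    \<open>K * (2 * C * second_moment * b n)\<close>, a further total weight \<open>C\<close>, and
    \<open>real n * (Gj + Gk)\<close> for the variances, divided by n^2.\<close>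
  define R where "R n = 2 * K * C\<^sup>2 * second_moment * (Gj + Gk) * (b n / real n)" for n
  have R_lim: "R \<longlonglongrightarrow> 0"
    unfolding R_def[abs_def] using tendsto_mult_right_zero[OF b(2)] by simp
  have main: "integrable M (\<lambda>x. ((\<Sum>p\<in>square_idx n. cosW S a w (fst p - snd p) * (Y (fst p) x * Y' (snd p) x)) - c)\<^sup>2) \<and>
      integral\<^sup>L M (\<lambda>x. ((\<Sum>p\<in>square_idx n. cosW S a w (fst p - snd p) * (Y (fst p) x * Y' (snd p) x)) - c)\<^sup>2)
       \<le> ((\<Sum>p\<in>square_idx n. cosW S a w (fst p - snd p) * gjk (fst p - snd p)) - c)\<^sup>2
          + gauss_var n (cosW S a w) gj gk gjk + R n * (real n)\<^sup>2"
    if S: "finite S" "(\<Sum>s\<in>S. \<bar>a s\<bar>) \<le> C" for n S a w c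
  proof -
    define W where "W = cosW S a w"
    let ?T = "{1..int n}"
    let ?E = "\<lambda>N \<alpha> t \<beta> u. expectation (\<lambda>x. truncated \<alpha> N t x * truncated \<beta> N u x)"
    note mom = truncated_product_moment_tendsto[OF nn(1) nn(1) sq meas(1) meas(1) lim(1) lim(1), unfolded gj(1)]
      truncated_product_moment_tendsto[OF nn(2) nn(2) sq meas(2) meas(2) lim(2) lim(2), unfolded gk(1)]
      truncated_product_moment_tendsto[OF nn(1) nn(2) sq meas(1) meas(2) lim(1) lim(2), unfolded gjk]
    have mom': "(\<lambda>N. ?E N \<beta> u \<alpha> t) \<longlonglongrightarrow> gjk (t - u)" for t u
      using mom(3)[of t u] by (simp add: mult.commute)
    define f where "f N x = ((\<Sum>p\<in>square_idx n. W (fst p - snd p) * (truncated \<alpha> N (fst p) x * truncated \<beta> N (snd p) x)) - c)\<^sup>2" for N x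
    define D where "D = K * (2 * C * second_moment * b n)"
    define bd where "bd N = ((\<Sum>p\<in>square_idx n. W (fst p - snd p) * ?E N \<alpha> (fst p) \<beta> (snd p)) - c)\<^sup>2 +
      (\<Sum>p\<in>square_idx n. \<Sum>p'\<in>square_idx n. W (fst p - snd p) * W (fst p' - snd p') *
        (?E N \<alpha> (fst p) \<alpha> (fst p') * ?E N \<beta> (snd p) \<beta> (snd p') +
         ?E N \<alpha> (fst p) \<beta> (snd p') * ?E N \<beta> (snd p) \<alpha> (fst p'))) +
      D * (\<Sum>i\<in>S \<times> UNIV. \<bar>a (fst i)\<bar> *
        ((\<Sum>t\<in>?T. \<Sum>u\<in>?T. trig w i t * trig w i u * ?E N \<alpha> t \<alpha> u) +
         (\<Sum>t\<in>?T. \<Sum>u\<in>?T. trig w i t * trig w i u * ?E N \<beta> t \<beta> u)) / 2)" for N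
    define B where "B = ((\<Sum>p\<in>square_idx n. W (fst p - snd p) * gjk (fst p - snd p)) - c)\<^sup>2 + gauss_var n W gj gk gjk +
      D * (\<Sum>i\<in>S \<times> UNIV. \<bar>a (fst i)\<bar> *
        ((\<Sum>t\<in>?T. \<Sum>u\<in>?T. trig w i t * trig w i u * gj (t - u)) +
         (\<Sum>t\<in>?T. \<Sum>u\<in>?T. trig w i t * trig w i u * gk (t - u))) / 2)"
    have lim_bd: "bd \<longlonglongrightarrow> B"
      unfolding bd_def[abs_def] B_def gauss_var_def
      by (intro tendsto_add tendsto_mult tendsto_sum tendsto_power tendsto_diff tendsto_const tendsto_divide mom mom') simp
    have f_bd: "expectation (f N) \<le> bd N" for N
    proof -
      have "expectation (f N) = ((\<Sum>p\<in>square_idx n. W (fst p - snd p) * ?E N \<alpha> (fst p) \<beta> (snd p)) - c)\<^sup>2 +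
        (\<Sum>p\<in>square_idx n. \<Sum>p'\<in>square_idx n. W (fst p - snd p) * W (fst p' - snd p') *
          (?E N \<alpha> (fst p) \<alpha> (fst p') * ?E N \<beta> (snd p) \<beta> (snd p') +
           ?E N \<alpha> (fst p) \<beta> (snd p') * ?E N \<beta> (snd p) \<alpha> (fst p'))) +
        (\<Sum>p\<in>square_idx n. \<Sum>p'\<in>square_idx n. W (fst p - snd p) * W (fst p' - snd p') *
          cum4 (truncated \<alpha> N (fst p)) (truncated \<beta> N (snd p)) (truncated \<alpha> N (fst p')) (truncated \<beta> N (snd p')))"
        unfolding f_def[abs_def] by (rule expectation_quadratic_form(2)) (rule L4_truncated)+
      also have "\<dots> \<le> bd N"
        unfolding bd_def D_def W_def
        by (intro add_left_mono truncated_cum4_sum_bound[OF nn b(1) S K])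
      finally show ?thesis .
    qed
    have f_int: "integrable M (f N)" for N
      unfolding f_def[abs_def] by (rule expectation_quadratic_form(1)) (rule L4_truncated)+
    have all: "AE x in M. \<forall>t. (\<lambda>N. truncated \<alpha> N t x) \<longlonglongrightarrow> Y t x" "AE x in M. \<forall>t. (\<lambda>N. truncated \<beta> N t x) \<longlonglongrightarrow> Y' t x"
      using lim by (auto simp: AE_all_countable)
    have f_lim: "AE x in M. (\<lambda>N. f N x) \<longlonglongrightarrow> ((\<Sum>p\<in>square_idx n. W (fst p - snd p) * (Y (fst p) x * Y' (snd p) x)) - c)\<^sup>2"
      using all
    proof eventually_elim
      fix x assume "\<forall>t. (\<lambda>N. truncated \<alpha> N t x) \<longlonglongrightarrow> Y t x" "\<forall>t. (\<lambda>N. truncated \<beta> N t x) \<longlonglongrightarrow> Y' t x"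
      then show "(\<lambda>N. f N x) \<longlonglongrightarrow> ((\<Sum>p\<in>square_idx n. W (fst p - snd p) * (Y (fst p) x * Y' (snd p) x)) - c)\<^sup>2"
        unfolding f_def by (intro tendsto_power tendsto_diff tendsto_sum tendsto_mult tendsto_const) auto
    qed
    have m: "(\<lambda>x. ((\<Sum>p\<in>square_idx n. W (fst p - snd p) * (Y (fst p) x * Y' (snd p) x)) - c)\<^sup>2) \<in> borel_measurable M"
      by measurable
    have f0: "0 \<le> f N x" for N x by (simp add: f_def)
    note fat = fatou_expectation[OF f_int f0 m f_lim f_bd lim_bd]
    \<comment> \<open>The trigonometric factors are at most 1, and each of the \<open>n\<close> rows
      is at most the absolute sum: the variance of a transform is O(n) at every frequency.\<close>
    have trig_le: "(\<Sum>t\<in>?T. \<Sum>u\<in>?T. trig w i t * trig w i u * g (t - u)) \<le> real n * infsum (\<lambda>h. \<bar>g h\<bar>) UNIV"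
      if "(\<lambda>h. \<bar>g h\<bar>) summable_on UNIV" for g :: "int \<Rightarrow> real" and i
    proof -
      have "(\<Sum>t\<in>?T. \<Sum>u\<in>?T. trig w i t * trig w i u * g (t - u)) \<le> (\<Sum>t\<in>?T. \<Sum>u\<in>?T. \<bar>g (t - u)\<bar>)"
      proof (intro sum_mono)
        fix t u
        have "trig w i t * trig w i u * g (t - u) \<le> \<bar>trig w i t * trig w i u * g (t - u)\<bar>" by simp
        also have "\<dots> \<le> 1 * 1 * \<bar>g (t - u)\<bar>"
          unfolding abs_mult by (intro mult_mono abs_trig_le_1) auto
        finally show "trig w i t * trig w i u * g (t - u) \<le> \<bar>g (t - u)\<bar>" by simp
      qed
      also have "\<dots> \<le> (\<Sum>t\<in>?T. infsum (\<lambda>h. \<bar>g h\<bar>) UNIV)"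
        using that by (intro sum_mono sum_shift_le_infsum) (auto simp: inj_on_def)
      finally show ?thesis by simp
    qed
    have C0: "0 \<le> C" using S(2) by (smt (verit) sum_nonneg abs_ge_zero)
    have D0: "0 \<le> D" using K(1) C0 b0 by (simp add: D_def second_moment_nonneg)
    have G0: "0 \<le> Gj" "0 \<le> Gk" unfolding Gj_def Gk_def by (auto intro: infsum_nonneg)
    have "(\<Sum>i\<in>S \<times> UNIV. \<bar>a (fst i)\<bar> *
        ((\<Sum>t\<in>?T. \<Sum>u\<in>?T. trig w i t * trig w i u * gj (t - u)) +
         (\<Sum>t\<in>?T. \<Sum>u\<in>?T. trig w i t * trig w i u * gk (t - u))) / 2) \<le>
       (\<Sum>i\<in>S \<times> (UNIV :: bool set). \<bar>a (fst i)\<bar> * (real n * Gj + real n * Gk) / 2)"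
      unfolding Gj_def Gk_def
      by (intro sum_mono divide_right_mono mult_left_mono add_mono trig_le gj(2) gk(2)) auto
    also have "\<dots> = (\<Sum>s\<in>S. \<Sum>\<sigma>\<in>(UNIV :: bool set). \<bar>a s\<bar> * (real n * Gj + real n * Gk) / 2)"
      by (simp add: sum.cartesian_product')
    also have "\<dots> = (\<Sum>s\<in>S. \<bar>a s\<bar>) * (real n * (Gj + Gk))"
      unfolding sum_distrib_right by (intro sum.cong refl) (simp add: UNIV_bool distrib_left)
    also have "\<dots> \<le> C * (real n * (Gj + Gk))"
      using S(2) G0 by (intro mult_right_mono) auto
    finally have "D * (\<Sum>i\<in>S \<times> UNIV. \<bar>a (fst i)\<bar> *
        ((\<Sum>t\<in>?T. \<Sum>u\<in>?T. trig w i t * trig w i u * gj (t - u)) +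
         (\<Sum>t\<in>?T. \<Sum>u\<in>?T. trig w i t * trig w i u * gk (t - u))) / 2) \<le> D * (C * (real n * (Gj + Gk)))"
      using D0 by (rule mult_left_mono)
    also have "\<dots> = R n * (real n)\<^sup>2"
      by (cases "n = 0") (simp_all add: D_def R_def power2_eq_square)
    finally have "B \<le> ((\<Sum>p\<in>square_idx n. W (fst p - snd p) * gjk (fst p - snd p)) - c)\<^sup>2 + gauss_var n W gj gk gjk + R n * (real n)\<^sup>2"
      unfolding B_def by (rule add_left_mono)
    with fat show ?thesis
      unfolding W_def[symmetric] by (auto intro: order_trans)
  qed
  show "\<exists>R. R \<longlonglongrightarrow> 0 \<and> (\<forall>n S a w c. finite S \<longrightarrow> (\<Sum>s\<in>S. \<bar>a s\<bar>) \<le> C \<longrightarrow>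
      integrable M (\<lambda>x. ((\<Sum>p\<in>square_idx n. cosW S a w (fst p - snd p) * (Y (fst p) x * Y' (snd p) x)) - c)\<^sup>2) \<and>
      integral\<^sup>L M (\<lambda>x. ((\<Sum>p\<in>square_idx n. cosW S a w (fst p - snd p) * (Y (fst p) x * Y' (snd p) x)) - c)\<^sup>2)
       \<le> ((\<Sum>p\<in>square_idx n. cosW S a w (fst p - snd p) * gjk (fst p - snd p)) - c)\<^sup>2
          + gauss_var n (cosW S a w) gj gk gjk + R n * (real n)\<^sup>2)"
    using R_lim main by blast
qed

end

section \<open>Quadratic forms under cumulant summability\<close>

text \<open>\<open>F\<close> receives the number of blocks and the product over the blocks. This
  generality lets the recursion absorb a removed block into \<open>F\<close>.\<close>

definition partition_sum :: "('b set \<Rightarrow> real) \<Rightarrow> 'b set \<Rightarrow> (nat \<Rightarrow> real \<Rightarrow> real) \<Rightarrow> real" where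
  "partition_sum m A F = (\<Sum>Q\<in>{Q. partition_on A Q}. F (card Q) (\<Prod>B\<in>Q. m B))"

lemma partition_sum_empty: "partition_sum m {} F = F 0 1"
  by (simp add: partition_sum_def partition_on_empty)

text \<open>A partition of \<open>insert x A\<close> amounts to the block \<open>insert x B\<close>
  that contains \<open>x\<close> and a partition of the remaining set \<open>A - B\<close>.\<close>

lemma partition_sum_insert:
  fixes A :: "'b set"
  assumes "finite A" "x \<notin> A"
  shows "partition_sum m (insert x A) F =
    (\<Sum>B\<in>Pow A. partition_sum m (A - B) (\<lambda>k p. F (Suc k) (m (insert x B) * p)))"
proof -
  have fin: "finite Q" if "partition_on C Q" "C \<subseteq> A" for C Q
    using that assms(1) finite_elements finite_subset by metis
  have fin': "finite {Q. partition_on (A - B) Q}" for B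
    using assms(1) by (intro finitely_many_partition_on) auto
  have nin: "insert x B \<notin> Q" if "partition_on (A - B) Q" for B Q
    using that assms(2) unfolding partition_on_def by auto
  have block: "\<exists>!B. x \<in> B \<and> B \<in> Q" if "partition_on (insert x A) Q" for Q
  proof -
    have "x \<in> \<Union>Q" using partition_onD1[OF that] by blast
    moreover have "B = C" if "x \<in> B" "B \<in> Q" "x \<in> C" "C \<in> Q" for B C
      using disjointD[OF partition_onD2[OF \<open>partition_on (insert x A) Q\<close>] that(2,4)] that(1,3) by blast
    ultimately show ?thesis by blast
  qed
  let ?S = "SIGMA B:Pow A. {Q. partition_on (A - B) Q}"
  have "(\<Sum>(B, Q)\<in>?S. F (Suc (card Q)) (m (insert x B) * (\<Prod>B\<in>Q. m B))) =
     (\<Sum>Q\<in>{Q. partition_on (insert x A) Q}. F (card Q) (\<Prod>B\<in>Q. m B))"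
  proof (rule sum.reindex_bij_witness[of _ "\<lambda>Q. let B = (THE B. x \<in> B \<and> B \<in> Q) in (B - {x}, Q - {B})"
        "\<lambda>(B, Q). insert (insert x B) Q"], goal_cases)
    case (1 BQ)
    then obtain B Q where BQ: "BQ = (B, Q)" "B \<subseteq> A" "partition_on (A - B) Q" by auto
    have "x \<notin> \<Union>Q" using BQ(3) assms(2) unfolding partition_on_def by auto
    then have "(THE B'. x \<in> B' \<and> B' \<in> insert (insert x B) Q) = insert x B"
      by (intro the_equality) auto
    moreover have "insert x B - {x} = B" using BQ(2) assms(2) by auto
    ultimately show ?case using nin[OF BQ(3)] BQ(1) by (simp add: Let_def)
  next
    case (2 BQ)
    then obtain B Q where BQ: "BQ = (B, Q)" "B \<subseteq> A" "partition_on (A - B) Q" by auto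
    have "insert x B \<inter> C = {}" if "C \<in> Q" for C
      using that partition_onD1[OF BQ(3)] assms(2) by blast
    moreover have "\<Union>(insert (insert x B) Q) = insert x A"
      using partition_onD1[OF BQ(3)] BQ(2) by auto
    ultimately have "partition_on (insert x A) (insert (insert x B) Q)"
      using partition_onD2[OF BQ(3)] partition_onD3[OF BQ(3)]
      by (auto simp: partition_on_def pairwise_insert disjnt_def)
    then show ?case using BQ(1) by simp
  next
    case (3 Q)
    then have Q: "partition_on (insert x A) Q" by simp
    then have "\<exists>!B. x \<in> B \<and> B \<in> Q"
      by (rule block)
    then have B: "x \<in> (THE B. x \<in> B \<and> B \<in> Q)" "(THE B. x \<in> B \<and> B \<in> Q) \<in> Q"
      by (metis (mono_tags, lifting) theI')+
    then show ?case by (simp add: Let_def insert_absorb)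
  next
    case (4 Q)
    then have Q: "partition_on (insert x A) Q" by simp
    then have "\<exists>!B. x \<in> B \<and> B \<in> Q"
      by (rule block)
    then obtain B where B: "(THE B. x \<in> B \<and> B \<in> Q) = B" "x \<in> B" "B \<in> Q"
      by (metis (mono_tags, lifting) theI')
    have "\<Union>(Q - {B}) = \<Union>Q - B"
      using disjointD[OF partition_onD2[OF Q] B(3)] by blast
    also have "\<dots> = A - (B - {x})"
      unfolding partition_onD1[OF Q, symmetric] using B(2) assms(2) by auto
    finally have "partition_on (A - (B - {x})) (Q - {B})"
      using partition_onD2[OF Q] partition_onD3[OF Q]
      by (auto simp: partition_on_def intro: pairwise_subset)
    moreover have "B - {x} \<subseteq> A" using Q B(3) unfolding partition_on_def by auto
    ultimately show ?case using B(1) by (simp add: Let_def)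
  next
    case (5 BQ)
    then obtain B Q where BQ: "BQ = (B, Q)" "B \<subseteq> A" "partition_on (A - B) Q" by auto
    have "finite Q" using BQ fin by blast
    then show ?case using nin[OF BQ(3)] BQ(1) by simp
  qed
  then have "(\<Sum>Q\<in>{Q. partition_on (insert x A) Q}. F (card Q) (\<Prod>B\<in>Q. m B)) =
     (\<Sum>(B, Q)\<in>?S. F (Suc (card Q)) (m (insert x B) * (\<Prod>B\<in>Q. m B)))" by simp
  also have "\<dots> = (\<Sum>B\<in>Pow A. \<Sum>Q\<in>{Q. partition_on (A - B) Q}. F (Suc (card Q)) (m (insert x B) * (\<Prod>B\<in>Q. m B)))"
    using assms(1) fin' by (subst sum.Sigma) auto
  finally show ?thesis by (simp add: partition_sum_def)
qed

lemma sum_Pow_insert: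
  fixes f :: "'b set \<Rightarrow> real"
  assumes "finite A" "x \<notin> A"
  shows "(\<Sum>B\<in>Pow (insert x A). f B) = (\<Sum>B\<in>Pow A. f B) + (\<Sum>B\<in>Pow A. f (insert x B))"
proof -
  have "inj_on (insert x) (Pow A)" using assms(2) by (auto simp: inj_on_def)
  then show ?thesis
    using assms unfolding Pow_insert by (subst sum.union_disjoint) (auto simp: sum.reindex)
qed

text \<open>The fifteen partitions of four points, grouped by block sizes 4, 3+1, 2+2, 2+1+1 and
  1+1+1+1, come out of the recursion on the block of one point.\<close>

lemma partition_sum_4:
  "partition_sum m {..<4::nat} F =
    F 1 (m {0,1,2,3}) +
    (F 2 (m {0} * m {1,2,3}) + F 2 (m {1} * m {0,2,3}) + F 2 (m {2} * m {0,1,3}) + F 2 (m {3} * m {0,1,2})) +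
    (F 2 (m {0,1} * m {2,3}) + F 2 (m {0,2} * m {1,3}) + F 2 (m {0,3} * m {1,2})) +
    (F 3 (m {0,1} * m {2} * m {3}) + F 3 (m {0,2} * m {1} * m {3}) + F 3 (m {0,3} * m {1} * m {2}) +
     F 3 (m {1,2} * m {0} * m {3}) + F 3 (m {1,3} * m {0} * m {2}) + F 3 (m {2,3} * m {0} * m {1})) +
    F 4 (m {0} * m {1} * m {2} * m {3})"
proof -
  have "{..<4::nat} = {0,1,2,3}" by auto
  then show ?thesis
    by (simp add: partition_sum_insert partition_sum_empty sum_Pow_insert insert_Diff_if
        numeral_2_eq_2 numeral_3_eq_3 mult_ac eval_nat_numeral)
qed


context prob_space
begin

text \<open>Multiplying out and collecting by type of partition leaves the coefficients 1, -1, -1,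
  2, -6, that is (-1)^(k-1) (k-1)! for k blocks. This connects \<open>cum4\<close> with
  \<open>joint_cumulant\<close>.\<close>

lemma cum4_centered:
  assumes L: "L4 a" "L4 b" "L4 c" "L4 d"
  defines "E \<equiv> expectation"
  shows "cum4 (\<lambda>x. a x - E a) (\<lambda>x. b x - E b) (\<lambda>x. c x - E c) (\<lambda>x. d x - E d) =
    E (\<lambda>x. a x * b x * c x * d x)
    - (E a * E (\<lambda>x. b x * c x * d x) + E b * E (\<lambda>x. a x * c x * d x) + E c * E (\<lambda>x. a x * b x * d x) + E d * E (\<lambda>x. a x * b x * c x))
    - (E (\<lambda>x. a x * b x) * E (\<lambda>x. c x * d x) + E (\<lambda>x. a x * c x) * E (\<lambda>x. b x * d x) + E (\<lambda>x. a x * d x) * E (\<lambda>x. b x * c x))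
    + 2 * (E (\<lambda>x. a x * b x) * E c * E d + E (\<lambda>x. a x * c x) * E b * E d + E (\<lambda>x. a x * d x) * E b * E c +
       E (\<lambda>x. b x * c x) * E a * E d + E (\<lambda>x. b x * d x) * E a * E c + E (\<lambda>x. c x * d x) * E a * E b)
    - 6 * (E a * E b * E c * E d)"
proof -
  have E2: "E (\<lambda>x. (u x - E u) * (v x - E v)) = E (\<lambda>x. u x * v x) - E u * E v" if "L4 u" "L4 v" for u v
  proof -
    have "(\<lambda>x. (u x - E u) * (v x - E v)) = (\<lambda>x. u x * v x - E v * u x - E u * v x + E u * E v)"
      by (simp add: algebra_simps)
    then show ?thesis
      unfolding E_def using that by (simp add: L4_mult2 L4_integrable prob_space)
  qed
  define \<alpha> \<beta> \<gamma> \<delta> where "\<alpha> = E a" "\<beta> = E b" "\<gamma> = E c" "\<delta> = E d"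
  have eq: "(\<lambda>x. (a x - \<alpha>) * (b x - \<beta>) * (c x - \<gamma>) * (d x - \<delta>)) = (\<lambda>x. a x * b x * c x * d x
    - \<alpha> * (b x * c x * d x) - \<beta> * (a x * c x * d x) - \<gamma> * (a x * b x * d x) - \<delta> * (a x * b x * c x)
    + \<gamma> * \<delta> * (a x * b x) + \<beta> * \<delta> * (a x * c x) + \<beta> * \<gamma> * (a x * d x)
    + \<alpha> * \<delta> * (b x * c x) + \<alpha> * \<gamma> * (b x * d x) + \<alpha> * \<beta> * (c x * d x)
    - \<beta> * \<gamma> * \<delta> * a x - \<alpha> * \<gamma> * \<delta> * b x - \<alpha> * \<beta> * \<delta> * c x - \<alpha> * \<beta> * \<gamma> * d x + \<alpha> * \<beta> * \<gamma> * \<delta>)"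
    by (simp add: algebra_simps)
  have E4: "E (\<lambda>x. (a x - \<alpha>) * (b x - \<beta>) * (c x - \<gamma>) * (d x - \<delta>)) = E (\<lambda>x. a x * b x * c x * d x)
    - \<alpha> * E (\<lambda>x. b x * c x * d x) - \<beta> * E (\<lambda>x. a x * c x * d x) - \<gamma> * E (\<lambda>x. a x * b x * d x) - \<delta> * E (\<lambda>x. a x * b x * c x)
    + \<gamma> * \<delta> * E (\<lambda>x. a x * b x) + \<beta> * \<delta> * E (\<lambda>x. a x * c x) + \<beta> * \<gamma> * E (\<lambda>x. a x * d x)
    + \<alpha> * \<delta> * E (\<lambda>x. b x * c x) + \<alpha> * \<gamma> * E (\<lambda>x. b x * d x) + \<alpha> * \<beta> * E (\<lambda>x. c x * d x)
    - \<beta> * \<gamma> * \<delta> * E a - \<alpha> * \<gamma> * \<delta> * E b - \<alpha> * \<beta> * \<delta> * E c - \<alpha> * \<beta> * \<gamma> * E d + \<alpha> * \<beta> * \<gamma> * \<delta>"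
    unfolding eq E_def using L by (simp add: L4_mult4 L4_mult3 L4_mult2 L4_integrable prob_space)
  note E2' = E2[OF L(1,2)] E2[OF L(1,3)] E2[OF L(1,4)] E2[OF L(2,3)] E2[OF L(2,4)] E2[OF L(3,4)]
  show ?thesis
    unfolding cum4_def E_def[symmetric] E2' E4[unfolded \<alpha>_\<beta>_\<gamma>_\<delta>_def]
    by (simp add: algebra_simps)
qed

lemma joint_cumulant_4:
  assumes "\<And>i. i < 4 \<Longrightarrow> L4 (Y i)"
  shows "joint_cumulant M 4 Y = cum4 (\<lambda>x. Y 0 x - expectation (Y 0)) (\<lambda>x. Y 1 x - expectation (Y 1))
     (\<lambda>x. Y 2 x - expectation (Y 2)) (\<lambda>x. Y 3 x - expectation (Y 3))"
proof -
  have "joint_cumulant M 4 Y = partition_sum (\<lambda>B. expectation (\<lambda>x. \<Prod>i\<in>B. Y i x)) {..<4} (\<lambda>k p. (- 1) ^ (k - 1) * fact (k - 1) * p)"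
    by (simp add: joint_cumulant_def partition_sum_def)
  also have "\<dots> = cum4 (\<lambda>x. Y 0 x - expectation (Y 0)) (\<lambda>x. Y 1 x - expectation (Y 1))
     (\<lambda>x. Y 2 x - expectation (Y 2)) (\<lambda>x. Y 3 x - expectation (Y 3))"
    using assms by (subst cum4_centered) (simp_all add: partition_sum_4 fact_numeral algebra_simps)
  finally show ?thesis .
qed

end

lemma stationary_expectation:
  fixes X :: "int \<Rightarrow> 'w \<Rightarrow> real^'m" and G :: "(int \<Rightarrow> real^'m) \<Rightarrow> real"
  assumes st: "strictly_stationary P X" and "finite T" and G: "G \<in> borel_measurable (PiM T (\<lambda>_. borel))"
  shows "integral\<^sup>L P (\<lambda>x. G (\<lambda>t\<in>T. X (t + h) x)) = integral\<^sup>L P (\<lambda>x. G (\<lambda>t\<in>T. X t x))"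
proof -
  have m: "(\<lambda>x. \<lambda>t\<in>T. X (t + h) x) \<in> measurable P (PiM T (\<lambda>_. borel))" for h
    using st by (intro measurable_restrict) (auto simp: strictly_stationary_def)
  have "distr P (PiM T (\<lambda>_. borel)) (\<lambda>x. \<lambda>t\<in>T. X (t + h) x) = distr P (PiM T (\<lambda>_. borel)) (\<lambda>x. \<lambda>t\<in>T. X t x)"
    using st assms(2) by (auto simp: strictly_stationary_def)
  then show ?thesis
    using integral_distr[OF m[of h] G] integral_distr[OF m[of 0] G] by simp
qed

text \<open>Slots filled with the constant 1 make means and covariances instances of the same
  invariance as fourth moments.\<close>

lemma stationary_expectation_4:
  fixes X :: "int \<Rightarrow> 'w \<Rightarrow> real^'m" and f g k l :: "real^'m \<Rightarrow> real"
  assumes st: "strictly_stationary P X"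
    and [measurable]: "f \<in> borel_measurable borel" "g \<in> borel_measurable borel"
      "k \<in> borel_measurable borel" "l \<in> borel_measurable borel"
  shows "integral\<^sup>L P (\<lambda>x. f (X (r + h) x) * g (X (s + h) x) * k (X (t + h) x) * l (X (u + h) x)) =
    integral\<^sup>L P (\<lambda>x. f (X r x) * g (X s x) * k (X t x) * l (X u x))"
proof -
  let ?T = "{r, s, t, u}"
  have [measurable]: "(\<lambda>z. z i) \<in> borel_measurable (PiM ?T (\<lambda>_. borel))" if "i \<in> ?T" for i
    using that by (rule measurable_component_singleton)
  have "(\<lambda>z. f (z r) * g (z s) * k (z t) * l (z u)) \<in> borel_measurable (PiM ?T (\<lambda>_. borel))"
    by measurable
  from stationary_expectation[OF st _ this, of h] show ?thesis by simp
qed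

lemma measurable_centered_component [measurable]:
  "(\<lambda>v::real^'m. v $ j - c) \<in> borel_measurable borel"
  by (intro borel_measurable_continuous_onI continuous_intros)

lemma stationary_autocov:
  fixes X :: "int \<Rightarrow> 'w \<Rightarrow> real^'m"
  assumes "strictly_stationary P X"
  shows "integral\<^sup>L P (\<lambda>x. (X t x $ j - proc_mean P X $ j) * (X u x $ k - proc_mean P X $ k)) = autocov P X j k (t - u)"
proof -
  have one: "(\<lambda>v::real^'m. 1::real) \<in> borel_measurable borel" by simp
  note m = measurable_centered_component
  from stationary_expectation_4[OF assms m[of j "proc_mean P X $ j"] m[of k "proc_mean P X $ k"] one one,
      where r = "t - u" and h = u and s = 0]
  show ?thesis
    by (simp add: autocov_def)
qed

text \<open>Moving the last time to 0 expresses each cumulant through three lags. For a fixed last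
  time, different triples of times give different lags, so all n^4 cumulants together amount to at
  most \<open>real n * Kc\<close> in absolute value; a bounded kernel keeps this O(n), which is
  small against n^2.\<close>

lemma cumulant_gaussian_quadratic_forms:
  fixes X :: "int \<Rightarrow> 'w \<Rightarrow> real^'m"
  assumes "prob_space P" and st: "strictly_stationary P X" and cc: "cumulant_cond P X"
  shows "gaussian_quadratic_forms P (\<lambda>t x. X t x $ j - proc_mean P X $ j) (\<lambda>t x. X t x $ k - proc_mean P X $ k)
     (autocov P X j j) (autocov P X k k) (autocov P X j k)"
proof -
  interpret prob_space P by fact
  define \<mu> where "\<mu> = proc_mean P X"
  define Y where "Y i t x = X t x $ i - \<mu> $ i" for i t x
  have X_meas [measurable]: "X t \<in> borel_measurable P" for t
    using st by (simp add: strictly_stationary_def)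
  have c_meas [measurable]: "(\<lambda>x. X t x $ i) \<in> borel_measurable P" for t i
    using measurable_compose[OF X_meas measurable_centered_component[of i 0]] by simp
  have L4X: "L4 (\<lambda>x. X t x $ i)" for t i
  proof -
    have "integrable P (\<lambda>x. \<bar>X t x $ i\<bar> ^ 4)"
      using cc unfolding cumulant_cond_def by blast
    then show ?thesis by (simp add: L4_def power_even_abs)
  qed
  have mean: "expectation (\<lambda>x. X t x $ i) = \<mu> $ i" for t i
  proof -
    have one: "(\<lambda>v::real^'m. 1::real) \<in> borel_measurable borel" by simp
    from stationary_expectation_4[OF st measurable_centered_component[of i 0] one one one,
        where r = 0 and h = t]
    have "expectation (\<lambda>x. X t x $ i) = expectation (\<lambda>x. X 0 x $ i)" by simp
    also have "\<dots> = \<mu> $ i"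
    proof -
      have "integrable P (X 0)"
      proof (rule Bochner_Integration.integrable_bound)
        show "integrable P (\<lambda>x. \<Sum>i\<in>UNIV. \<bar>X 0 x $ i\<bar>)"
          using L4_integrable[OF L4X] by auto
        show "AE x in P. norm (X 0 x) \<le> norm (\<Sum>i\<in>UNIV. \<bar>X 0 x $ i\<bar>)"
          by (intro AE_I2 order_trans[OF norm_le_l1_cart]) simp
      qed simp
      from integral_bounded_linear[OF bounded_linear_vec_nth this, of i] show ?thesis
        by (simp add: \<mu>_def proc_mean_def)
    qed
    finally show ?thesis .
  qed
  have L4Y: "L4 (Y i t)" for i t
    unfolding Y_def[abs_def] using L4_add[OF L4X L4_const, of t i "- \<mu> $ i"] by simp
  have mom: "expectation (\<lambda>x. Y i t x * Y l u x) = autocov P X i l (t - u)" for i l t u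
    unfolding Y_def \<mu>_def by (rule stationary_autocov[OF st])
  \<comment> \<open>The components alternate as j, k, j, k, the order in which the squared quadratic
    form produces them.\<close>
  define a :: "nat \<Rightarrow> 'm" where "a i = (if even i then j else k)" for i
  define jc where "jc v = joint_cumulant P 4 (\<lambda>i \<omega>. if i < 4 - 1 then X (v i) \<omega> $ a i else X 0 \<omega> $ a (4 - 1))" for v
  \<comment> \<open>The condition at order 4 with lag index 0. The weight is at least 1, so the
    cumulants themselves are absolutely summable.\<close>
  have "(\<lambda>v. (1 + real_of_int \<bar>v 0\<bar>) * \<bar>jc v\<bar>) summable_on (PiE {..<4 - 1} (\<lambda>_. UNIV))"
    using cc[unfolded cumulant_cond_def, THEN conjunct2, rule_format, of 4 0 a] unfolding jc_def by simp
  then have "(\<lambda>v. \<bar>jc v\<bar>) summable_on (PiE {..<4 - 1} (\<lambda>_. UNIV))"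
    by (rule summable_on_comparison_test) (auto simp: mult_le_cancel_right1)
  then have sm: "(\<lambda>v. \<bar>jc v\<bar>) summable_on (PiE {..<3::nat} (\<lambda>_. UNIV))" by simp
  define Kc where "Kc = infsum (\<lambda>v. \<bar>jc v\<bar>) (PiE {..<3::nat} (\<lambda>_. UNIV))"
  \<comment> \<open>Lags relative to the last time \<open>snd p'\<close>, restricted to three
    indices to lie in the function space of the cumulant condition.\<close>
  define v where "v p p' = (\<lambda>i\<in>{..<3::nat}. if i = 0 then fst p - snd p' else if i = 1 then snd p - snd p' else fst p' - snd p' :: int)" for p p'
  have jc: "cum4 (Y j (fst p)) (Y k (snd p)) (Y j (fst p')) (Y k (snd p')) = jc (v p p')" for p p'
  proof -
    obtain t u t' u' where p: "p = (t, u)" "p' = (t', u')" by fastforce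
    note m = measurable_centered_component
    from stationary_expectation_4[OF st m[of j "\<mu> $ j"] m[of k "\<mu> $ k"] m[of j "\<mu> $ j"] m[of k "\<mu> $ k"],
        where r = "t - u'" and h = u' and s = "u - u'" and t = "t' - u'" and u = 0]
    have "expectation (\<lambda>x. Y j t x * Y k u x * Y j t' x * Y k u' x) =
      expectation (\<lambda>x. Y j (t - u') x * Y k (u - u') x * Y j (t' - u') x * Y k 0 x)"
      by (simp add: Y_def)
    then have "cum4 (Y j t) (Y k u) (Y j t') (Y k u') = cum4 (Y j (t - u')) (Y k (u - u')) (Y j (t' - u')) (Y k 0)"
      unfolding cum4_def mom by simp
    also have "\<dots> = jc (v p p')"
    proof -
      let ?V = "\<lambda>i \<omega>. if i < 4 - 1 then X (v p p' i) \<omega> $ a i else X 0 \<omega> $ a (4 - 1)"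
      have "L4 (?V i)" for i using L4X by (cases "i < 4 - 1") simp_all
      from joint_cumulant_4[of ?V, OF this] show ?thesis
        unfolding jc_def by (simp add: p v_def a_def Y_def[abs_def] mean)
    qed
    finally show ?thesis by (simp add: p)
  qed
  have vP: "v p p' \<in> PiE {..<3} (\<lambda>_. UNIV)" for p p'
    by (simp add: v_def PiE_iff)
  have inner: "(\<Sum>x\<in>square_idx n \<times> {1..int n}. \<bar>jc (v (fst x) (snd x, u'))\<bar>) \<le> Kc" for n u'
  proof -
    let ?g = "\<lambda>x. v (fst x) (snd x, u')"
    have inj: "inj_on ?g (square_idx n \<times> {1..int n})"
    proof (rule inj_onI)
      fix x y assume "?g x = ?g y"
      then have "?g x 0 = ?g y 0" "?g x 1 = ?g y 1" "?g x 2 = ?g y 2" by auto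
      then show "x = y" by (simp add: v_def prod_eq_iff)
    qed
    have "(\<Sum>x\<in>square_idx n \<times> {1..int n}. \<bar>jc (?g x)\<bar>) = (\<Sum>z\<in>?g ` (square_idx n \<times> {1..int n}). \<bar>jc z\<bar>)"
      using sum.reindex[OF inj, of "\<lambda>z. \<bar>jc z\<bar>"] by simp
    also have "\<dots> \<le> Kc"
      unfolding Kc_def by (intro finite_sum_le_infsum sm image_subsetI vP) auto
    finally show ?thesis .
  qed
  have total: "(\<Sum>p\<in>square_idx n. \<Sum>p'\<in>square_idx n. \<bar>jc (v p p')\<bar>) \<le> real n * Kc" for n
  proof -
    have "(\<Sum>p\<in>square_idx n. \<Sum>p'\<in>square_idx n. \<bar>jc (v p p')\<bar>) =
      (\<Sum>p\<in>square_idx n. \<Sum>t'\<in>{1..int n}. \<Sum>u'\<in>{1..int n}. \<bar>jc (v p (t', u'))\<bar>)"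
      by (rule sum.cong[OF refl], rule sum.cartesian_product')
    also have "\<dots> = (\<Sum>x\<in>square_idx n \<times> {1..int n}. \<Sum>u'\<in>{1..int n}. \<bar>jc (v (fst x) (snd x, u'))\<bar>)"
      by (subst sum.cartesian_product'[of _ "square_idx n"]) simp
    also have "\<dots> = (\<Sum>u'\<in>{1..int n}. \<Sum>x\<in>square_idx n \<times> {1..int n}. \<bar>jc (v (fst x) (snd x, u'))\<bar>)"
      by (rule sum.swap)
    also have "\<dots> \<le> (\<Sum>u'\<in>{1..int n}. Kc)"
      by (intro sum_mono inner)
    finally show ?thesis by simp
  qed
  show ?thesis
    unfolding gaussian_quadratic_forms_def \<mu>_def[symmetric] Y_def[symmetric]
  proof
    fix C :: real
    define R where "R n = C\<^sup>2 * Kc * (1 / real n)" for n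
    have "R \<longlonglongrightarrow> 0"
      unfolding R_def[abs_def] by (rule tendsto_mult_right_zero) (rule lim_1_over_n)
    moreover have "integrable P (\<lambda>x. ((\<Sum>p\<in>square_idx n. cosW S b w (fst p - snd p) * (Y j (fst p) x * Y k (snd p) x)) - c)\<^sup>2) \<and>
      expectation (\<lambda>x. ((\<Sum>p\<in>square_idx n. cosW S b w (fst p - snd p) * (Y j (fst p) x * Y k (snd p) x)) - c)\<^sup>2)
       \<le> ((\<Sum>p\<in>square_idx n. cosW S b w (fst p - snd p) * autocov P X j k (fst p - snd p)) - c)\<^sup>2
          + gauss_var n (cosW S b w) (autocov P X j j) (autocov P X k k) (autocov P X j k) + R n * (real n)\<^sup>2"
      if S: "finite S" "(\<Sum>s\<in>S. \<bar>b s\<bar>) \<le> C" for n S b w c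
    proof (intro conjI)
      let ?W = "cosW S b w"
      show "integrable P (\<lambda>x. ((\<Sum>p\<in>square_idx n. ?W (fst p - snd p) * (Y j (fst p) x * Y k (snd p) x)) - c)\<^sup>2)"
        by (rule expectation_quadratic_form(1)) (rule L4Y)+
      \<comment> \<open>Reversing the lag exchanges the components; \<open>gauss_var\<close> uses
        the orientation j, k throughout.\<close>
      have com: "autocov P X k j (t - u) = autocov P X j k (u - t)" for t u
        using mom[of k t j u] mom[of j u k t] by (simp add: mult.commute)
      have "(\<Sum>p\<in>square_idx n. \<Sum>p'\<in>square_idx n. ?W (fst p - snd p) * ?W (fst p' - snd p') *
          cum4 (Y j (fst p)) (Y k (snd p)) (Y j (fst p')) (Y k (snd p'))) \<le>
        (\<Sum>p\<in>square_idx n. \<Sum>p'\<in>square_idx n. C * C * \<bar>jc (v p p')\<bar>)"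
      proof (intro sum_mono)
        fix p p'
        have "?W (fst p - snd p) * ?W (fst p' - snd p') * jc (v p p') \<le> \<bar>?W (fst p - snd p) * ?W (fst p' - snd p') * jc (v p p')\<bar>"
          by (rule abs_ge_self)
        also have "\<dots> \<le> C * C * \<bar>jc (v p p')\<bar>"
          unfolding abs_mult using abs_cosW_le[OF S(2)] order_trans[OF abs_ge_zero abs_cosW_le[OF S(2)]]
          by (intro mult_mono mult_nonneg_nonneg) auto
        finally show "?W (fst p - snd p) * ?W (fst p' - snd p') * cum4 (Y j (fst p)) (Y k (snd p)) (Y j (fst p')) (Y k (snd p'))
          \<le> C * C * \<bar>jc (v p p')\<bar>" unfolding jc .
      qed
      also have "\<dots> = C\<^sup>2 * (\<Sum>p\<in>square_idx n. \<Sum>p'\<in>square_idx n. \<bar>jc (v p p')\<bar>)"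
        by (simp only: sum_distrib_left power2_eq_square)
      also have "\<dots> \<le> C\<^sup>2 * (real n * Kc)"
        by (intro mult_left_mono total) simp
      also have "\<dots> = R n * (real n)\<^sup>2"
        by (cases "n = 0") (simp_all add: R_def power2_eq_square)
      finally have rem: "(\<Sum>p\<in>square_idx n. \<Sum>p'\<in>square_idx n. ?W (fst p - snd p) * ?W (fst p' - snd p') *
          cum4 (Y j (fst p)) (Y k (snd p)) (Y j (fst p')) (Y k (snd p'))) \<le> R n * (real n)\<^sup>2" .
      show "expectation (\<lambda>x. ((\<Sum>p\<in>square_idx n. ?W (fst p - snd p) * (Y j (fst p) x * Y k (snd p) x)) - c)\<^sup>2)
       \<le> ((\<Sum>p\<in>square_idx n. ?W (fst p - snd p) * autocov P X j k (fst p - snd p)) - c)\<^sup>2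
          + gauss_var n ?W (autocov P X j j) (autocov P X k k) (autocov P X j k) + R n * (real n)\<^sup>2"
        using rem
        by (subst expectation_quadratic_form(2)[OF L4Y L4Y]) (simp add: gauss_var_def mom com)
    qed
    ultimately show "\<exists>R. R \<longlonglongrightarrow> 0 \<and> (\<forall>n S a w c. finite S \<longrightarrow> (\<Sum>s\<in>S. \<bar>a s\<bar>) \<le> C \<longrightarrow>
      integrable P (\<lambda>x. ((\<Sum>p\<in>square_idx n. cosW S a w (fst p - snd p) * (Y j (fst p) x * Y k (snd p) x)) - c)\<^sup>2) \<and>
      expectation (\<lambda>x. ((\<Sum>p\<in>square_idx n. cosW S a w (fst p - snd p) * (Y j (fst p) x * Y k (snd p) x)) - c)\<^sup>2)
       \<le> ((\<Sum>p\<in>square_idx n. cosW S a w (fst p - snd p) * autocov P X j k (fst p - snd p)) - c)\<^sup>2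
          + gauss_var n (cosW S a w) (autocov P X j j) (autocov P X k k) (autocov P X j k) + R n * (real n)\<^sup>2)"
      by blast
  qed
qed

section \<open>Fourier frequencies and the periodogram\<close>

text \<open>A geometric sum over the powers of an n-th root of unity other than 1.\<close>

lemma sum_cis_fourier:
  fixes r :: int
  assumes "n > 0" "\<not> int n dvd r"
  shows "(\<Sum>t\<in>{1..int n}. cis (2 * pi * real_of_int r / real n * real_of_int t)) = 0"
proof -
  define z where "z = cis (2 * pi * real_of_int r / real n)"
  have "z \<noteq> 1"
  proof
    assume "z = 1"
    then have "cos (2 * pi * real_of_int r / real n) = 1"
      unfolding z_def by (metis cis.sel(1) one_complex.sel(1))
    then obtain k :: int where "2 * pi * real_of_int r / real n = real_of_int k * 2 * pi"
      unfolding cos_one_2pi_int by blast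
    then have "real_of_int r = real_of_int (k * int n)"
      using assms(1) by (simp add: field_simps)
    then have "r = k * int n" by (simp only: of_int_eq_iff)
    then show False using assms(2) by simp
  qed
  have "z ^ n = 1"
  proof -
    have "real n * (2 * pi * real_of_int r / real n) = 2 * pi * real_of_int r"
      using assms(1) by simp
    then have "z ^ n = cis (2 * pi * real_of_int r)"
      by (simp only: z_def Complex.DeMoivre)
    also have "\<dots> = 1"
      by (simp add: cis_multiple_2pi)
    finally show ?thesis .
  qed
  have "(\<Sum>t\<in>{1..int n}. cis (2 * pi * real_of_int r / real n * real_of_int t)) = (\<Sum>i<n. z ^ Suc i)"
    by (rule sum.reindex_bij_witness[of _ "\<lambda>i. int (Suc i)" "\<lambda>t. nat (t - 1)"])
       (auto simp: z_def Complex.DeMoivre mult_ac simp del: power_Suc)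
  also have "\<dots> = z * (\<Sum>i<n. z ^ i)"
    by (simp add: sum_distrib_left)
  also have "\<dots> = 0"
    using \<open>z \<noteq> 1\<close> \<open>z ^ n = 1\<close> by (simp add: geometric_sum)
  finally show ?thesis .
qed

lemma
  fixes r :: int
  assumes "n > 0" "\<not> int n dvd r"
  shows sum_cos_fourier: "(\<Sum>t\<in>{1..int n}. cos (2 * pi * real_of_int r / real n * real_of_int t)) = 0"
    and sum_sin_fourier: "(\<Sum>t\<in>{1..int n}. sin (2 * pi * real_of_int r / real n * real_of_int t)) = 0"
  using arg_cong[OF sum_cis_fourier[OF assms], of Re] arg_cong[OF sum_cis_fourier[OF assms], of Im] by simp_all

text \<open>The addition formula separates the two times. It serves the orthogonality of the cosines
  as well as the removal of constants from the periodogram.\<close>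

lemma sum_square_cos_mult:
  fixes y z :: "int \<Rightarrow> real"
  shows "(\<Sum>p\<in>square_idx n. cos (w * real_of_int (fst p - snd p)) * (y (fst p) * z (snd p))) =
    (\<Sum>t\<in>{1..int n}. cos (w * real_of_int t) * y t) * (\<Sum>u\<in>{1..int n}. cos (w * real_of_int u) * z u) +
    (\<Sum>t\<in>{1..int n}. sin (w * real_of_int t) * y t) * (\<Sum>u\<in>{1..int n}. sin (w * real_of_int u) * z u)"
proof -
  have "(\<Sum>p\<in>square_idx n. cos (w * real_of_int (fst p - snd p)) * (y (fst p) * z (snd p))) =
    (\<Sum>t\<in>{1..int n}. \<Sum>u\<in>{1..int n}. (cos (w * real_of_int t) * y t) * (cos (w * real_of_int u) * z u) +
      (sin (w * real_of_int t) * y t) * (sin (w * real_of_int u) * z u))"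
    unfolding sum.cartesian_product' by (simp add: right_diff_distrib cos_diff algebra_simps)
  also have "\<dots> = (\<Sum>t\<in>{1..int n}. \<Sum>u\<in>{1..int n}. (cos (w * real_of_int t) * y t) * (cos (w * real_of_int u) * z u)) +
     (\<Sum>t\<in>{1..int n}. \<Sum>u\<in>{1..int n}. (sin (w * real_of_int t) * y t) * (sin (w * real_of_int u) * z u))"
    by (simp only: sum.distrib)
  finally show ?thesis by (simp only: sum_product)
qed

lemma sum_square_cos_fourier:
  fixes r :: int
  assumes "n > 0" "\<not> int n dvd r"
  shows "(\<Sum>p\<in>square_idx n. cos (2 * pi * real_of_int r / real n * real_of_int (fst p - snd p))) = 0"
  using sum_square_cos_mult[where y = "\<lambda>_. 1" and z = "\<lambda>_. 1" and n = n and w = "2 * pi * real_of_int r / real n"]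
    sum_cos_fourier[OF assms] sum_sin_fourier[OF assms] by simp

text \<open>Cosines at distinct Fourier frequencies of the lower half are orthogonal over the pairs
  of times: the product formula yields the indices s - s' and s + s', neither of them a multiple of
  \<open>n\<close>. On the diagonal cos^2 <= 1 is enough.\<close>

lemma cosW_parseval:
  assumes "n > 0" "S \<subseteq> {1..n div 2}"
  shows "(\<Sum>p\<in>square_idx n. (cosW S a (fourier_freq n) (fst p - snd p))\<^sup>2) \<le> (real n)\<^sup>2 * (\<Sum>s\<in>S. (a s)\<^sup>2)"
proof -
  have fS: "finite S" using assms(2) finite_subset by blast
  let ?c = "\<lambda>s p. cos (fourier_freq n s * real_of_int (fst p - snd p))"
  have off: "(\<Sum>p\<in>square_idx n. ?c s p * ?c s' p) = 0" if "s \<in> S" "s' \<in> S" "s \<noteq> s'" for s s'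
  proof -
    have b: "1 \<le> s" "s \<le> n div 2" "1 \<le> s'" "s' \<le> n div 2" using that assms(2) by auto
    \<comment> \<open>Distinct indices cannot both equal \<open>n div 2\<close>, so the sum stays
      below \<open>n\<close> even for even \<open>n\<close>.\<close>
    have lt: "s + s' < n" using b that(3) by linarith
    have ndvd: "\<not> int n dvd r" if "r \<noteq> 0" "\<bar>r\<bar> < int n" for r
      using dvd_imp_le_int[of r "int n"] that by auto
    have "\<not> int n dvd (int s - int s')"
      using that(3) lt by (intro ndvd) auto
    then have z1: "(\<Sum>p\<in>square_idx n. cos (2 * pi * real_of_int (int s - int s') / real n * real_of_int (fst p - snd p))) = 0"
      using assms(1) by (rule sum_square_cos_fourier[rotated])
    have "\<not> int n dvd (int s + int s')"
      using b(1) lt by (intro ndvd) auto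
    then have z2: "(\<Sum>p\<in>square_idx n. cos (2 * pi * real_of_int (int s + int s') / real n * real_of_int (fst p - snd p))) = 0"
      using assms(1) by (rule sum_square_cos_fourier[rotated])
    have eq: "?c s p * ?c s' p = (cos (2 * pi * real_of_int (int s - int s') / real n * real_of_int (fst p - snd p)) +
      cos (2 * pi * real_of_int (int s + int s') / real n * real_of_int (fst p - snd p))) / 2" for p
    proof -
      have "2 * pi * real_of_int (int s - int s') / real n * h = fourier_freq n s * h - fourier_freq n s' * h"
        "2 * pi * real_of_int (int s + int s') / real n * h = fourier_freq n s * h + fourier_freq n s' * h" for h
        by (simp_all add: fourier_freq_def algebra_simps diff_divide_distrib add_divide_distrib)
      then show ?thesis by (simp only: cos_times_cos)
    qed
    show ?thesis
      unfolding eq sum_divide_distrib[symmetric] sum.distrib z1 z2 by simp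
  qed
  have "(\<Sum>p\<in>square_idx n. (cosW S a (fourier_freq n) (fst p - snd p))\<^sup>2) =
     (\<Sum>p\<in>square_idx n. \<Sum>s\<in>S. \<Sum>s'\<in>S. a s * a s' * (?c s p * ?c s' p))"
    unfolding cosW_def power2_eq_square sum_product by (simp only: mult_ac)
  also have "\<dots> = (\<Sum>s\<in>S. \<Sum>s'\<in>S. \<Sum>p\<in>square_idx n. a s * a s' * (?c s p * ?c s' p))"
    by (subst sum.swap) (rule sum.cong[OF refl], rule sum.swap)
  also have "\<dots> = (\<Sum>s\<in>S. \<Sum>s'\<in>S. if s = s' then a s * a s' * (\<Sum>p\<in>square_idx n. ?c s p * ?c s' p) else 0)"
    using off by (intro sum.cong refl) (simp add: sum_distrib_left[symmetric])
  also have "\<dots> = (\<Sum>s\<in>S. a s * a s * (\<Sum>p\<in>square_idx n. ?c s p * ?c s p))"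
    using fS by simp
  also have "\<dots> \<le> (\<Sum>s\<in>S. (a s)\<^sup>2 * (real n)\<^sup>2)"
  proof (rule sum_mono)
    fix s
    have "(\<Sum>p\<in>square_idx n. ?c s p * ?c s p) \<le> (\<Sum>p\<in>square_idx n. 1)"
      by (intro sum_mono) (simp add: power2_eq_square[symmetric] abs_square_le_1)
    then have "(\<Sum>p\<in>square_idx n. ?c s p * ?c s p) \<le> (real n)\<^sup>2"
      by (simp add: power2_eq_square)
    then show "a s * a s * (\<Sum>p\<in>square_idx n. ?c s p * ?c s p) \<le> (a s)\<^sup>2 * (real n)\<^sup>2"
      unfolding power2_eq_square[of "a s"] by (rule mult_left_mono) simp
  qed
  finally show ?thesis by (simp add: sum_distrib_left mult.commute)
qed

text \<open>Reading a lag as the set of pairs with that difference unites both signs of the lag and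
  the vanishing at large lags, where there are no pairs. Summation over the lags then runs through
  the whole square.\<close>

lemma acov_hat_eq:
  fixes x :: "int \<Rightarrow> real^'m"
  shows "acov_hat n x j k h = (1 / real n) * (\<Sum>p\<in>{p\<in>square_idx n. fst p - snd p = h}.
     (x (fst p) $ j - sample_mean n x $ j) * (x (snd p) $ k - sample_mean n x $ k))"
proof (cases "\<bar>h\<bar> < int n")
  case False
  then have e: "{p\<in>square_idx n. fst p - snd p = h} = {}" by auto
  have "acov_hat n x j k h = 0" using False by (auto simp: acov_hat_def)
  then show ?thesis by (simp only: e sum.empty mult_zero_right)
next
  case True
  show ?thesis
  proof (cases "0 \<le> h")
    case h: True
    have "(\<Sum>t\<in>{1..int n - h}. (x (t + h) $ j - sample_mean n x $ j) * (x t $ k - sample_mean n x $ k)) =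
      (\<Sum>p\<in>{p\<in>square_idx n. fst p - snd p = h}. (x (fst p) $ j - sample_mean n x $ j) * (x (snd p) $ k - sample_mean n x $ k))"
      using h by (intro sum.reindex_bij_witness[of _ "\<lambda>p. snd p" "\<lambda>t. (t + h, t)"]) auto
    then show ?thesis using True h by (simp add: acov_hat_def acov_hat_nonneg_def)
  next
    case h: False
    have "(\<Sum>t\<in>{1..int n + h}. (x (t - h) $ k - sample_mean n x $ k) * (x t $ j - sample_mean n x $ j)) =
      (\<Sum>p\<in>{p\<in>square_idx n. fst p - snd p = h}. (x (fst p) $ j - sample_mean n x $ j) * (x (snd p) $ k - sample_mean n x $ k))"
      using h by (intro sum.reindex_bij_witness[of _ "\<lambda>p. fst p" "\<lambda>t. (t, t - h)"]) auto
    then show ?thesis using True h by (simp add: acov_hat_def acov_hat_nonneg_def)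
  qed
qed

lemma Re_periodogram_fourier:
  fixes x :: "int \<Rightarrow> real^'m"
  assumes "0 < s" "s < n"
  shows "Re (periodogram n x j k (fourier_freq n s)) = 1 / (2 * pi * real n) *
    (\<Sum>p\<in>square_idx n. cos (fourier_freq n s * real_of_int (fst p - snd p)) * ((x (fst p) $ j - c) * (x (snd p) $ k - d)))"
proof -
  let ?w = "fourier_freq n s"
  let ?Q = "\<lambda>c d. \<Sum>p\<in>square_idx n. cos (?w * real_of_int (fst p - snd p)) * ((x (fst p) $ j - c) * (x (snd p) $ k - d))"
  have Re_cmul: "Re (complex_of_real u * z) = u * Re z" for u z
    by simp
  have Re_exp: "Re (exp (- \<i> * complex_of_real u) * complex_of_real v) = cos u * v" for u v
    by (simp add: exp_eq_polar Re_exp)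
  have "Re (periodogram n x j k ?w) = 1 / (2 * pi) * (\<Sum>h\<in>{- int n..int n}. cos (?w * real_of_int h) * acov_hat n x j k h)"
    unfolding periodogram_def by (simp only: Re_cmul Re_sum Re_exp)
  also have "(\<Sum>h\<in>{- int n..int n}. cos (?w * real_of_int h) * acov_hat n x j k h) =
     (\<Sum>h\<in>{- int n..int n}. \<Sum>p\<in>{p\<in>square_idx n. fst p - snd p = h}. 1 / real n * (cos (?w * real_of_int (fst p - snd p)) *
      ((x (fst p) $ j - sample_mean n x $ j) * (x (snd p) $ k - sample_mean n x $ k))))"
    unfolding acov_hat_eq sum_distrib_left by (intro sum.cong refl) auto
  also have "\<dots> = (\<Sum>p\<in>square_idx n. 1 / real n * (cos (?w * real_of_int (fst p - snd p)) *
      ((x (fst p) $ j - sample_mean n x $ j) * (x (snd p) $ k - sample_mean n x $ k))))"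
    by (rule sum.group) auto
  also have "\<dots> = 1 / real n * ?Q (sample_mean n x $ j) (sample_mean n x $ k)"
    by (simp only: sum_distrib_left)
  also have "?Q (sample_mean n x $ j) (sample_mean n x $ k) = ?Q c d"
  proof -
    have "\<not> int n dvd int s"
      using assms zdvd_not_zless by auto
    then have z: "(\<Sum>t\<in>{1..int n}. cos (?w * real_of_int t)) = 0" "(\<Sum>t\<in>{1..int n}. sin (?w * real_of_int t)) = 0"
      using sum_cos_fourier[of n "int s"] sum_sin_fourier[of n "int s"] assms by (simp_all add: fourier_freq_def)
    have "(\<Sum>t\<in>{1..int n}. cos (?w * real_of_int t) * (x t $ i - e)) = (\<Sum>t\<in>{1..int n}. cos (?w * real_of_int t) * x t $ i)"
      "(\<Sum>t\<in>{1..int n}. sin (?w * real_of_int t) * (x t $ i - e)) = (\<Sum>t\<in>{1..int n}. sin (?w * real_of_int t) * x t $ i)" for i e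
      using z by (simp_all add: right_diff_distrib sum_subtractf sum_distrib_right[symmetric])
    then show ?thesis
      unfolding sum_square_cos_mult[of _ "\<lambda>t. x t $ j - _" "\<lambda>t. x t $ k - _"] by simp
  qed
  finally show ?thesis by simp
qed

section \<open>Least squares weights and variance bounds\<close>

lemma power_sums:
  "(\<Sum>i\<in>{1..M}. real i) = real M * (real M + 1) / 2"
  "(\<Sum>i\<in>{1..M}. real i ^ 2) = real M * (real M + 1) * (2 * real M + 1) / 6"
  "(\<Sum>i\<in>{1..M}. real i ^ 3) = (real M * (real M + 1) / 2) ^ 2"
  "(\<Sum>i\<in>{1..M}. real i ^ 4) = real M * (real M + 1) * (2 * real M + 1) * (3 * (real M)\<^sup>2 + 3 * real M - 1) / 30"
  by (induction M; simp add: field_simps power2_eq_square power3_eq_cube power4_eq_xxxx)+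

text \<open>Power sums give m^2 (m^2 - 1) / 180 times the polynomial \<open>br\<close>. For m >= 3
  one has m^2 - 1 >= (8/9) m^2 and br >= 6 m^2, and (8/9) * 6 / 180 = 4/135 exceeds 1/40. The shift
  \<delta> places the regression frequencies relative to \<theta>, see
  \<open>reg_indices_enum\<close>.\<close>

lemma design_determinant:
  fixes \<delta> :: real
  assumes "3 \<le> M" "0 \<le> \<delta>" "\<delta> \<le> 1"
  shows "real M * (\<Sum>i\<in>{1..M}. (real i - \<delta>) ^ 4) - (\<Sum>i\<in>{1..M}. (real i - \<delta>) ^ 2)\<^sup>2 \<ge> real M ^ 6 / 40"
proof -
  define m where "m = real M"
  have m: "m \<ge> 3" using assms(1) by (simp add: m_def)
  have s2: "(\<Sum>i\<in>{1..M}. (real i - \<delta>) ^ 2) = (\<Sum>i\<in>{1..M}. real i ^ 2) - 2 * \<delta> * (\<Sum>i\<in>{1..M}. real i) + m * \<delta>\<^sup>2"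
    by (simp add: power2_diff sum.distrib sum_subtractf sum_distrib_left m_def mult_ac)
  have e4: "(a - \<delta>) ^ 4 = a ^ 4 - 4 * \<delta> * a ^ 3 + 6 * \<delta>\<^sup>2 * a ^ 2 - 4 * \<delta> ^ 3 * a + \<delta> ^ 4" for a
    by (simp add: power2_eq_square power3_eq_cube power4_eq_xxxx algebra_simps)
  have s4: "(\<Sum>i\<in>{1..M}. (real i - \<delta>) ^ 4) = (\<Sum>i\<in>{1..M}. real i ^ 4) - 4 * \<delta> * (\<Sum>i\<in>{1..M}. real i ^ 3)
     + 6 * \<delta>\<^sup>2 * (\<Sum>i\<in>{1..M}. real i ^ 2) - 4 * \<delta> ^ 3 * (\<Sum>i\<in>{1..M}. real i) + m * \<delta> ^ 4"
    unfolding e4 by (simp add: sum.distrib sum_subtractf sum_distrib_left m_def)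
  define br where "br = 16 * m\<^sup>2 + 30 * m + 11 - 60 * \<delta> * (m + 1) + 60 * \<delta>\<^sup>2"
  have D: "m * (\<Sum>i\<in>{1..M}. (real i - \<delta>) ^ 4) - (\<Sum>i\<in>{1..M}. (real i - \<delta>) ^ 2)\<^sup>2 = m\<^sup>2 * (m\<^sup>2 - 1) / 180 * br"
    unfolding s2 s4 power_sums m_def[symmetric] br_def
    by (simp add: field_simps power2_eq_square power3_eq_cube power4_eq_xxxx)
  \<comment> \<open>Subtracting this quantity removes \<delta> from \<open>br\<close>; the worst
    case is \<delta> = 1.\<close>
  have "0 \<le> 60 * ((1 - \<delta>) * (m - \<delta>))"
    using assms m by simp
  also have "\<dots> = br - (16 * m\<^sup>2 - 30 * m + 11)"
    unfolding br_def by (simp add: power2_eq_square algebra_simps)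
  finally have "16 * m\<^sup>2 - 30 * m + 11 \<le> br" by simp
  moreover have "3 * m \<le> m\<^sup>2" using m by (simp add: power2_eq_square)
  ultimately have br: "6 * m\<^sup>2 \<le> br" by linarith
  have "9 \<le> m\<^sup>2" using power_mono[of 3 m 2] m by simp
  then have "8 / 9 * m\<^sup>2 \<le> m\<^sup>2 - 1" by simp
  then have "m\<^sup>2 * (8 / 9 * m\<^sup>2) / 180 * (6 * m\<^sup>2) \<le> m\<^sup>2 * (m\<^sup>2 - 1) / 180 * br"
    using br by (intro mult_mono divide_right_mono mult_left_mono) auto
  moreover have "m ^ 6 / 40 \<le> m\<^sup>2 * (8 / 9 * m\<^sup>2) / 180 * (6 * m\<^sup>2)"
  proof -
    have "m\<^sup>2 * (8 / 9 * m\<^sup>2) / 180 * (6 * m\<^sup>2) = (4 / 135) * m ^ 6"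
      by (simp add: eval_nat_numeral)
    moreover have "0 \<le> m ^ 6" using m by simp
    ultimately show ?thesis by linarith
  qed
  ultimately show ?thesis unfolding m_def[symmetric] D by linarith
qed

lemma reg_indices_enum:
  assumes "\<theta> = 0 \<or> \<theta> = pi" "M \<le> n div 2" "0 < n"
  obtains f :: "nat \<Rightarrow> nat" and \<delta> :: real where "0 \<le> \<delta>" "\<delta> \<le> 1" "bij_betw f {1..M} (reg_indices n M \<theta>)"
    "\<And>i. i \<in> {1..M} \<Longrightarrow> \<bar>\<theta> - fourier_freq n (f i)\<bar> = 2 * pi / real n * (real i - \<delta>)"
proof (cases "\<theta> = 0")
  case True
  show ?thesis
  proof (rule that[of 0 id])
    show "bij_betw id {1..M} (reg_indices n M \<theta>)"
      using True by (simp add: reg_indices_def)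
  qed (use True assms in \<open>auto simp: fourier_freq_def\<close>)
next
  case False
  then have th: "\<theta> = pi" using assms(1) by simp
  \<comment> \<open>Counting downwards from \<open>pi\<close>: for even \<open>n\<close> the first
    frequency is \<open>pi\<close> itself, for odd \<open>n\<close> it is half a step away. Near 0
    the first frequency is a full step away, hence the shift 0 in the other case.\<close>
  define \<delta> :: real where "\<delta> = (if even n then 1 else 1 / 2)"
  show ?thesis
  proof (rule that[of \<delta> "\<lambda>i. n div 2 + 1 - i"])
    show "bij_betw (\<lambda>i. n div 2 + 1 - i) {1..M} (reg_indices n M \<theta>)"
      using False assms(2) unfolding reg_indices_def
      by (intro bij_betw_byWitness[where f' = "\<lambda>s. n div 2 + 1 - s"]) auto
    fix i assume i: "i \<in> {1..M}"
    have s: "real (n div 2 + 1 - i) = real (n div 2) + 1 - real i"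
      using i assms(2) by (simp add: of_nat_diff)
    have half: "real n / 2 = real (n div 2) + 1 - \<delta>"
    proof (cases "even n")
      case True
      then show ?thesis by (auto simp: \<delta>_def elim!: evenE)
    next
      case False
      then show ?thesis by (auto simp: \<delta>_def elim!: oddE)
    qed
    have "\<theta> - fourier_freq n (n div 2 + 1 - i) = 2 * pi / real n * (real n / 2 - real (n div 2 + 1 - i))"
      using assms(3) by (simp add: th fourier_freq_def field_simps)
    also have "\<dots> = 2 * pi / real n * (real i - \<delta>)"
      unfolding half s by simp
    finally have "\<theta> - fourier_freq n (n div 2 + 1 - i) = 2 * pi / real n * (real i - \<delta>)" .
    moreover have "0 \<le> real i - \<delta>" using i by (auto simp: \<delta>_def)
    ultimately show "\<bar>\<theta> - fourier_freq n (n div 2 + 1 - i)\<bar> = 2 * pi / real n * (real i - \<delta>)"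
      by simp
  qed (auto simp: \<delta>_def)
qed

text \<open>Cramer's rule for the two normal equations. \<open>matrix_inv\<close> is a choice, which
  satisfies the inverse equations only because the determinant \<open>D\<close> is nonzero.\<close>

lemma f_tilde_cramer:
  fixes x :: "int \<Rightarrow> real^'m" and n M :: nat and \<theta> :: real
  defines "r \<equiv> \<lambda>s. (\<theta> - fourier_freq n s)\<^sup>2" and "S \<equiv> reg_indices n M \<theta>"
  defines "D \<equiv> real (card S) * (\<Sum>s\<in>S. (r s)\<^sup>2) - (\<Sum>s\<in>S. r s)\<^sup>2"
  assumes "D \<noteq> 0"
  shows "f_tilde n M \<theta> x j k =
    (\<Sum>s\<in>S. ((\<Sum>s\<in>S. (r s)\<^sup>2) - (\<Sum>s\<in>S. r s) * r s) / D * Re (periodogram n x j k (fourier_freq n s)))"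
proof -
  let ?A = "XtX n M \<theta>" and ?y = "XtY n M \<theta> x j k"
  let ?R = "\<lambda>s. Re (periodogram n x j k (fourier_freq n s))"
  have dr: "design_row n \<theta> s $ 1 = 1" "design_row n \<theta> s $ 2 = r s" for s
    by (simp_all add: design_row_def r_def)
  have A: "?A $ 1 $ 1 = real (card S)" "?A $ 1 $ 2 = (\<Sum>s\<in>S. r s)" "?A $ 2 $ 1 = (\<Sum>s\<in>S. r s)" "?A $ 2 $ 2 = (\<Sum>s\<in>S. (r s)\<^sup>2)"
    by (simp_all add: XtX_def dr S_def power2_eq_square)
  have y: "?y $ 1 = (\<Sum>s\<in>S. ?R s)" "?y $ 2 = (\<Sum>s\<in>S. r s * ?R s)"
    by (simp_all add: XtY_def dr S_def)
  have "det ?A = D"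
    unfolding det_2 A D_def by (simp add: power2_eq_square)
  then have "invertible ?A"
    using assms(4) by (simp add: invertible_det_nz)
  then have "?A ** matrix_inv ?A = mat 1"
    unfolding invertible_def matrix_inv_def by (rule someI_ex[THEN conjunct1])
  then have "?A *v (matrix_inv ?A *v ?y) = ?y"
    by (simp add: matrix_vector_mul_assoc)
  then have "(?A *v (matrix_inv ?A *v ?y)) $ 1 = ?y $ 1" "(?A *v (matrix_inv ?A *v ?y)) $ 2 = ?y $ 2"
    by simp_all
  then have eqs: "real (card S) * (matrix_inv ?A *v ?y) $ 1 + (\<Sum>s\<in>S. r s) * (matrix_inv ?A *v ?y) $ 2 = (\<Sum>s\<in>S. ?R s)"
     "(\<Sum>s\<in>S. r s) * (matrix_inv ?A *v ?y) $ 1 + (\<Sum>s\<in>S. (r s)\<^sup>2) * (matrix_inv ?A *v ?y) $ 2 = (\<Sum>s\<in>S. r s * ?R s)"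
    unfolding matrix_vector_mult_def[of ?A] by (simp_all add: sum_2 A y)
  have "D * f_tilde n M \<theta> x j k = (\<Sum>s\<in>S. (r s)\<^sup>2) * (\<Sum>s\<in>S. ?R s) - (\<Sum>s\<in>S. r s) * (\<Sum>s\<in>S. r s * ?R s)"
    unfolding eqs[symmetric] D_def f_tilde_def by (simp add: algebra_simps power2_eq_square)
  also have "\<dots> = (\<Sum>s\<in>S. ((\<Sum>s\<in>S. (r s)\<^sup>2) - (\<Sum>s\<in>S. r s) * r s) * ?R s)"
    unfolding left_diff_distrib sum_subtractf sum_distrib_left by (simp add: mult.assoc)
  finally show ?thesis
    using assms(4) by (simp add: sum_divide_distrib[symmetric] field_simps)
qed

text \<open>The frequency scale \<open>c\<close> cancels between numerator and determinant. Sums of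
  squares and of fourth powers of the scaled distances are at most M^3 and M^5, so a numerator of
  size at most c^2 M^5 meets a determinant of at least c^2 M^6 / 40.\<close>

lemma f_tilde_weights:
  assumes \<theta>: "\<theta> = 0 \<or> \<theta> = pi" and M: "3 \<le> M" "M \<le> n div 2"
  obtains a :: "nat \<Rightarrow> real" where
    "(\<Sum>s\<in>reg_indices n M \<theta>. a s) = 1"
    "\<And>s. s \<in> reg_indices n M \<theta> \<Longrightarrow> \<bar>a s\<bar> \<le> 40 / real M"
    "\<And>(x :: int \<Rightarrow> real^'m) j k. f_tilde n M \<theta> x j k = (\<Sum>s\<in>reg_indices n M \<theta>. a s * Re (periodogram n x j k (fourier_freq n s)))"
    "card (reg_indices n M \<theta>) = M"
    "\<And>s. s \<in> reg_indices n M \<theta> \<Longrightarrow> \<bar>fourier_freq n s - \<theta>\<bar> \<le> 2 * pi * (real M / real n)"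
proof -
  have n: "0 < n" using M by auto
  obtain f :: "nat \<Rightarrow> nat" and \<delta> :: real where \<delta>: "0 \<le> \<delta>" "\<delta> \<le> 1" and bij: "bij_betw f {1..M} (reg_indices n M \<theta>)"
    and fr: "\<And>i. i \<in> {1..M} \<Longrightarrow> \<bar>\<theta> - fourier_freq n (f i)\<bar> = 2 * pi / real n * (real i - \<delta>)"
    using reg_indices_enum[OF \<theta> M(2) n] by metis
  define S where "S = reg_indices n M \<theta>"
  define r where "r s = (\<theta> - fourier_freq n s)\<^sup>2" for s
  define c where "c = (2 * pi / real n)\<^sup>2"
  have c: "c > 0" using n by (simp add: c_def)
  have rf: "r (f i) = c * (real i - \<delta>)\<^sup>2" if "i \<in> {1..M}" for i
    unfolding r_def c_def power_mult_distrib[symmetric] fr[OF that, symmetric] by simp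
  have card: "card S = M"
    using bij_betw_same_card[OF bij] by (simp add: S_def)
  have reidx: "(\<Sum>s\<in>S. g s) = (\<Sum>i\<in>{1..M}. g (f i))" for g :: "nat \<Rightarrow> real"
    unfolding S_def by (rule sum.reindex_bij_betw[OF bij, symmetric])
  define S1 where "S1 = (\<Sum>s\<in>S. r s)"
  define S2 where "S2 = (\<Sum>s\<in>S. (r s)\<^sup>2)"
  define s1 where "s1 = (\<Sum>i\<in>{1..M}. (real i - \<delta>)\<^sup>2)"
  define s2 where "s2 = (\<Sum>i\<in>{1..M}. (real i - \<delta>) ^ 4)"
  have S1: "S1 = c * s1"
    unfolding S1_def reidx s1_def sum_distrib_left by (intro sum.cong refl rf)
  have S2: "S2 = c\<^sup>2 * s2"
    unfolding S2_def reidx s2_def sum_distrib_left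
    by (intro sum.cong refl) (simp add: rf power_mult_distrib flip: power_mult)
  define D where "D = real M * S2 - S1\<^sup>2"
  have "D = c\<^sup>2 * (real M * s2 - s1\<^sup>2)"
    by (simp add: D_def S1 S2 power_mult_distrib algebra_simps)
  moreover have "real M * s2 - s1\<^sup>2 \<ge> real M ^ 6 / 40"
    unfolding s1_def s2_def by (rule design_determinant[OF M(1) \<delta>])
  ultimately have D: "D \<ge> c\<^sup>2 * (real M ^ 6 / 40)"
    using c by simp
  have pos: "c\<^sup>2 * (real M ^ 6 / 40) > 0" using c M by simp
  then have D0: "D > 0" using D by linarith
  define a where "a s = (S2 - S1 * r s) / D" for s
  have d: "0 \<le> real i - \<delta>" "real i - \<delta> \<le> real M" if "i \<in> {1..M}" for i
    using that \<delta> by auto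
  have s1b: "0 \<le> s1" "s1 \<le> real M ^ 3"
  proof -
    have "s1 \<le> (\<Sum>i\<in>{1..M}. (real M)\<^sup>2)"
      unfolding s1_def using d by (intro sum_mono power_mono) auto
    then show "s1 \<le> real M ^ 3" by (simp add: eval_nat_numeral)
  qed (auto simp: s1_def intro: sum_nonneg)
  have s2b: "0 \<le> s2" "s2 \<le> real M ^ 5"
  proof -
    have "s2 \<le> (\<Sum>i\<in>{1..M}. (real M) ^ 4)"
      unfolding s2_def using d by (intro sum_mono power_mono) auto
    then show "s2 \<le> real M ^ 5" by (simp add: eval_nat_numeral)
  qed (auto simp: s2_def intro: sum_nonneg)
  show ?thesis
  proof (rule that[of a], unfold S_def[symmetric])
    show "card S = M" by fact
    have "(\<Sum>s\<in>S. a s) = (real M * S2 - S1 * S1) / D"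
      unfolding a_def sum_divide_distrib[symmetric] sum_subtractf sum_distrib_left[symmetric] S1_def[symmetric]
      by (simp add: card)
    then show "(\<Sum>s\<in>S. a s) = 1"
      using D0 by (simp add: D_def power2_eq_square)
    fix s assume "s \<in> S"
    then obtain i where i: "i \<in> {1..M}" "s = f i"
      using bij unfolding S_def bij_betw_def by blast
    have "\<bar>fourier_freq n s - \<theta>\<bar> = 2 * pi / real n * (real i - \<delta>)"
      using fr[OF i(1)] i(2) by (simp add: abs_minus_commute)
    also have "\<dots> \<le> 2 * pi / real n * real M"
      using d[OF i(1)] by (intro mult_left_mono) auto
    finally show "\<bar>fourier_freq n s - \<theta>\<bar> \<le> 2 * pi * (real M / real n)" by simp
    have "S2 - S1 * r s = c\<^sup>2 * (s2 - s1 * (real i - \<delta>)\<^sup>2)"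
      unfolding S1 S2 i(2) rf[OF i(1)] by (simp add: power2_eq_square algebra_simps)
    moreover have "s1 * (real i - \<delta>)\<^sup>2 \<le> real M ^ 3 * (real M)\<^sup>2"
      using s1b d[OF i(1)] by (intro mult_mono power_mono) auto
    moreover have "real M ^ 3 * (real M)\<^sup>2 = real M ^ 5" by (simp flip: power_add)
    moreover have "0 \<le> s1 * (real i - \<delta>)\<^sup>2" using s1b by simp
    ultimately have "\<bar>S2 - S1 * r s\<bar> \<le> c\<^sup>2 * real M ^ 5"
      using s2b c by (simp add: abs_mult abs_le_iff)
    then have "\<bar>a s\<bar> \<le> (c\<^sup>2 * real M ^ 5) / (c\<^sup>2 * (real M ^ 6 / 40))"
      unfolding a_def abs_divide using D pos D0 by (intro frac_le) auto
    also have "\<dots> = 40 / real M"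
      using c M by (simp add: eval_nat_numeral)
    finally show "\<bar>a s\<bar> \<le> 40 / real M" .
  next
    fix x :: "int \<Rightarrow> real^'m" and j k
    show "f_tilde n M \<theta> x j k = (\<Sum>s\<in>S. a s * Re (periodogram n x j k (fourier_freq n s)))"
      using f_tilde_cramer[of n M \<theta> x j k, folded r_def S_def, unfolded card, folded S1_def S2_def,
          folded D_def, OF less_imp_neq[OF D0, symmetric]]
      by (simp only: a_def)
  qed
qed

text \<open>By |u v| <= (u^2 + v^2) / 2 one half of the sum is paid for by the row sums and the
  other half by the column sums.\<close>

lemma schur_bound:
  fixes W :: "'p \<Rightarrow> real" and c :: "'p \<Rightarrow> 'p \<Rightarrow> real"
  assumes c: "\<And>p p'. 0 \<le> c p p'" "\<And>p. p \<in> I \<Longrightarrow> (\<Sum>p'\<in>I. c p p') \<le> G" "\<And>p'. p' \<in> I \<Longrightarrow> (\<Sum>p\<in>I. c p p') \<le> G"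
  shows "(\<Sum>p\<in>I. \<Sum>p'\<in>I. \<bar>W p\<bar> * \<bar>W p'\<bar> * c p p') \<le> G * (\<Sum>p\<in>I. (W p)\<^sup>2)"
proof -
  have "(\<Sum>p\<in>I. \<Sum>p'\<in>I. \<bar>W p\<bar> * \<bar>W p'\<bar> * c p p') \<le> (\<Sum>p\<in>I. \<Sum>p'\<in>I. ((W p)\<^sup>2 / 2 + (W p')\<^sup>2 / 2) * c p p')"
  proof (intro sum_mono mult_right_mono c)
    fix p p'
    show "\<bar>W p\<bar> * \<bar>W p'\<bar> \<le> (W p)\<^sup>2 / 2 + (W p')\<^sup>2 / 2"
      using sum_squares_bound[of "\<bar>W p\<bar>" "\<bar>W p'\<bar>"] by simp
  qed
  also have "\<dots> = (\<Sum>p\<in>I. \<Sum>p'\<in>I. (W p)\<^sup>2 / 2 * c p p') + (\<Sum>p\<in>I. \<Sum>p'\<in>I. (W p')\<^sup>2 / 2 * c p p')"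
    by (simp only: distrib_right sum.distrib)
  also have "(\<Sum>p\<in>I. \<Sum>p'\<in>I. (W p')\<^sup>2 / 2 * c p p') = (\<Sum>p'\<in>I. \<Sum>p\<in>I. (W p')\<^sup>2 / 2 * c p p')"
    by (rule sum.swap)
  also have "(\<Sum>p\<in>I. \<Sum>p'\<in>I. (W p)\<^sup>2 / 2 * c p p') + (\<Sum>p'\<in>I. \<Sum>p\<in>I. (W p')\<^sup>2 / 2 * c p p') \<le>
     (\<Sum>p\<in>I. (W p)\<^sup>2 / 2 * G) + (\<Sum>p\<in>I. (W p)\<^sup>2 / 2 * G)"
    unfolding sum_distrib_left[symmetric] by (intro add_mono sum_mono mult_left_mono c) auto
  also have "\<dots> = G * (\<Sum>p\<in>I. (W p)\<^sup>2)"
    by (simp add: sum_distrib_left sum.distrib[symmetric] mult.commute)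
  finally show ?thesis .
qed

text \<open>As matrices indexed by pairs of times, the covariance products have row and column sums
  that factor into two absolute sums, one for each time. In the second product the times are paired
  crosswise. Schur's test applies to both.\<close>

lemma gauss_var_le:
  assumes sj: "(\<lambda>h. \<bar>gj h\<bar>) summable_on UNIV" and sk: "(\<lambda>h. \<bar>gk h\<bar>) summable_on UNIV" and sjk: "(\<lambda>h. \<bar>gjk h\<bar>) summable_on UNIV"
  shows "gauss_var n W gj gk gjk \<le>
    (infsum (\<lambda>h. \<bar>gj h\<bar>) UNIV * infsum (\<lambda>h. \<bar>gk h\<bar>) UNIV + (infsum (\<lambda>h. \<bar>gjk h\<bar>) UNIV)\<^sup>2) * (\<Sum>p\<in>square_idx n. (W (fst p - snd p))\<^sup>2)"
proof -
  let ?I = "square_idx n"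
  let ?w = "\<lambda>p. W (fst p - snd p)"
  let ?c1 = "\<lambda>p p'. \<bar>gj (fst p - fst p')\<bar> * \<bar>gk (snd p - snd p')\<bar>"
  let ?c2 = "\<lambda>p p'. \<bar>gjk (fst p - snd p')\<bar> * \<bar>gjk (fst p' - snd p)\<bar>"
  define Gj Gk Gjk where "Gj = infsum (\<lambda>h. \<bar>gj h\<bar>) UNIV" and "Gk = infsum (\<lambda>h. \<bar>gk h\<bar>) UNIV" and "Gjk = infsum (\<lambda>h. \<bar>gjk h\<bar>) UNIV"
  have prod: "(\<Sum>p\<in>?I. f (fst p) * g (snd p)) \<le> A * B"
    if "(\<Sum>t\<in>{1..int n}. f t) \<le> A" "(\<Sum>t\<in>{1..int n}. g t) \<le> B" "\<And>t. 0 \<le> f t" "\<And>t. 0 \<le> g t" for f g :: "int \<Rightarrow> real" and A B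
  proof -
    have "(\<Sum>p\<in>?I. f (fst p) * g (snd p)) = (\<Sum>t\<in>{1..int n}. f t) * (\<Sum>t\<in>{1..int n}. g t)"
      by (simp add: sum.cartesian_product' sum_product)
    also have "\<dots> \<le> A * B"
      using that order_trans[OF sum_nonneg that(1)] by (intro mult_mono sum_nonneg) auto
    finally show ?thesis .
  qed
  have inj: "inj_on (\<lambda>t. a - t) F" "inj_on (\<lambda>t. t - a) F" for a :: int and F by (auto simp: inj_on_def)
  note S = sum_shift_le_infsum[OF _ finite_atLeastAtMost_int]
  have c1: "(\<Sum>p'\<in>?I. ?c1 p p') \<le> Gj * Gk" "(\<Sum>p'\<in>?I. ?c1 p' p) \<le> Gj * Gk" for p
    unfolding Gj_def Gk_def
    by (rule prod[of "\<lambda>t. \<bar>gj (fst p - t)\<bar>" _ "\<lambda>t. \<bar>gk (snd p - t)\<bar>"] prod[of "\<lambda>t. \<bar>gj (t - fst p)\<bar>" _ "\<lambda>t. \<bar>gk (t - snd p)\<bar>"];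
        intro S sj sk inj abs_ge_zero)+
  have c2: "(\<Sum>p'\<in>?I. ?c2 p p') \<le> Gjk * Gjk" "(\<Sum>p'\<in>?I. ?c2 p' p) \<le> Gjk * Gjk" for p
  proof -
    have "(\<Sum>p'\<in>?I. \<bar>gjk (fst p' - snd p)\<bar> * \<bar>gjk (fst p - snd p')\<bar>) \<le> Gjk * Gjk"
      unfolding Gjk_def
      by (rule prod[of "\<lambda>t. \<bar>gjk (t - snd p)\<bar>" _ "\<lambda>t. \<bar>gjk (fst p - t)\<bar>"]; intro S sjk inj abs_ge_zero)
    then show "(\<Sum>p'\<in>?I. ?c2 p p') \<le> Gjk * Gjk" "(\<Sum>p'\<in>?I. ?c2 p' p) \<le> Gjk * Gjk"
      by (simp_all add: mult.commute)
  qed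
  have "gauss_var n W gj gk gjk \<le> (\<Sum>p\<in>?I. \<Sum>p'\<in>?I. \<bar>?w p\<bar> * \<bar>?w p'\<bar> * ?c1 p p' + \<bar>?w p\<bar> * \<bar>?w p'\<bar> * ?c2 p p')"
    unfolding gauss_var_def
  proof (intro sum_mono)
    fix p p'
    have "?w p * ?w p' * (gj (fst p - fst p') * gk (snd p - snd p') + gjk (fst p - snd p') * gjk (fst p' - snd p)) \<le>
       \<bar>?w p * ?w p' * (gj (fst p - fst p') * gk (snd p - snd p'))\<bar> + \<bar>?w p * ?w p' * (gjk (fst p - snd p') * gjk (fst p' - snd p))\<bar>"
      unfolding distrib_left by (intro add_mono abs_ge_self)
    then show "?w p * ?w p' * (gj (fst p - fst p') * gk (snd p - snd p') + gjk (fst p - snd p') * gjk (fst p' - snd p)) \<le>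
       \<bar>?w p\<bar> * \<bar>?w p'\<bar> * ?c1 p p' + \<bar>?w p\<bar> * \<bar>?w p'\<bar> * ?c2 p p'"
      unfolding abs_mult .
  qed
  also have "\<dots> = (\<Sum>p\<in>?I. \<Sum>p'\<in>?I. \<bar>?w p\<bar> * \<bar>?w p'\<bar> * ?c1 p p') + (\<Sum>p\<in>?I. \<Sum>p'\<in>?I. \<bar>?w p\<bar> * \<bar>?w p'\<bar> * ?c2 p p')"
    by (simp only: sum.distrib)
  also have "\<dots> \<le> Gj * Gk * (\<Sum>p\<in>?I. (?w p)\<^sup>2) + Gjk * Gjk * (\<Sum>p\<in>?I. (?w p)\<^sup>2)"
    by (intro add_mono schur_bound c1 c2) auto
  finally show ?thesis
    by (simp add: Gj_def Gk_def Gjk_def power2_eq_square distrib_right)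
qed

section \<open>Limits of kernel-weighted sums of autocovariances\<close>

lemma sum_square_diff:
  fixes F :: "int \<Rightarrow> real"
  shows "(\<Sum>p\<in>square_idx n. F (fst p - snd p)) = (\<Sum>h\<in>{- int n..int n}. (real n - \<bar>real_of_int h\<bar>) * F h)"
proof -
  have card: "card {p\<in>square_idx n. fst p - snd p = h} = nat (int n - \<bar>h\<bar>)" for h
  proof -
    have "{p\<in>square_idx n. fst p - snd p = h} = (\<lambda>t. (t, t - h)) ` {max 1 (1 + h)..min (int n) (int n + h)}"
      by (auto simp: image_iff)
    moreover have "inj_on (\<lambda>t. (t, t - h)) A" for A by (auto simp: inj_on_def)
    ultimately show ?thesis by (simp add: card_image)
  qed
  have "(\<Sum>p\<in>square_idx n. F (fst p - snd p)) = (\<Sum>h\<in>{- int n..int n}. \<Sum>p\<in>{p\<in>square_idx n. fst p - snd p = h}. F (fst p - snd p))"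
    by (rule sum.group[symmetric]) auto
  also have "\<dots> = (\<Sum>h\<in>{- int n..int n}. \<Sum>p\<in>{p\<in>square_idx n. fst p - snd p = h}. F h)"
    by (intro sum.cong refl) auto
  also have "\<dots> = (\<Sum>h\<in>{- int n..int n}. (real n - \<bar>real_of_int h\<bar>) * F h)"
    unfolding sum_constant card by (intro sum.cong refl) (auto simp: of_nat_nat)
  finally show ?thesis .
qed

text \<open>Dominated convergence for the counting measure; the summable majorant makes the
  unordered sums agree with integrals.\<close>

lemma infsum_tendsto_dominated:
  fixes f :: "nat \<Rightarrow> 'b \<Rightarrow> real"
  assumes "b summable_on UNIV" "\<And>n h. \<bar>f n h\<bar> \<le> b h" "\<And>h. (\<lambda>n. f n h) \<longlonglongrightarrow> g h"
  shows "(\<lambda>n. infsum (f n) UNIV) \<longlonglongrightarrow> infsum g UNIV"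
proof -
  have b0: "0 \<le> b h" for h using assms(2)[of 0 h] by (rule order_trans[OF abs_ge_zero])
  have bi: "integrable (count_space UNIV) b"
    using assms(1) b0 abs_summable_equivalent[of b UNIV] by (simp add: abs_summable_on_def)
  have gb: "\<bar>g h\<bar> \<le> b h" for h
    by (rule LIMSEQ_le_const2[OF tendsto_rabs[OF assms(3)]]) (use assms(2) in auto)
  have eq: "infsum u UNIV = integral\<^sup>L (count_space UNIV) u" if "\<And>h. \<bar>u h\<bar> \<le> b h" for u
  proof -
    have "integrable (count_space UNIV) u"
      using that b0 by (intro Bochner_Integration.integrable_bound[OF bi]) auto
    then show ?thesis
      by (simp add: infsetsum_infsum[symmetric] abs_summable_on_def infsetsum_def)
  qed
  have "(\<lambda>n. integral\<^sup>L (count_space UNIV) (f n)) \<longlonglongrightarrow> integral\<^sup>L (count_space UNIV) g"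
    using assms bi by (intro integral_dominated_convergence[where w = b]) auto
  then show ?thesis
    by (simp add: eq assms(2) gb)
qed

lemma weighted_mean_tendsto:
  fixes g :: "int \<Rightarrow> real" and W :: "nat \<Rightarrow> int \<Rightarrow> real"
  assumes g: "(\<lambda>h. \<bar>g h\<bar>) summable_on UNIV" and W: "\<And>n h. \<bar>W n h\<bar> \<le> C" "\<And>h. (\<lambda>n. W n h) \<longlonglongrightarrow> V h"
  shows "(\<lambda>n. (\<Sum>p\<in>square_idx n. W n (fst p - snd p) * g (fst p - snd p)) / real n) \<longlonglongrightarrow> infsum (\<lambda>h. V h * g h) UNIV"
proof -
  \<comment> \<open>The Fejer factor stems from the number of pairs at lag \<open>h\<close>, and the
    maximum extends the sum from |h| <= n to all lags. At n = 0 division by zero makes the factor 1,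
    which still respects the majorant.\<close>
  define f where "f n h = max 0 (1 - \<bar>real_of_int h\<bar> / real n) * (W n h * g h)" for n h
  have C0: "0 \<le> C" using W(1)[of 0 0] by linarith
  have ev: "(\<Sum>p\<in>square_idx n. W n (fst p - snd p) * g (fst p - snd p)) / real n = infsum (f n) UNIV" if "n > 0" for n
  proof -
    have "(\<Sum>p\<in>square_idx n. W n (fst p - snd p) * g (fst p - snd p)) / real n =
      (\<Sum>h\<in>{- int n..int n}. (real n - \<bar>real_of_int h\<bar>) * (W n h * g h) / real n)"
      by (simp add: sum_square_diff[of "\<lambda>h. W n h * g h"] sum_divide_distrib)
    also have "\<dots> = (\<Sum>h\<in>{- int n..int n}. f n h)"
      using that by (intro sum.cong refl) (auto simp: f_def max_def field_simps)
    also have "\<dots> = infsum (f n) {- int n..int n}" by simp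
    also have "\<dots> = infsum (f n) UNIV"
      using that by (intro infsum_cong_neutral) (auto simp: f_def max_def field_simps)
    finally show ?thesis .
  qed
  have "(\<lambda>n. infsum (f n) UNIV) \<longlonglongrightarrow> infsum (\<lambda>h. V h * g h) UNIV"
  proof (rule infsum_tendsto_dominated[where b = "\<lambda>h. C * \<bar>g h\<bar>"])
    show "(\<lambda>h. C * \<bar>g h\<bar>) summable_on UNIV" using g by (rule summable_on_cmult_right)
    fix n h
    have "\<bar>f n h\<bar> \<le> 1 * (C * \<bar>g h\<bar>)"
      unfolding f_def abs_mult using W(1)[of n h] C0 by (intro mult_mono) auto
    then show "\<bar>f n h\<bar> \<le> C * \<bar>g h\<bar>" by simp
  next
    fix h
    have "(\<lambda>n. max 0 (1 - \<bar>real_of_int h\<bar> / real n) * (W n h * g h)) \<longlonglongrightarrow> max 0 (1 - 0) * (V h * g h)"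
      by (intro tendsto_mult tendsto_max tendsto_diff tendsto_const W lim_const_over_n)
    then show "(\<lambda>n. f n h) \<longlonglongrightarrow> V h * g h" by (simp add: f_def)
  qed
  then show ?thesis
    by (rule Lim_transform_eventually) (auto intro!: eventually_sequentiallyI[of 1] simp: ev)
qed

section \<open>Consistency\<close>

lemma abs_cos_diff_le: "\<bar>cos x - cos y\<bar> \<le> \<bar>x - y\<bar>" for x y :: real
proof -
  have "\<bar>cos x - cos y\<bar> = 2 * (\<bar>sin ((x + y) / 2)\<bar> * \<bar>sin ((y - x) / 2)\<bar>)"
    by (simp add: cos_diff_cos abs_mult)
  also have "\<dots> \<le> 2 * (1 * \<bar>(y - x) / 2\<bar>)"
    by (intro mult_left_mono mult_mono abs_sin_x_le_abs_x) auto
  finally show ?thesis by (simp add: abs_minus_commute)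
qed

text \<open>At frequency 0 the exponentials are 1, and unordered summability of complex numbers is
  absolute.\<close>

lemma autocov_abs_summable:
  assumes "assumption_A p P X"
  shows "(\<lambda>h. \<bar>autocov P X j k h\<bar>) summable_on UNIV"
proof -
  have "(\<lambda>h::int. exp (- \<i> * complex_of_real (0 * real_of_int h)) * complex_of_real (autocov P X j k h)) summable_on UNIV"
    using assms unfolding assumption_A_def by blast
  then show ?thesis
    by (simp add: summable_on_iff_abs_summable_on_complex)
qed

text \<open>At both frequencies the sines at integer lags vanish, which leaves a real cosine
  series.\<close>

lemma spec_dens_endpoint:
  assumes \<theta>: "\<theta> = 0 \<or> \<theta> = pi"
    and sm: "(\<lambda>h. \<bar>autocov P X j k h\<bar>) summable_on UNIV"
  shows "spec_dens P X j k \<theta> = complex_of_real (infsum (\<lambda>h. cos (\<theta> * real_of_int h) * autocov P X j k h) UNIV / (2 * pi))"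
proof -
  have "sin (\<theta> * real_of_int h) = 0" for h
    using \<theta> by (auto simp: sin_zero_iff_int2 mult.commute)
  then have e: "exp (- \<i> * complex_of_real (\<theta> * real_of_int h)) = complex_of_real (cos (\<theta> * real_of_int h))" for h
    by (simp add: complex_eq_iff Re_exp Im_exp)
  let ?f = "\<lambda>h. cos (\<theta> * real_of_int h) * autocov P X j k h"
  have "(\<lambda>h. norm (?f h)) summable_on UNIV"
    using sm by (rule summable_on_comparison_test) (auto simp: abs_mult mult_left_le_one_le)
  then have "(?f has_sum infsum ?f UNIV) UNIV"
    by (rule has_sum_infsum[OF summable_on_iff_abs_summable_on_real[THEN iffD2]])
  then have "infsum (\<lambda>h. complex_of_real (?f h)) UNIV = complex_of_real (infsum ?f UNIV)"
    by (intro infsumI has_sum_of_real)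
  then show ?thesis
    unfolding spec_dens_def e of_real_mult[symmetric] by (simp flip: of_real_mult)
qed

text \<open>Each component is a moving average with the rows \<open>\<Psi> l $ i\<close> as
  coefficients, and the norm of the whole matrix \<open>\<Psi> l\<close> is a common majorant for
  both components.\<close>

lemma linear_process_gaussian_quadratic_forms:
  fixes X :: "int \<Rightarrow> 'w \<Rightarrow> real^'m" and Z :: "int \<Rightarrow> 'w \<Rightarrow> real^'d"
  assumes "prob_space P" and st: "strictly_stationary P X" and lin: "linear_process_cond P X Z \<Psi>"
    and sm: "\<And>j k. (\<lambda>h. \<bar>autocov P X j k h\<bar>) summable_on UNIV"
  shows "gaussian_quadratic_forms P (\<lambda>t x. X t x $ j - proc_mean P X $ j) (\<lambda>t x. X t x $ k - proc_mean P X $ k)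
     (autocov P X j j) (autocov P X k k) (autocov P X j k)"
proof -
  interpret prob_space P by fact
  have ind: "indep_vars (\<lambda>_. borel) Z UNIV"
    using lin by (simp add: linear_process_cond_def)
  then have Z_meas: "Z t \<in> borel_measurable P" for t
    by (auto simp: indep_vars_def)
  have c_meas: "(\<lambda>x. Z t x $ i) \<in> borel_measurable P" for t i
    using measurable_compose[OF Z_meas measurable_centered_component[of i 0]] by simp
  have L4c: "L4 (\<lambda>x. Z t x $ i)" for t i
    using lin c_meas by (auto simp: linear_process_cond_def L4_def)
  have inner: "v \<bullet> z = (\<Sum>i\<in>UNIV. v $ i * z $ i)" for v z :: "real^'d"
    by (simp add: inner_vec_def)
  interpret indep_vectors P Z
  proof
    show "indep_vars (\<lambda>_. borel) Z UNIV" by fact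
    show "distr P borel (Z t) = distr P borel (Z 0)" for t
      using lin by (simp add: linear_process_cond_def)
    show "L4 (\<lambda>x. v \<bullet> Z 0 x)" for v
      unfolding inner by (intro L4_sum L4_cmult L4c)
    show "expectation (\<lambda>x. v \<bullet> Z 0 x) = 0" for v
    proof -
      have "expectation (\<lambda>x. v \<bullet> Z 0 x) = (\<Sum>i\<in>UNIV. v $ i * expectation (\<lambda>x. Z 0 x $ i))"
        unfolding inner using L4_integrable[OF L4c] by (subst Bochner_Integration.integral_sum) auto
      then show ?thesis
        using lin by (simp add: linear_process_cond_def)
    qed
  qed
  have X_meas: "X t \<in> borel_measurable P" for t
    using st by (simp add: strictly_stationary_def)
  have Y_meas: "(\<lambda>x. X t x $ i - proc_mean P X $ i) \<in> borel_measurable P" for t i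
    using measurable_compose[OF X_meas measurable_centered_component] .
  have lim: "AE x in P. (\<lambda>N. truncated (\<lambda>l. \<Psi> l $ i) N t x) \<longlonglongrightarrow> X t x $ i - proc_mean P X $ i" for i t
  proof -
    have "AE x in P. (\<lambda>N. proc_mean P X + (\<Sum>l\<in>{- int N..int N}. \<Psi> l *v Z (t - l) x)) \<longlonglongrightarrow> X t x"
      using lin by (simp add: linear_process_cond_def)
    then show ?thesis
    proof eventually_elim
      fix x assume "(\<lambda>N. proc_mean P X + (\<Sum>l\<in>{- int N..int N}. \<Psi> l *v Z (t - l) x)) \<longlonglongrightarrow> X t x"
      then have "(\<lambda>N. (proc_mean P X + (\<Sum>l\<in>{- int N..int N}. \<Psi> l *v Z (t - l) x)) $ i - proc_mean P X $ i)
          \<longlonglongrightarrow> X t x $ i - proc_mean P X $ i"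
        by (intro tendsto_diff tendsto_vec_nth tendsto_const)
      then show "(\<lambda>N. truncated (\<lambda>l. \<Psi> l $ i) N t x) \<longlonglongrightarrow> X t x $ i - proc_mean P X $ i"
        by (simp add: truncated_def matrix_vector_mul_component)
    qed
  qed
  show ?thesis
  proof (rule linear_gaussian_quadratic_forms[where \<psi> = "\<lambda>l. norm (\<Psi> l)" and \<alpha> = "\<lambda>l. \<Psi> l $ j" and \<beta> = "\<lambda>l. \<Psi> l $ k"])
    show "norm (\<Psi> l $ j) \<le> norm (\<Psi> l)" "norm (\<Psi> l $ k) \<le> norm (\<Psi> l)" for l
      by (simp_all add: Finite_Cartesian_Product.norm_nth_le)
    show "(\<lambda>l. (norm (\<Psi> l))\<^sup>2) summable_on UNIV"
      using lin by (simp add: linear_process_cond_def)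
  qed (use Y_meas lim sm stationary_autocov[OF st] in auto)
qed

theorem theorem4p1:
  fixes P :: "'w measure"
    and X :: "int \<Rightarrow> 'w \<Rightarrow> real^'m"
    and M :: "nat \<Rightarrow> nat"
    and j k :: 'm
    and \<theta> :: real
  assumes "prob_space P"
    and "assumption_A 4 P X"
    and "assumption_B P X"
    and "\<theta> = 0 \<or> \<theta> = pi"
    and "filterlim M at_top sequentially"
    and "(\<lambda>n. real (M n) / real n) \<longlonglongrightarrow> 0"
  shows "\<forall>\<epsilon>>0. (\<lambda>n. measure P {\<omega> \<in> space P.
            cmod (complex_of_real (f_tilde n (M n) \<theta> (\<lambda>t. X t \<omega>) j k) - spec_dens P X j k \<theta>) > \<epsilon>})
          \<longlonglongrightarrow> 0"
proof (intro allI impI)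
  fix \<epsilon> :: real assume "\<epsilon> > 0"
  interpret prob_space P by fact
  note \<theta> = assms(4)
  have st: "strictly_stationary P X"
    using assms(3) by (simp add: assumption_B_def)
  note sm = autocov_abs_summable[OF assms(2)]
  define Y where "Y i t x = X t x $ i - proc_mean P X $ i" for i t x
  define g where "g = autocov P X j k"
  define L where "L = infsum (\<lambda>h. cos (\<theta> * real_of_int h) * g h) UNIV"
  have gq: "gaussian_quadratic_forms P (Y j) (Y k) (autocov P X j j) (autocov P X k k) g"
  proof -
    consider Z :: "int \<Rightarrow> 'w \<Rightarrow> real^'m" and \<Psi> where "linear_process_cond P X Z \<Psi>" | "cumulant_cond P X"
      using assms(3) unfolding assumption_B_def by blast
    then show ?thesis
      unfolding Y_def[abs_def] g_def
    proof cases
      case 1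
      then show "gaussian_quadratic_forms P (\<lambda>t x. X t x $ j - proc_mean P X $ j) (\<lambda>t x. X t x $ k - proc_mean P X $ k)
          (autocov P X j j) (autocov P X k k) (autocov P X j k)"
        by (rule linear_process_gaussian_quadratic_forms[OF assms(1) st _ sm])
    next
      case 2
      then show "gaussian_quadratic_forms P (\<lambda>t x. X t x $ j - proc_mean P X $ j) (\<lambda>t x. X t x $ k - proc_mean P X $ k)
          (autocov P X j j) (autocov P X k k) (autocov P X j k)"
        by (rule cumulant_gaussian_quadratic_forms[OF assms(1) st])
    qed
  qed
  \<comment> \<open>The total weight 40 comes from M weights of size at most 40 / M.\<close>
  obtain R where R: "R \<longlonglongrightarrow> 0" and bd: "\<forall>n S a w c. finite S \<longrightarrow> (\<Sum>s\<in>S. \<bar>a s\<bar>) \<le> 40 \<longrightarrow>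
      integrable P (\<lambda>x. ((\<Sum>p\<in>square_idx n. cosW S a w (fst p - snd p) * (Y j (fst p) x * Y k (snd p) x)) - c)\<^sup>2) \<and>
      expectation (\<lambda>x. ((\<Sum>p\<in>square_idx n. cosW S a w (fst p - snd p) * (Y j (fst p) x * Y k (snd p) x)) - c)\<^sup>2)
       \<le> ((\<Sum>p\<in>square_idx n. cosW S a w (fst p - snd p) * g (fst p - snd p)) - c)\<^sup>2
          + gauss_var n (cosW S a w) (autocov P X j j) (autocov P X k k) g + R n * (real n)\<^sup>2"
    using gq[unfolded gaussian_quadratic_forms_def, THEN spec, of 40] by (elim exE conjE) (rule that)
  note bound = bd[rule_format]
  \<comment> \<open>Three frequencies are required for the lower bound on the determinant; at most
    \<open>n div 2\<close> of them keep the window below \<open>pi\<close> within the indices from 1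
    to \<open>n div 2\<close>.\<close>
  define good where "good n \<longleftrightarrow> 3 \<le> M n \<and> M n \<le> n div 2" for n
  have ev_good: "eventually good sequentially"
  proof -
    have "eventually (\<lambda>n. 3 \<le> M n) sequentially"
      using assms(5) by (simp add: filterlim_at_top)
    \<comment> \<open>The margin between 1/3 and 1/2 absorbs the rounding in
      \<open>n div 2\<close>.\<close>
    moreover have "eventually (\<lambda>n. real (M n) / real n < 1 / 3) sequentially"
      using assms(6) by (rule order_tendstoD(2)) simp
    moreover have "eventually (\<lambda>n::nat. n > 0) sequentially" by (rule eventually_gt_at_top)
    ultimately show ?thesis
    proof eventually_elim
      fix n assume n: "3 \<le> M n" "real (M n) / real n < 1 / 3" "n > 0"
      then have "real (3 * M n) < real n" by (simp add: field_simps)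
      then have "3 * M n < n" by (simp only: of_nat_less_iff)
      then show "good n" using n(1) by (simp add: good_def)
    qed
  qed
  \<comment> \<open>Empty outside \<open>good\<close>, so that the bound 40 on the total weight
    holds for every \<open>n\<close>, as \<open>weighted_mean_tendsto\<close> demands of its
    kernels.\<close>
  define S where "S n = (if good n then reg_indices n (M n) \<theta> else {})" for n
  define ok where "ok n b \<longleftrightarrow> (\<Sum>s\<in>S n. b s) = 1 \<and> (\<forall>s\<in>S n. \<bar>b s\<bar> \<le> 40 / real (M n)) \<and>
      (\<forall>(x :: int \<Rightarrow> real^'m) j k. f_tilde n (M n) \<theta> x j k = (\<Sum>s\<in>S n. b s * Re (periodogram n x j k (fourier_freq n s)))) \<and>
      card (S n) = M n \<and> (\<forall>s\<in>S n. \<bar>fourier_freq n s - \<theta>\<bar> \<le> 2 * pi * (real (M n) / real n))" for n b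
  have "\<exists>b. good n \<longrightarrow> ok n b" for n
  proof (cases "good n")
    case True
    then have "3 \<le> M n" "M n \<le> n div 2" by (simp_all add: good_def)
    then show ?thesis
    proof (rule f_tilde_weights[OF \<theta>, where ?'m = 'm], goal_cases)
      case (1 b)
      with True have "ok n b"
        unfolding ok_def S_def by simp
      then show ?case by blast
    qed
  qed simp
  then obtain a where ok: "\<And>n. good n \<Longrightarrow> ok n (a n)"
    by metis
  have a: "\<And>n. good n \<Longrightarrow> (\<Sum>s\<in>S n. a n s) = 1"
      "\<And>n s. good n \<Longrightarrow> s \<in> S n \<Longrightarrow> \<bar>a n s\<bar> \<le> 40 / real (M n)"
      "\<And>n (x :: int \<Rightarrow> real^'m) j k. good n \<Longrightarrow>
        f_tilde n (M n) \<theta> x j k = (\<Sum>s\<in>S n. a n s * Re (periodogram n x j k (fourier_freq n s)))"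
      "\<And>n. good n \<Longrightarrow> card (S n) = M n"
      "\<And>n s. good n \<Longrightarrow> s \<in> S n \<Longrightarrow> \<bar>fourier_freq n s - \<theta>\<bar> \<le> 2 * pi * (real (M n) / real n)"
    by (simp_all only: ok[unfolded ok_def])
  have S_sub: "S n \<subseteq> {1..n div 2}" for n
    by (auto simp: S_def good_def reg_indices_def)
  have fin: "finite (S n)" for n
    using S_sub finite_subset by blast
  define W where "W n = cosW (S n) (a n) (fourier_freq n)" for n
  have sum_a: "(\<Sum>s\<in>S n. \<bar>a n s\<bar>) \<le> 40" for n
  proof (cases "good n")
    case True
    then have "(\<Sum>s\<in>S n. \<bar>a n s\<bar>) \<le> (\<Sum>s\<in>S n. 40 / real (M n))"
      by (intro sum_mono a(2))
    also have "\<dots> \<le> 40"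
      using True by (simp add: a(4) good_def)
    finally show ?thesis .
  qed (simp add: S_def)
  have W_lim: "(\<lambda>n. W n h) \<longlonglongrightarrow> cos (\<theta> * real_of_int h)" for h
  proof -
    \<comment> \<open>Since the weights add up to 1, the error is a weighted sum of differences of
      cosines, each at most |h| times the distance of the frequency from \<theta>.\<close>
    have "eventually (\<lambda>n. norm (W n h - cos (\<theta> * real_of_int h)) \<le> 40 * (2 * pi * \<bar>real_of_int h\<bar>) * (real (M n) / real n)) sequentially"
      using ev_good
    proof eventually_elim
      fix n assume n: "good n"
      have "W n h - cos (\<theta> * real_of_int h) =
          (\<Sum>s\<in>S n. a n s * (cos (fourier_freq n s * real_of_int h) - cos (\<theta> * real_of_int h)))"
        unfolding W_def cosW_def right_diff_distrib sum_subtractf sum_distrib_right[symmetric] a(1)[OF n] by simp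
      also have "\<bar>\<dots>\<bar> \<le> (\<Sum>s\<in>S n. \<bar>a n s\<bar> * (2 * pi * (real (M n) / real n) * \<bar>real_of_int h\<bar>))"
      proof (rule order_trans[OF sum_abs sum_mono])
        fix s assume s: "s \<in> S n"
        have "\<bar>cos (fourier_freq n s * real_of_int h) - cos (\<theta> * real_of_int h)\<bar> \<le> \<bar>fourier_freq n s - \<theta>\<bar> * \<bar>real_of_int h\<bar>"
          using abs_cos_diff_le[of "fourier_freq n s * real_of_int h" "\<theta> * real_of_int h"]
          by (simp add: abs_mult[symmetric] left_diff_distrib)
        also have "\<dots> \<le> 2 * pi * (real (M n) / real n) * \<bar>real_of_int h\<bar>"
          by (intro mult_right_mono a(5)[OF n s]) simp
        finally show "\<bar>a n s * (cos (fourier_freq n s * real_of_int h) - cos (\<theta> * real_of_int h))\<bar>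
            \<le> \<bar>a n s\<bar> * (2 * pi * (real (M n) / real n) * \<bar>real_of_int h\<bar>)"
          unfolding abs_mult by (rule mult_left_mono) simp
      qed
      also have "\<dots> \<le> 40 * (2 * pi * (real (M n) / real n) * \<bar>real_of_int h\<bar>)"
        unfolding sum_distrib_right[symmetric] by (intro mult_right_mono sum_a) auto
      finally show "norm (W n h - cos (\<theta> * real_of_int h)) \<le> 40 * (2 * pi * \<bar>real_of_int h\<bar>) * (real (M n) / real n)"
        by (simp add: mult_ac)
    qed
    moreover have "(\<lambda>n. 40 * (2 * pi * \<bar>real_of_int h\<bar>) * (real (M n) / real n)) \<longlonglongrightarrow> 0"
      by (rule tendsto_mult_right_zero) (rule assms(6))
    ultimately have "(\<lambda>n. W n h - cos (\<theta> * real_of_int h)) \<longlonglongrightarrow> 0"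
      by (rule Lim_null_comparison)
    then show ?thesis by (simp add: LIM_zero_iff)
  qed
  have mean_lim: "(\<lambda>n. (\<Sum>p\<in>square_idx n. W n (fst p - snd p) * g (fst p - snd p)) / real n) \<longlonglongrightarrow> L"
    unfolding L_def
  proof (rule weighted_mean_tendsto)
    show "(\<lambda>h. \<bar>g h\<bar>) summable_on UNIV" unfolding g_def by (rule sm)
    show "\<bar>W n h\<bar> \<le> 40" for n h unfolding W_def by (rule abs_cosW_le[OF sum_a])
  qed (rule W_lim)

  define G where "G = infsum (\<lambda>h. \<bar>autocov P X j j h\<bar>) UNIV * infsum (\<lambda>h. \<bar>autocov P X k k h\<bar>) UNIV +
    (infsum (\<lambda>h. \<bar>g h\<bar>) UNIV)\<^sup>2"
  have G0: "0 \<le> G"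
    unfolding G_def by (intro add_nonneg_nonneg mult_nonneg_nonneg infsum_nonneg) auto
  \<comment> \<open>Squared bias, Gaussian variance and cumulant remainder, all divided by n^2. The
    number 1600 = 40^2 arises because M squared weights of size at most (40 / M)^2 add up to at most
    1600 / M.\<close>
  define e where "e n = ((\<Sum>p\<in>square_idx n. W n (fst p - snd p) * g (fst p - snd p)) / real n - L)\<^sup>2
    + G * 1600 * (1 / real (M n)) + R n" for n
  have e_lim: "e \<longlonglongrightarrow> 0"
  proof -
    have "filterlim (\<lambda>n. real (M n)) at_infinity sequentially"
      using filterlim_compose[OF filterlim_real_sequentially assms(5)] by (rule filterlim_at_top_imp_at_infinity)
    then have "(\<lambda>n. 1 / real (M n)) \<longlonglongrightarrow> 0"
      by (rule tendsto_divide_0[OF tendsto_const])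
    then have "e \<longlonglongrightarrow> (L - L)\<^sup>2 + G * 1600 * 0 + 0"
      unfolding e_def[abs_def] by (intro tendsto_intros mean_lim R)
    then show ?thesis by simp
  qed
  define Q where "Q n x = (\<Sum>p\<in>square_idx n. W n (fst p - snd p) * (Y j (fst p) x * Y k (snd p) x))" for n x
  have Q_int: "integrable P (\<lambda>x. (Q n x - real n * L)\<^sup>2)" for n
    unfolding Q_def W_def using bound[OF fin sum_a] by blast
  have Q_bound: "expectation (\<lambda>x. (Q n x - real n * L)\<^sup>2) \<le> e n * (real n)\<^sup>2" if n: "good n" for n
  proof -
    have n0: "0 < n" "0 < M n" using n by (auto simp: good_def)
    have "expectation (\<lambda>x. (Q n x - real n * L)\<^sup>2) \<le>
        ((\<Sum>p\<in>square_idx n. W n (fst p - snd p) * g (fst p - snd p)) - real n * L)\<^sup>2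
          + gauss_var n (W n) (autocov P X j j) (autocov P X k k) g + R n * (real n)\<^sup>2"
      unfolding Q_def W_def using bound[OF fin sum_a] by blast
    moreover have "((\<Sum>p\<in>square_idx n. W n (fst p - snd p) * g (fst p - snd p)) - real n * L)\<^sup>2 =
        ((\<Sum>p\<in>square_idx n. W n (fst p - snd p) * g (fst p - snd p)) / real n - L)\<^sup>2 * (real n)\<^sup>2"
      unfolding power_mult_distrib[symmetric] left_diff_distrib using n0 by (simp add: mult.commute)
    moreover have "gauss_var n (W n) (autocov P X j j) (autocov P X k k) g \<le> G * 1600 * (1 / real (M n)) * (real n)\<^sup>2"
    proof -
      have "(\<Sum>s\<in>S n. (a n s)\<^sup>2) \<le> (\<Sum>s\<in>S n. (40 / real (M n))\<^sup>2)"
        using a(2)[OF n] by (intro sum_mono) (metis abs_ge_zero power2_abs power_mono)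
      also have "\<dots> = 1600 * (1 / real (M n))"
        using n0 by (simp add: a(4)[OF n] power2_eq_square)
      finally have a2: "(\<Sum>s\<in>S n. (a n s)\<^sup>2) \<le> 1600 * (1 / real (M n))" .
      have "gauss_var n (W n) (autocov P X j j) (autocov P X k k) g \<le> G * (\<Sum>p\<in>square_idx n. (W n (fst p - snd p))\<^sup>2)"
        unfolding G_def g_def by (rule gauss_var_le[OF sm sm sm])
      also have "\<dots> \<le> G * ((real n)\<^sup>2 * (\<Sum>s\<in>S n. (a n s)\<^sup>2))"
        unfolding W_def by (intro mult_left_mono cosW_parseval n0 S_sub G0)
      also have "\<dots> \<le> G * ((real n)\<^sup>2 * (1600 * (1 / real (M n))))"
        by (intro mult_left_mono a2 G0) auto
      finally show ?thesis by (simp add: mult_ac)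
    qed
    ultimately show ?thesis
      unfolding e_def by (simp add: distrib_right)
  qed
  have f_Q: "f_tilde n (M n) \<theta> (\<lambda>t. X t x) j k = Q n x / (2 * pi * real n)" if n: "good n" for n x
  proof -
    have "f_tilde n (M n) \<theta> (\<lambda>t. X t x) j k = (\<Sum>s\<in>S n. a n s * Re (periodogram n (\<lambda>t. X t x) j k (fourier_freq n s)))"
      by (rule a(3)[OF n])
    also have "\<dots> = (\<Sum>s\<in>S n. a n s * (1 / (2 * pi * real n) *
        (\<Sum>p\<in>square_idx n. cos (fourier_freq n s * real_of_int (fst p - snd p)) * (Y j (fst p) x * Y k (snd p) x))))"
    proof (rule sum.cong[OF refl])
      fix s assume "s \<in> S n"
      then have "0 < s" "s < n" using S_sub[of n] by fastforce+
      then show "a n s * Re (periodogram n (\<lambda>t. X t x) j k (fourier_freq n s)) = a n s * (1 / (2 * pi * real n) *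
        (\<Sum>p\<in>square_idx n. cos (fourier_freq n s * real_of_int (fst p - snd p)) * (Y j (fst p) x * Y k (snd p) x)))"
        unfolding Y_def by (simp only: Re_periodogram_fourier[where c = "proc_mean P X $ j" and d = "proc_mean P X $ k"])
    qed
    also have "\<dots> = (\<Sum>s\<in>S n. \<Sum>p\<in>square_idx n. 1 / (2 * pi * real n) *
        (a n s * cos (fourier_freq n s * real_of_int (fst p - snd p)) * (Y j (fst p) x * Y k (snd p) x)))"
      by (simp only: sum_distrib_left mult_ac)
    also have "\<dots> = (\<Sum>p\<in>square_idx n. \<Sum>s\<in>S n. 1 / (2 * pi * real n) *
        (a n s * cos (fourier_freq n s * real_of_int (fst p - snd p)) * (Y j (fst p) x * Y k (snd p) x)))"
      by (rule sum.swap)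
    also have "\<dots> = 1 / (2 * pi * real n) * Q n x"
      unfolding Q_def W_def cosW_def sum_distrib_right sum_distrib_left ..
    finally show ?thesis by simp
  qed
  have prob_bound: "measure P {\<omega> \<in> space P. cmod (complex_of_real (f_tilde n (M n) \<theta> (\<lambda>t. X t \<omega>) j k) - spec_dens P X j k \<theta>) > \<epsilon>}
      \<le> e n / (2 * pi * \<epsilon>)\<^sup>2" if n: "good n" for n
  proof -
    have n0: "0 < n" using n by (auto simp: good_def)
    \<comment> \<open>The deviation \<epsilon> on the scale of \<open>Q\<close>, which is 2 pi n
      times the estimator; squared for Chebyshev's inequality.\<close>
    let ?c = "(2 * pi * \<epsilon> * real n)\<^sup>2"
    have c0: "0 < ?c" using n0 \<open>\<epsilon> > 0\<close> by simp
    have "measure P {\<omega> \<in> space P. cmod (complex_of_real (f_tilde n (M n) \<theta> (\<lambda>t. X t \<omega>) j k) - spec_dens P X j k \<theta>) > \<epsilon>}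
      \<le> measure P {\<omega> \<in> space P. (Q n \<omega> - real n * L)\<^sup>2 \<ge> ?c}"
    proof (rule finite_measure_mono)
      show "{\<omega> \<in> space P. (Q n \<omega> - real n * L)\<^sup>2 \<ge> ?c} \<in> sets P"
        using borel_measurable_integrable[OF Q_int[of n]] by measurable
      show "{\<omega> \<in> space P. cmod (complex_of_real (f_tilde n (M n) \<theta> (\<lambda>t. X t \<omega>) j k) - spec_dens P X j k \<theta>) > \<epsilon>} \<subseteq>
        {\<omega> \<in> space P. (Q n \<omega> - real n * L)\<^sup>2 \<ge> ?c}"
      proof safe
        fix \<omega> assume "\<epsilon> < cmod (complex_of_real (f_tilde n (M n) \<theta> (\<lambda>t. X t \<omega>) j k) - spec_dens P X j k \<theta>)"
        then have "\<epsilon> < \<bar>Q n \<omega> / (2 * pi * real n) - L / (2 * pi)\<bar>"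
          unfolding f_Q[OF n] spec_dens_endpoint[OF \<theta> sm] L_def g_def of_real_diff[symmetric] norm_of_real .
        also have "Q n \<omega> / (2 * pi * real n) - L / (2 * pi) = (Q n \<omega> - real n * L) / (2 * pi * real n)"
          using n0 by (simp add: field_simps)
        finally have "2 * pi * \<epsilon> * real n \<le> \<bar>Q n \<omega> - real n * L\<bar>"
          using n0 by (simp add: field_simps)
        then have "?c \<le> \<bar>Q n \<omega> - real n * L\<bar>\<^sup>2"
          using \<open>\<epsilon> > 0\<close> by (intro power_mono) auto
        then show "?c \<le> (Q n \<omega> - real n * L)\<^sup>2" by simp
      qed
    qed
    also have "\<dots> \<le> expectation (\<lambda>x. (Q n x - real n * L)\<^sup>2) / ?c"
      by (rule integral_Markov_inequality_measure[OF Q_int sets.top _ c0]) simp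
    also have "\<dots> \<le> e n * (real n)\<^sup>2 / ?c"
      using c0 by (intro divide_right_mono Q_bound n) simp
    also have "\<dots> = e n / (2 * pi * \<epsilon>)\<^sup>2"
      using n0 by (simp add: power_mult_distrib)
    finally show ?thesis .
  qed
  show "(\<lambda>n. measure P {\<omega> \<in> space P.
            cmod (complex_of_real (f_tilde n (M n) \<theta> (\<lambda>t. X t \<omega>) j k) - spec_dens P X j k \<theta>) > \<epsilon>}) \<longlonglongrightarrow> 0"
  proof (rule tendsto_sandwich[where f = "\<lambda>_. 0" and h = "\<lambda>n. e n / (2 * pi * \<epsilon>)\<^sup>2"])
    show "(\<lambda>n. e n / (2 * pi * \<epsilon>)\<^sup>2) \<longlonglongrightarrow> 0"
      using e_lim by (rule tendsto_divide_zero)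
    show "eventually (\<lambda>n. measure P {\<omega> \<in> space P. cmod (complex_of_real (f_tilde n (M n) \<theta> (\<lambda>t. X t \<omega>) j k) - spec_dens P X j k \<theta>) > \<epsilon>}
        \<le> e n / (2 * pi * \<epsilon>)\<^sup>2) sequentially"
      using ev_good by eventually_elim (rule prob_bound)
  qed auto
qed

end
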